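(* Assume the Orlicz function $\Psi$ satisfies $\Delta^0$ and $\phi\colon\mathbb D\to\mathbb D$ is analytic. If $C_\phi\colon H^\Psi\to H^\Psi$ is weakly compact, then $$\sup_{a\in\mathbb T}\|C_\phi(u_{a,r})\|_\Psi=o\Big(\frac{1}{\Psi^{-1}(1/(1-r))}\Big)\quad\text{as } r\to1.$$
   Context: An Orlicz function is a continuous, strictly convex, increasing $\Psi\colon[0,\infty)\to[0,\infty)$ with $\Psi(0)=0$ and $\Psi(x)/x\to\infty$. $H^\Psi$ = analytic $f$ on $\mathbb D$ with $\sup_{r<1}\|f(re^{i\cdot})\|_\Psi<\infty$ where $\|g\|_\Psi=\inf\{C>0:\int_{\mathbb T}\Psi(|g|/C)\,dm\le1\}$; normed by the Luxemburg norm of its boundary function. $C_\phi f=f\circ\phi$. $\Delta^0$: there is $\beta>1$ with $\Psi(\beta x)/\Psi(x)\to\infty$. For $|a|=1$, $0\le r<1$: $u_{a,r}(z)=\big(\frac{1-r}{1-\bar a rz}\big)^2$. *)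

theory Defs
  imports "HOL-Analysis.Analysis"
begin

definition strictly_convex_on :: "real set \<Rightarrow> (real \<Rightarrow> real) \<Rightarrow> bool" where
  "strictly_convex_on S f \<longleftrightarrow> (\<forall>x\<in>S. \<forall>y\<in>S. \<forall>t. x \<noteq> y \<and> 0 < t \<and> t < 1 \<longrightarrow>
      f ((1 - t) * x + t * y) < (1 - t) * f x + t * f y)"

definition orlicz_fn :: "(real \<Rightarrow> real) \<Rightarrow> bool" where
  "orlicz_fn \<Psi> \<longleftrightarrow> continuous_on {0..} \<Psi> \<and> strictly_convex_on {0..} \<Psi> \<and>
     strict_mono_on {0..} \<Psi> \<and> \<Psi> 0 = 0 \<and> (\<forall>x\<ge>0. \<Psi> x \<ge> 0) \<and>
     filterlim (\<lambda>x. \<Psi> x / x) at_top at_top"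

definition Delta0 :: "(real \<Rightarrow> real) \<Rightarrow> bool" where
  "Delta0 \<Psi> \<longleftrightarrow> (\<exists>\<beta>>1. filterlim (\<lambda>x. \<Psi> (\<beta> * x) / \<Psi> x) at_top at_top)"

definition orlicz_inv :: "(real \<Rightarrow> real) \<Rightarrow> real \<Rightarrow> real" where
  "orlicz_inv \<Psi> = the_inv_into {0..} \<Psi>"

text \<open>Luxemburg norm on the circle, with normalized Lebesgue measure dm = dt/(2 pi), t in [0, 2 pi]\<close>
definition luxemburg :: "(real \<Rightarrow> real) \<Rightarrow> (real \<Rightarrow> complex) \<Rightarrow> real" where
  "luxemburg \<Psi> g = Inf {C. C > 0 \<and>
     (\<integral>\<^sup>+ t. ennreal (\<Psi> (cmod (g t) / C) / (2 * pi)) * indicator {0..2*pi} t \<partial>lborel) \<le> 1}"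

definition hardy_orlicz :: "(real \<Rightarrow> real) \<Rightarrow> (complex \<Rightarrow> complex) set" where
  "hardy_orlicz \<Psi> = {f. f holomorphic_on ball 0 1 \<and>
     bdd_above ((\<lambda>r. luxemburg \<Psi> (\<lambda>t. f (complex_of_real r * cis t))) ` {0..<1})}"

definition boundary_fn :: "(complex \<Rightarrow> complex) \<Rightarrow> real \<Rightarrow> complex" where
  "boundary_fn f t = Lim (at_left 1) (\<lambda>r::real. f (complex_of_real r * cis t))"

definition ho_norm :: "(real \<Rightarrow> real) \<Rightarrow> (complex \<Rightarrow> complex) \<Rightarrow> real" where
  "ho_norm \<Psi> f = luxemburg \<Psi> (boundary_fn f)"

definition ho_dual :: "(real \<Rightarrow> real) \<Rightarrow> ((complex \<Rightarrow> complex) \<Rightarrow> complex) set" where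
  "ho_dual \<Psi> = {L. (\<forall>f\<in>hardy_orlicz \<Psi>. \<forall>g\<in>hardy_orlicz \<Psi>. \<forall>a b::complex.
        L (\<lambda>z. a * f z + b * g z) = a * L f + b * L g) \<and>
      (\<exists>K. \<forall>f\<in>hardy_orlicz \<Psi>. cmod (L f) \<le> K * ho_norm \<Psi> f)}"

definition ho_weak_topology :: "(real \<Rightarrow> real) \<Rightarrow> (complex \<Rightarrow> complex) topology" where
  "ho_weak_topology \<Psi> = subtopology
     (topology_generated_by {{f. L f \<in> U} | L U. L \<in> ho_dual \<Psi> \<and> open U})
     (hardy_orlicz \<Psi>)"

definition ho_weakly_compact :: "(real \<Rightarrow> real) \<Rightarrow> ((complex \<Rightarrow> complex) \<Rightarrow> (complex \<Rightarrow> complex)) \<Rightarrow> bool" where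
  "ho_weakly_compact \<Psi> T \<longleftrightarrow>
     (\<forall>f\<in>hardy_orlicz \<Psi>. T f \<in> hardy_orlicz \<Psi>) \<and>
     (\<exists>K. \<forall>f\<in>hardy_orlicz \<Psi>. ho_norm \<Psi> (T f) \<le> K * ho_norm \<Psi> f) \<and>
     compactin (ho_weak_topology \<Psi>)
       (ho_weak_topology \<Psi> closure_of (T ` {f \<in> hardy_orlicz \<Psi>. ho_norm \<Psi> f \<le> 1}))"

definition comp_op :: "(complex \<Rightarrow> complex) \<Rightarrow> (complex \<Rightarrow> complex) \<Rightarrow> (complex \<Rightarrow> complex)" where
  "comp_op \<phi> f = f \<circ> \<phi>"

definition u_fn :: "complex \<Rightarrow> real \<Rightarrow> complex \<Rightarrow> complex" where
  "u_fn a r z = ((1 - complex_of_real r) / (1 - cnj a * complex_of_real r * z)) ^ 2"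

end

theory Submission
  imports Defs "HOL-Complex_Analysis.Complex_Analysis"
begin

text \<open>Suppose \<open>\<parallel>C\<^sub>\<phi> u\<^bsub>a,r\<^esub>\<parallel> \<ge> \<delta> / \<Psi>\<^sup>-\<^sup>1(1/(1-r))\<close> for some \<open>r\<close> arbitrarily close to 1. The functions
  \<open>f = \<Psi>\<^sup>-\<^sup>1(1/(1-r)) u\<^bsub>a,r\<^esub>\<close> are bounded in norm and tend to 0 in \<open>L\<^sup>1\<close>, and so do their
  images under \<open>C\<^sub>\<phi>\<close>. Thanks to \<open>\<Delta>\<^sup>0\<close> a sufficiently sparse sequence of them behaves like the unit vector
  basis of \<open>c\<^sub>0\<close>: the partial sums stay bounded in norm. An explicit norming weight gives functionals \<open>G\<^sub>n\<close> of
  norm at most 1 that are bounded below on the \<open>n\<close>-th image and almost vanish on all the other ones. A weak cluster point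
  \<open>g\<close> of the images of the partial sums then satisfies \<open>|G\<^sub>n(g)| \<ge> e > 0\<close> for all \<open>n\<close>, whereas a
  weak-star cluster point of the \<open>G\<^sub>n\<close> annihilates all the partial sums and hence \<open>g\<close>.

  For \<open>G\<^sub>n\<close> to be bounded in terms of boundary values, functions in \<open>H\<^sup>\<Psi>\<close> must be dominated by the Poisson
  integrals of their radial limits. Since \<open>\<Delta>\<^sup>0\<close> forces \<open>H\<^sup>\<Psi> \<subseteq> H\<^sup>2\<close>, Fatou's theorem is only needed in
  \<open>H\<^sup>2\<close>; the maximal inequality behind it comes from Garsia's maximal ergodic lemma for the Poisson semigroup,
  combined with Harnack's inequality to pass from averages to single radii.\<close>

subsection \<open>Normalised Lebesgue measure on the circle\<close>

text \<open>Apart from having a large image, all that a new block has to satisfy is a list of upper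
  bounds for one number, c (1 - r) with c = \<open>orlicz_inv \<Psi> (1 / (1 - r))\<close>, and
  superlinear growth makes this number tend to 0. The bounds depend on the past only through two
  numbers: a sup bound for the partial sum of the earlier functions and a sup bound for the earlier
  weights. Both are finite because each block is bounded on the disc and each functional integrates
  over a single circle inside the disc, against a bounded weight. For this reason largeness of an
  image is expressed by the integral of \<Psi> over an interior circle, although the norm is that of
  the boundary function. Weak topologies need not be metrizable, so cluster points replace
  convergent subsequences, and the contradiction has to work with events that happen frequently
  instead of eventually.\<close>

definition circ :: "real measure" where
  "circ = uniform_measure lborel {0..2*pi}"

lemma space_circ [simp]: "space circ = UNIV"
  and sets_circ [simp, measurable_cong]: "sets circ = sets borel"
  by (simp_all add: circ_def)

lemma circ_density: "circ = density lborel (\<lambda>x. ennreal (indicator {0..2*pi} x / (2*pi)))"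
  unfolding circ_def uniform_measure_def
  by (intro density_cong) (auto simp: divide_ennreal[symmetric] ennreal_indicator)

lemma emeasure_circ_UNIV [simp]: "emeasure circ UNIV = 1"
  unfolding circ_def
  by (subst emeasure_uniform_measure) (auto simp: divide_ennreal ennreal_mult[symmetric])

lemma finite_measure_circ: "finite_measure circ"
  by (rule finite_measureI) simp

interpretation circ: finite_measure circ
  by (rule finite_measure_circ)

lemma measure_circ_UNIV [simp]: "measure circ UNIV = 1"
  by (simp add: measure_def)

lemma AE_circ: "(AE t in circ. P t) \<longleftrightarrow> (AE t in lborel. t \<in> {0..2*pi} \<longrightarrow> P t)"
  unfolding circ_def by (rule AE_uniform_measure) auto

text \<open>The left side is the integral in the form used by \<open>luxemburg\<close>; all
  estimates are made with \<open>circ\<close>.\<close>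

lemma nn_integral_circ:
  assumes [measurable]: "f \<in> borel_measurable borel" and "\<And>t. f t \<ge> 0"
  shows "(\<integral>\<^sup>+ t. ennreal (f t / (2*pi)) * indicator {0..2*pi} t \<partial>lborel) = (\<integral>\<^sup>+ t. ennreal (f t) \<partial>circ)"
  unfolding circ_density
  by (subst nn_integral_density)
     (use assms(2) in \<open>auto intro!: nn_integral_cong simp: indicator_def ennreal_mult[symmetric]\<close>)

lemma integrable_circ_bounded:
  fixes f :: "real \<Rightarrow> 'a::{banach, second_countable_topology}"
  assumes "f \<in> borel_measurable borel" and "\<And>t. norm (f t) \<le> B"
  shows "integrable circ f"
  by (rule circ.integrable_const_bound[of _ B]) (use assms in \<open>auto simp: measurable_cong_sets[OF sets_circ refl]\<close>)

lemma integral_circ_eq: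
  fixes f :: "real \<Rightarrow> 'a::euclidean_space"
  assumes "continuous_on UNIV f"
  shows "integral\<^sup>L circ f = integral {0..2*pi} f /\<^sub>R (2*pi)"
proof -
  have [measurable]: "f \<in> borel_measurable borel"
    using assms by (rule borel_measurable_continuous_onI)
  have "integral\<^sup>L circ f = (\<integral>x. (indicator {0..2*pi} x / (2*pi)) *\<^sub>R f x \<partial>lborel)"
    unfolding circ_density by (rule integral_density) auto
  also have "\<dots> = (\<integral>x. (1 / (2*pi)) *\<^sub>R (indicator {0..2*pi} x *\<^sub>R f x) \<partial>lborel)"
    by (intro Bochner_Integration.integral_cong) (auto simp: indicator_def)
  also have "\<dots> = (1 / (2*pi)) *\<^sub>R (LINT x : {0..2*pi} | lborel. f x)"
    unfolding set_lebesgue_integral_def by (rule integral_scaleR_right)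
  also have "(LINT x : {0..2*pi} | lborel. f x) = integral {0..2*pi} f"
    by (intro set_borel_integral_eq_integral borel_integrable_atLeastAtMost')
       (use assms continuous_on_subset in blast)
  finally show ?thesis
    by (simp only: inverse_eq_divide)
qed

subsection \<open>The Poisson kernel\<close>

text \<open>The kernel of the point with radius \<open>q\<close> and angle \<open>t\<close>, at the
  boundary angle \<open>s\<close>. The denominator is the squared distance of the two
  points.\<close>

definition poisson :: "real \<Rightarrow> real \<Rightarrow> real \<Rightarrow> real" where
  "poisson q t s = (1 - q\<^sup>2) / (1 - 2 * q * cos (t - s) + q\<^sup>2)"

lemma norm_cis_diff_squared: "(cmod (cis s - of_real q * cis t))\<^sup>2 = 1 - 2 * q * cos (t - s) + q\<^sup>2"
proof -
  have "(cmod (cis s - of_real q * cis t))\<^sup>2 = (cos s - q * cos t)\<^sup>2 + (sin s - q * sin t)\<^sup>2"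
    by (simp add: cmod_power2)
  also have "\<dots> = ((cos s)\<^sup>2 + (sin s)\<^sup>2) + q\<^sup>2 * ((cos t)\<^sup>2 + (sin t)\<^sup>2) - 2 * q * (cos t * cos s + sin t * sin s)"
    by (simp only: power2_eq_square) algebra
  finally show ?thesis
    by (simp add: cos_diff)
qed

lemma poisson_denom_ge:
  fixes q t s :: real
  assumes "0 \<le> q"
  shows "(1 - q)\<^sup>2 \<le> 1 - 2 * q * cos (t - s) + q\<^sup>2"
  using mult_left_mono[OF cos_le_one[of "t - s"], of "2 * q"] assms
  by (simp add: power2_eq_square algebra_simps)

lemma poisson_denom_pos:
  fixes q t s :: real
  assumes "0 \<le> q" "q < 1"
  shows "0 < 1 - 2 * q * cos (t - s) + q\<^sup>2"
  using poisson_denom_ge[OF assms(1), of t s] assms(2) by (smt (verit) zero_less_power2)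

lemma poisson_pos: "0 \<le> q \<Longrightarrow> q < 1 \<Longrightarrow> 0 < poisson q t s"
  unfolding poisson_def using poisson_denom_pos[of q t s]
  by (intro divide_pos_pos) (auto simp: power_less_one_iff abs_square_less_1)

lemma poisson_le:
  assumes "0 \<le> q" "q < 1"
  shows "poisson q t s \<le> 1 / (1 - q)\<^sup>2"
  unfolding poisson_def
  using poisson_denom_ge[OF assms(1), of t s] assms by (intro frac_le) auto

lemma poisson_sym: "poisson q t s = poisson q s t"
  unfolding poisson_def by (metis cos_minus minus_diff_eq)

lemma continuous_on_poisson:
  fixes f g :: "real \<Rightarrow> real"
  assumes "0 \<le> q" "q < 1" "continuous_on S f" "continuous_on S g"
  shows "continuous_on S (\<lambda>x. poisson q (f x) (g x))"
proof -
  have "1 - 2 * q * cos (f x - g x) + q\<^sup>2 \<noteq> 0" for x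
    using poisson_denom_pos[OF assms(1,2), of "f x" "g x"] by linarith
  then show ?thesis
    unfolding poisson_def by (intro continuous_on_divide continuous_intros assms) blast
qed

lemma poisson_measurable [measurable]: "(\<lambda>x. poisson q (fst x) (snd x)) \<in> borel_measurable borel"
  unfolding poisson_def by (intro borel_measurable_divide borel_measurable_continuous_onI continuous_intros)

lemma poisson_measurable2 [measurable]:
  "(\<lambda>(t, s). poisson q t s) \<in> borel_measurable (borel \<Otimes>\<^sub>M borel)"
  using poisson_measurable by (simp add: borel_prod case_prod_beta')

lemma poisson_measurable1 [measurable]: "poisson q t \<in> borel_measurable borel"
  "(\<lambda>t. poisson q t s) \<in> borel_measurable borel"
  unfolding poisson_def by measurable

text \<open>Cauchy's formula at \<open>z\<close> for the auxiliary function \<open>F\<close>, which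
  agrees with \<open>f\<close> at \<open>z\<close>. On the unit circle the conjugate of cis s is its
  inverse, and the extra denominator turns the Cauchy kernel into the Poisson kernel.\<close>

lemma poisson_integral_formula:
  assumes hol: "f holomorphic_on S" and S: "cball 0 1 \<subseteq> S" and q: "0 \<le> q" "q < 1"
  shows "(\<integral>s. of_real (poisson q t s) * f (cis s) \<partial>circ) = f (of_real q * cis t)"
proof -
  define z where "z = of_real q * cis t"
  define F where "F w = f w * (1 - of_real (q\<^sup>2)) / (1 - cnj z * w)" for w
  have z: "cmod z = q" using q by (simp add: z_def norm_mult)
  have ne: "1 - cnj z * w \<noteq> 0" if "w \<in> cball 0 1" for w
  proof
    assume "1 - cnj z * w = 0"
    then have "cmod (cnj z * w) = 1" by (metis eq_iff_diff_eq_0 norm_one)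
    moreover have "q * cmod w \<le> q * 1" using that q by (intro mult_left_mono) auto
    ultimately show False using z q by (simp add: norm_mult)
  qed
  have "F holomorphic_on cball 0 1"
    unfolding F_def using ne by (intro holomorphic_intros holomorphic_on_subset[OF hol S]) auto
  then have "((\<lambda>u. F u / (u - z)) has_contour_integral (2 * of_real pi * \<i> * F z)) (circlepath 0 1)"
    using z q by (intro Cauchy_integral_circlepath_simple) auto
  then have I: "((\<lambda>s. F (cis s) / (cis s - z) * (\<i> * cis s)) has_integral (2 * of_real pi * \<i> * F z)) {0..2*pi}"
    unfolding circlepath_def using has_contour_integral_part_circlepath_iff[of 0 "2*pi" _ _ 0 1]
    by (simp add: mult.assoc)
  have "cnj z * z = of_real (q\<^sup>2)"
    using z by (metis complex_norm_square mult.commute)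
  then have "F z = f z"
    using ne[of z] z q by (simp add: F_def)
  moreover have eq: "F (cis s) / (cis s - z) * (\<i> * cis s) = \<i> * (of_real (poisson q t s) * f (cis s))" for s
  proof -
    have "cis s * cnj (cis s) = 1" by (simp add: cis_cnj cis_mult)
    then have "1 - cnj z * cis s = cis s * cnj (cis s - z)" by (simp add: right_diff_distrib mult.commute)
    then have "(1 - cnj z * cis s) * (cis s - z) = cis s * ((cis s - z) * cnj (cis s - z))"
      by (simp only: mult_ac)
    also have "\<dots> = cis s * of_real ((cmod (cis s - z))\<^sup>2)"
      by (simp only: complex_norm_square)
    also have "\<dots> = cis s * of_real (1 - 2 * q * cos (t - s) + q\<^sup>2)"
      by (simp only: z_def norm_cis_diff_squared)
    finally have *: "(1 - cnj z * cis s) * (cis s - z) = cis s * of_real (1 - 2 * q * cos (t - s) + q\<^sup>2)" .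
    have "F (cis s) / (cis s - z) * (\<i> * cis s)
        = f (cis s) * (1 - of_real (q\<^sup>2)) * \<i> * cis s / ((1 - cnj z * cis s) * (cis s - z))"
      by (simp add: F_def)
    also have "\<dots> = \<i> * (of_real (poisson q t s) * f (cis s))"
      unfolding * poisson_def by (simp add: cis_neq_zero)
    finally show ?thesis .
  qed
  ultimately have "((\<lambda>s. \<i> * (of_real (poisson q t s) * f (cis s))) has_integral (2 * of_real pi * \<i> * f z)) {0..2*pi}"
    using I by simp
  from has_integral_mult_right[OF this, of "-\<i>"]
  have "((\<lambda>s. (-\<i> * \<i>) * (of_real (poisson q t s) * f (cis s))) has_integral ((-\<i> * \<i>) * (2 * of_real pi * f z))) {0..2*pi}"
    by (simp only: mult_ac)
  then have "((\<lambda>s. of_real (poisson q t s) * f (cis s)) has_integral (2 * of_real pi * f z)) {0..2*pi}"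
    by (simp only: mult_minus_left i_squared minus_minus mult_1)
  then have "integral {0..2*pi} (\<lambda>s. of_real (poisson q t s) * f (cis s)) = 2 * of_real pi * f z"
    by (rule integral_unique)
  moreover have "continuous_on UNIV (\<lambda>s. of_real (poisson q t s) * f (cis s))"
    by (intro continuous_intros continuous_on_poisson q
         continuous_on_compose2[OF holomorphic_on_imp_continuous_on[OF hol]])
       (use S in auto)
  ultimately show ?thesis
    by (subst integral_circ_eq) (auto simp: z_def scaleR_conv_of_real)
qed

lemma poisson_integral_one:
  assumes q: "0 \<le> q" "q < 1"
  shows "(\<integral>s. poisson q t s \<partial>circ) = 1" "(\<integral>s. poisson q s t \<partial>circ) = 1"
proof -
  have "(\<integral>s. of_real (poisson q t s) * (1::complex) \<partial>circ) = 1"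
    by (rule poisson_integral_formula[where S=UNIV and f="\<lambda>_. 1"]) (use q in auto)
  then have "complex_of_real (\<integral>s. poisson q t s \<partial>circ) = 1"
    by simp
  then show "(\<integral>s. poisson q t s \<partial>circ) = 1" by (simp only: of_real_eq_1_iff)
  then show "(\<integral>s. poisson q s t \<partial>circ) = 1" by (simp add: poisson_sym[of q _ t])
qed

lemma integrable_poisson_mult:
  fixes f :: "real \<Rightarrow> 'a::{real_normed_algebra_1, banach, second_countable_topology}"
  assumes q: "0 \<le> q" "q < 1" and [measurable]: "f \<in> borel_measurable borel" and B: "\<And>s. norm (f s) \<le> B"
  shows "integrable circ (\<lambda>s. of_real (poisson q t s) * f s)"
proof (rule integrable_circ_bounded[where B="1 / (1 - q)\<^sup>2 * B"])
  show "(\<lambda>s. of_real (poisson q t s) * f s) \<in> borel_measurable borel" by measurable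
  fix s
  have "norm (of_real (poisson q t s) * f s) \<le> poisson q t s * norm (f s)"
    using norm_mult_ineq[of "of_real (poisson q t s)" "f s"] poisson_pos[OF q, of t s] by simp
  also have "\<dots> \<le> 1 / (1 - q)\<^sup>2 * B"
    by (intro mult_mono poisson_le q B) auto
  finally show "norm (of_real (poisson q t s) * f s) \<le> 1 / (1 - q)\<^sup>2 * B" .
qed

lemma integrable_poisson: 
  assumes q: "0 \<le> q" "q < 1" 
  shows "integrable circ (poisson q t)" "integrable circ (\<lambda>s. poisson q s t)"
  using integrable_poisson_mult[OF q, of "\<lambda>_. 1::real" 1 t] poisson_sym[of q _ t]
  by auto

lemma nn_integral_poisson_one:
  assumes q: "0 \<le> q" "q < 1"
  shows "(\<integral>\<^sup>+s. ennreal (poisson q t s) \<partial>circ) = 1" "(\<integral>\<^sup>+s. ennreal (poisson q s t) \<partial>circ) = 1"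
  by (subst nn_integral_eq_integral; use integrable_poisson[OF q] poisson_pos[OF q] poisson_integral_one[OF q] 
      in \<open>auto intro!: AE_I2 less_imp_le\<close>)+

text \<open>The kernel with parameter \<open>p\<close> is the real part of the function
  \<open>f\<close> below, which is holomorphic across the closed disc. The Poisson formula at radius
  \<open>q\<close> evaluates it at the dilated point.\<close>

lemma poisson_semigroup:
  assumes q: "0 \<le> q" "q < 1" and p: "0 \<le> p" "p < 1"
  shows "(\<integral>x. poisson q t x * poisson p x s \<partial>circ) = poisson (q * p) t s"
proof -
  define f where "f w = (1 + of_real p * cis (-s) * w) / (1 - of_real p * cis (-s) * w)" for w
  define S where "S = {w::complex. p * cmod w < 1}"
  have ne: "1 - of_real p * cis (-s) * w \<noteq> 0" if "w \<in> S" for w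
  proof
    assume "1 - of_real p * cis (-s) * w = 0"
    then have "cmod (of_real p * cis (-s) * w) = 1" by (metis eq_iff_diff_eq_0 norm_one)
    then show False using that p by (simp add: norm_mult S_def)
  qed
  have hol: "f holomorphic_on S"
    unfolding f_def using ne by (intro holomorphic_intros) auto
  have S: "cball 0 1 \<subseteq> S"
  proof
    fix w :: complex assume "w \<in> cball 0 1"
    then have "p * cmod w \<le> p * 1" using p by (intro mult_left_mono) auto
    then show "w \<in> S" using p by (simp add: S_def)
  qed
  have Re: "Re (f (of_real a * cis x)) = poisson (a * p) x s" if "0 \<le> a" "a \<le> 1" for a x
  proof -
    define d where "d = of_real (a * p) * cis (x - s)"
    have "cis (-s) * cis x = cis (x - s)" by (simp add: cis_mult)
    then have "of_real p * cis (-s) * (of_real a * cis x) = d"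
      unfolding d_def of_real_mult by (metis mult.assoc mult.commute)
    then have d: "f (of_real a * cis x) = (1 + d) / (1 - d)"
      by (simp add: f_def)
    have "Re ((1 + d) / (1 - d)) = (1 - (cmod d)\<^sup>2) / (cmod (1 - d))\<^sup>2"
      unfolding Re_divide cmod_power2 by (simp add: power2_eq_square algebra_simps)
    also have "(cmod d)\<^sup>2 = (a * p)\<^sup>2"
      by (simp add: d_def norm_mult power_mult_distrib)
    also have "(cmod (1 - d))\<^sup>2 = 1 - 2 * (a * p) * cos (x - s) + (a * p)\<^sup>2"
      using norm_cis_diff_squared[of 0 "a * p" "x - s"] by (simp add: d_def)
    finally show ?thesis by (simp add: d poisson_def)
  qed
  have "continuous_on UNIV (\<lambda>x. f (cis x))"
    by (rule continuous_on_compose2[OF holomorphic_on_imp_continuous_on[OF hol]]) (use S in \<open>auto intro!: continuous_intros\<close>)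
  then have "continuous_on UNIV (\<lambda>x. of_real (poisson q t x) * f (cis x))"
    by (intro continuous_intros continuous_on_poisson q)
  moreover have "compact (cball (0::complex) 1)" by simp
  then have "bounded (f ` cball 0 1)"
    by (intro compact_imp_bounded compact_continuous_image holomorphic_on_imp_continuous_on holomorphic_on_subset[OF hol S]) 
  then obtain B where B: "\<And>w. w \<in> cball 0 1 \<Longrightarrow> norm (f w) \<le> B"
    unfolding bounded_iff by (metis imageI)
  ultimately have "integrable circ (\<lambda>x. of_real (poisson q t x) * f (cis x))"
    by (intro integrable_poisson_mult[where B=B] q B borel_measurable_continuous_onI \<open>continuous_on UNIV (\<lambda>x. f (cis x))\<close>) auto
  then have "Re (\<integral>x. of_real (poisson q t x) * f (cis x) \<partial>circ) = (\<integral>x. Re (of_real (poisson q t x) * f (cis x)) \<partial>circ)"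
    by (rule integral_Re[symmetric])
  also have "\<dots> = (\<integral>x. poisson q t x * poisson p x s \<partial>circ)"
    using Re[of 1] by simp
  finally show ?thesis
    using poisson_integral_formula[OF hol S q, of t] Re[of q t] q by simp
qed

text \<open>Passing from radius \<open>q\<close> to \<open>p\<close> moves the point by at most 1 -
  q, hence by no more than its distance to any boundary point. Distances to the boundary at most
  double, squaring gives the 4, and the numerators only help.\<close>

lemma poisson_Harnack:
  assumes q: "0 \<le> q" "q < 1" and p: "q\<^sup>2 \<le> p" "p \<le> q"
  shows "poisson q t s \<le> 4 * poisson p t s"
proof -
  have p0: "0 \<le> p" "p < 1" using p q by (auto intro: order_trans[OF zero_le_power2])
  have "q - p \<le> 1 - q"
    using p(1) zero_le_power2[of "1 - q"] by (simp add: power2_eq_square algebra_simps)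
  have "cmod (cis s - of_real p * cis t) \<le> cmod (cis s - of_real q * cis t) + cmod (of_real (q - p) * cis t)"
    using norm_triangle_ineq[of "cis s - of_real q * cis t" "of_real (q - p) * cis t"] by (simp add: algebra_simps)
  also have "cmod (of_real (q - p) * cis t) = q - p" using p by (simp only: norm_mult norm_of_real norm_cis) simp
  also have "q - p \<le> cmod (cis s - of_real q * cis t)"
    using norm_triangle_ineq2[of "cis s" "of_real q * cis t"] q \<open>q - p \<le> 1 - q\<close> by (simp add: norm_mult)
  finally have "cmod (cis s - of_real p * cis t) \<le> 2 * cmod (cis s - of_real q * cis t)" by simp
  then have "(cmod (cis s - of_real p * cis t))\<^sup>2 \<le> (2 * cmod (cis s - of_real q * cis t))\<^sup>2"
    by (intro power_mono) auto
  then have d: "1 - 2 * p * cos (t - s) + p\<^sup>2 \<le> 4 * (1 - 2 * q * cos (t - s) + q\<^sup>2)"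
    by (simp only: power_mult_distrib norm_cis_diff_squared) simp
  have "poisson q t s = 4 * ((1 - q\<^sup>2) / (4 * (1 - 2 * q * cos (t - s) + q\<^sup>2)))"
    by (simp only: poisson_def mult_divide_mult_cancel_left_if times_divide_eq_right) simp
  also have "\<dots> \<le> 4 * ((1 - p\<^sup>2) / (1 - 2 * p * cos (t - s) + p\<^sup>2))"
    using q p p0 poisson_denom_pos[OF p0, of t s] d
    by (intro mult_left_mono frac_le) (auto simp: abs_square_le_1 intro: power_mono)
  finally show ?thesis by (simp add: poisson_def)
qed

subsection \<open>The Poisson semigroup and its maximal function\<close>

text \<open>A class closed under the operations needed below and contained in the integrable
  functions, so that integrability goals reduce to introduction rules. Radial limits need not belong
  to it; they occur under nonnegative integrals.\<close>

definition bounded_borel :: "(real \<Rightarrow> 'a::{banach, second_countable_topology}) \<Rightarrow> bool" where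
  "bounded_borel f \<longleftrightarrow> f \<in> borel_measurable borel \<and> (\<exists>B. \<forall>x. norm (f x) \<le> B)"

lemma bounded_borelI: "f \<in> borel_measurable borel \<Longrightarrow> (\<And>x. norm (f x) \<le> B) \<Longrightarrow> bounded_borel f"
  by (auto simp: bounded_borel_def)

lemma bounded_borelE:
  assumes "bounded_borel f"
  obtains B where "f \<in> borel_measurable borel" "\<And>x. norm (f x) \<le> B" "0 \<le> B"
  using assms unfolding bounded_borel_def by (meson norm_ge_zero order_trans)

lemma bounded_borel_measurable [measurable_dest]: "bounded_borel f \<Longrightarrow> f \<in> borel_measurable borel"
  by (simp add: bounded_borel_def)

lemma bounded_borel_integrable: "bounded_borel f \<Longrightarrow> integrable circ f"
  by (auto simp: bounded_borel_def intro: integrable_circ_bounded)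

lemma bounded_borel_const [simp]: "bounded_borel (\<lambda>_. c)"
  by (rule bounded_borelI[of _ "norm c"]) auto

lemma bounded_borel_add:
  assumes "bounded_borel f" "bounded_borel g" shows "bounded_borel (\<lambda>x. f x + g x)"
proof -
  from assms obtain A B where [measurable]: "f \<in> borel_measurable borel" "g \<in> borel_measurable borel"
    and "\<And>x. norm (f x) \<le> A" "\<And>x. norm (g x) \<le> B" by (meson bounded_borelE)
  then show ?thesis
    by (intro bounded_borelI[of _ "A + B"]) (auto intro: norm_triangle_le add_mono)
qed

lemma bounded_borel_scaleR:
  assumes "bounded_borel f" "bounded_borel g" shows "bounded_borel (\<lambda>x. f x *\<^sub>R g x)"
proof -
  from assms obtain A B where [measurable]: "f \<in> borel_measurable borel" "g \<in> borel_measurable borel"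
    and "\<And>x. norm (f x) \<le> A" "\<And>x. norm (g x) \<le> B" "0 \<le> A" by (meson bounded_borelE)
  then show ?thesis
    by (intro bounded_borelI[of _ "A * B"]) (auto intro!: mult_mono)
qed

lemma bounded_borel_mult:
  fixes f g :: "real \<Rightarrow> 'a::{real_normed_algebra, banach, second_countable_topology}"
  assumes "bounded_borel f" "bounded_borel g" shows "bounded_borel (\<lambda>x. f x * g x)"
proof -
  from assms obtain A B where [measurable]: "f \<in> borel_measurable borel" "g \<in> borel_measurable borel"
    and "\<And>x. norm (f x) \<le> A" "\<And>x. norm (g x) \<le> B" "0 \<le> A" by (meson bounded_borelE)
  then show ?thesis
    by (intro bounded_borelI[of _ "A * B"])
       (auto intro!: order_trans[OF norm_mult_ineq] mult_mono)
qed

lemma bounded_borel_diff: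
  assumes "bounded_borel f" "bounded_borel g" shows "bounded_borel (\<lambda>x. f x - g x)"
  using bounded_borel_add[OF assms(1) bounded_borel_scaleR[OF bounded_borel_const[of "-1"] assms(2)]] by simp

lemma bounded_borel_sum: "(\<And>i. i \<in> I \<Longrightarrow> bounded_borel (f i)) \<Longrightarrow> bounded_borel (\<lambda>x. \<Sum>i\<in>I. f i x)"
  by (induction I rule: infinite_finite_induct) (auto intro: bounded_borel_add)

lemma bounded_borel_norm: "bounded_borel f \<Longrightarrow> bounded_borel (\<lambda>x. norm (f x))"
  by (auto simp: bounded_borel_def)

lemma bounded_borel_cnj: "bounded_borel f \<Longrightarrow> bounded_borel (\<lambda>x. cnj (f x))"
proof -
  assume "bounded_borel f"
  then obtain B where [measurable]: "f \<in> borel_measurable borel" and "\<And>x. norm (f x) \<le> B" by (meson bounded_borelE)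
  moreover have "(\<lambda>x. cnj (f x)) \<in> borel_measurable borel"
    by (rule measurable_compose[OF _ borel_measurable_continuous_onI[of cnj]]) (auto intro: continuous_intros)
  ultimately show ?thesis by (intro bounded_borelI[of _ B]) auto
qed

lemma bounded_borel_poisson: "0 \<le> q \<Longrightarrow> q < 1 \<Longrightarrow> bounded_borel (poisson q t)"
  by (rule bounded_borelI[of _ "1 / (1 - q)\<^sup>2"]) (auto simp: poisson_le poisson_pos less_imp_le)

lemmas bounded_borel_intros = bounded_borel_const bounded_borel_add bounded_borel_scaleR bounded_borel_mult
  bounded_borel_diff bounded_borel_sum bounded_borel_norm bounded_borel_cnj bounded_borel_poisson

lemma bounded_borel_circle:
  fixes h :: "complex \<Rightarrow> 'a::euclidean_space"
  assumes h: "continuous_on (ball 0 1) h" and r: "0 \<le> r" "r < 1"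
  shows "bounded_borel (\<lambda>t. h (of_real r * cis t))"
proof -
  have sub: "of_real r * cis t \<in> cball 0 r" for t using r by (simp add: norm_mult)
  have "cball 0 r \<subseteq> ball (0::complex) 1" using r by auto
  then have "bounded (h ` cball 0 r)"
    by (intro compact_imp_bounded compact_continuous_image continuous_on_subset[OF h]) auto
  then obtain B where "\<And>w. w \<in> cball 0 r \<Longrightarrow> norm (h w) \<le> B"
    unfolding bounded_iff by (metis imageI)
  moreover have "continuous_on UNIV (\<lambda>t. h (of_real r * cis t))"
    using sub \<open>cball 0 r \<subseteq> ball (0::complex) 1\<close>
    by (intro continuous_on_compose2[OF h] continuous_intros) auto
  ultimately show ?thesis
    using sub by (intro bounded_borelI[of _ B] borel_measurable_continuous_onI) auto
qed

section \<open>Symmetry and composition of Poisson operators\<close>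

interpretation circ2: pair_sigma_finite circ circ ..

text \<open>Symmetry of the Poisson operators. The value type is general because the cross term in
  \<open>circle_energy_diff\<close> is complex.\<close>

lemma circ_Fubini:
  fixes f g :: "real \<Rightarrow> 'a::{real_normed_field, banach, second_countable_topology}"
  assumes q: "0 \<le> q" "q < 1" and f: "bounded_borel f" and g: "bounded_borel g"
  shows "(\<integral>t. f t * (\<integral>s. poisson q t s *\<^sub>R g s \<partial>circ) \<partial>circ) = (\<integral>s. (\<integral>t. poisson q s t *\<^sub>R f t \<partial>circ) * g s \<partial>circ)"
proof -
  obtain A where [measurable]: "f \<in> borel_measurable borel" and A: "\<And>x. norm (f x) \<le> A" "0 \<le> A" using f by (meson bounded_borelE)
  obtain B where [measurable]: "g \<in> borel_measurable borel" and B: "\<And>x. norm (g x) \<le> B" "0 \<le> B" using g by (meson bounded_borelE)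
  have fin: "finite_measure (circ \<Otimes>\<^sub>M circ)" by (intro finite_measure_pair_measure finite_measure_circ)
  have int: "integrable (circ \<Otimes>\<^sub>M circ) (\<lambda>(t, s). poisson q t s *\<^sub>R (f t * g s))"
  proof (rule finite_measure.integrable_const_bound[OF fin])
    show "AE x in circ \<Otimes>\<^sub>M circ. norm (case x of (t, s) \<Rightarrow> poisson q t s *\<^sub>R (f t * g s)) \<le> 1 / (1 - q)\<^sup>2 * (A * B)"
    proof (intro AE_I2, clarsimp simp: norm_mult)
      fix t s
      have "\<bar>poisson q t s\<bar> \<le> 1 / (1 - q)\<^sup>2" using poisson_le[OF q, of t s] poisson_pos[OF q, of t s] by simp
      moreover have "norm (f t) * norm (g s) \<le> A * B" using A B by (intro mult_mono) auto
      ultimately have "\<bar>poisson q t s\<bar> * (norm (f t) * norm (g s)) \<le> 1 / (1 - q)\<^sup>2 * (A * B)" by (rule mult_mono) auto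
      then show "\<bar>poisson q t s\<bar> * (norm (f t) * norm (g s)) \<le> A * B / (1 - q)\<^sup>2" by simp
    qed
    show "(\<lambda>(t, s). poisson q t s *\<^sub>R (f t * g s)) \<in> borel_measurable (circ \<Otimes>\<^sub>M circ)" by measurable
  qed
  have i: "integrable circ (\<lambda>s. poisson q t s *\<^sub>R g s)" "integrable circ (\<lambda>s. poisson q t s *\<^sub>R f s)" for t
    by (intro bounded_borel_integrable bounded_borel_intros q f g)+
  have "(\<integral>t. f t * (\<integral>s. poisson q t s *\<^sub>R g s \<partial>circ) \<partial>circ) = (\<integral>t. (\<integral>s. poisson q t s *\<^sub>R (f t * g s) \<partial>circ) \<partial>circ)"
    using i by (intro Bochner_Integration.integral_cong refl) (simp flip: integral_mult_right_zero)
  also have "\<dots> = (\<integral>s. (\<integral>t. poisson q t s *\<^sub>R (f t * g s) \<partial>circ) \<partial>circ)"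
    by (rule circ2.Fubini_integral[OF int, symmetric])
  also have "\<dots> = (\<integral>s. (\<integral>t. poisson q s t *\<^sub>R f t \<partial>circ) * g s \<partial>circ)"
    using i by (intro Bochner_Integration.integral_cong refl) (simp add: poisson_sym[of q _ t for t] flip: integral_mult_left_zero)
  finally show ?thesis .
qed

definition poisson_op :: "real \<Rightarrow> (real \<Rightarrow> real) \<Rightarrow> real \<Rightarrow> real" where
  "poisson_op q f t = (\<integral>s. poisson q t s *\<^sub>R f s \<partial>circ)"

text \<open>In Garsia's proof of the maximal ergodic inequality one takes the maximum of the partial sums of
  \<open>\<Sum>k. P^k f\<close> up to \<open>N\<close>, \<open>P\<close> being the Poisson operator. This recursion only majorises that maximum, but
  satisfies the one identity the proof needs by definition.\<close>

primrec maximal_sum :: "real \<Rightarrow> (real \<Rightarrow> real) \<Rightarrow> nat \<Rightarrow> real \<Rightarrow> real" where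
  "maximal_sum q f 0 = (\<lambda>_. 0)"
| "maximal_sum q f (Suc N) = (\<lambda>t. max 0 (f t + poisson_op q (maximal_sum q f N) t))"

context
  fixes q :: real assumes q: "0 \<le> q" "q < 1"
begin

lemma integrable_poisson_bounded: "bounded_borel f \<Longrightarrow> integrable circ (\<lambda>s. poisson q t s *\<^sub>R f s)"
  by (intro bounded_borel_integrable bounded_borel_intros q)

lemma poisson_op_mono:
  assumes "bounded_borel f" "bounded_borel g" "\<And>s. f s \<le> g s"
  shows "poisson_op q f t \<le> poisson_op q g t"
  unfolding poisson_op_def using assms poisson_pos[OF q]
  by (intro integral_mono integrable_poisson_bounded) (auto intro!: mult_left_mono less_imp_le)

lemma poisson_op_const [simp]: "poisson_op q (\<lambda>_. c) t = c"
  unfolding poisson_op_def using poisson_integral_one(1)[OF q] by simp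

lemma poisson_op_nonneg:
  assumes "bounded_borel f" "\<And>s. 0 \<le> f s"
  shows "0 \<le> poisson_op q f t"
  using poisson_op_mono[of "\<lambda>_. 0" f t] assms by simp

lemma poisson_op_diff:
  assumes "bounded_borel f" "bounded_borel g"
  shows "poisson_op q (\<lambda>s. f s - g s) t = poisson_op q f t - poisson_op q g t"
  unfolding poisson_op_def scaleR_diff_right
  using assms by (intro Bochner_Integration.integral_diff integrable_poisson_bounded)

lemma poisson_op_sum:
  assumes "\<And>i. i \<in> I \<Longrightarrow> bounded_borel (f i)"
  shows "poisson_op q (\<lambda>s. \<Sum>i\<in>I. f i s) t = (\<Sum>i\<in>I. poisson_op q (f i) t)"
  unfolding poisson_op_def scaleR_sum_right
  using assms by (intro Bochner_Integration.integral_sum integrable_poisson_bounded)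

lemma bounded_borel_poisson_op:
  assumes f: "bounded_borel f" shows "bounded_borel (poisson_op q f)"
proof -
  obtain B where [measurable]: "f \<in> borel_measurable borel" and B: "\<And>x. norm (f x) \<le> B" using f by (meson bounded_borelE)
  have "(\<lambda>t. poisson_op q f t) \<in> borel_measurable circ"
    unfolding poisson_op_def by measurable
  moreover have "- B \<le> poisson_op q f t" "poisson_op q f t \<le> B" for t
    using poisson_op_mono[OF f bounded_borel_const, of B t] poisson_op_mono[OF bounded_borel_const f, of "-B" t] B
    by (auto simp: abs_le_iff minus_le_iff)
  ultimately show ?thesis
    by (intro bounded_borelI[of _ B]) (auto simp: abs_le_iff minus_le_iff)
qed

lemma integral_poisson_op:
  assumes f: "bounded_borel f" shows "(\<integral>t. poisson_op q f t \<partial>circ) = (\<integral>t. f t \<partial>circ)"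
  using circ_Fubini[OF q bounded_borel_const[of 1] f] poisson_integral_one(1)[OF q] by (simp add: poisson_op_def)

lemma poisson_op_poisson_op:
  assumes f: "bounded_borel f" and p: "0 \<le> p" "p < 1"
  shows "poisson_op q (poisson_op p f) t = poisson_op (q * p) f t"
proof -
  have "poisson_op q (poisson_op p f) t = (\<integral>s. poisson_op q (poisson p s) t * f s \<partial>circ)"
    using circ_Fubini[OF p bounded_borel_poisson[OF q, of t] f]
    by (simp add: poisson_op_def mult.commute)
  also have "\<dots> = poisson_op (q * p) f t"
    using poisson_semigroup[OF q p] poisson_sym[of p] by (simp add: poisson_op_def)
  finally show ?thesis .
qed

lemma bounded_borel_maximal_sum:
  assumes f: "bounded_borel f" shows "bounded_borel (maximal_sum q f N)"
proof (induction N)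
  case (Suc N)
  have g: "bounded_borel (\<lambda>t. f t + poisson_op q (maximal_sum q f N) t)"
    by (intro bounded_borel_add f bounded_borel_poisson_op Suc)
  then obtain B where [measurable]: "(\<lambda>t. f t + poisson_op q (maximal_sum q f N) t) \<in> borel_measurable borel"
    and B: "\<And>t. norm (f t + poisson_op q (maximal_sum q f N) t) \<le> B" "0 \<le> B" by (meson bounded_borelE)
  show ?case unfolding maximal_sum.simps
    by (rule bounded_borelI[of _ B]) (use B in \<open>auto simp: abs_le_iff max_def\<close>)
qed auto

lemma maximal_sum_nonneg: "0 \<le> maximal_sum q f N t"
  by (cases N) auto

lemma maximal_sum_mono:
  assumes f: "bounded_borel f" shows "maximal_sum q f N t \<le> maximal_sum q f (Suc N) t"
proof (induction N arbitrary: t)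
  case (Suc N)
  have "poisson_op q (maximal_sum q f N) t \<le> poisson_op q (maximal_sum q f (Suc N)) t"
    by (intro poisson_op_mono bounded_borel_maximal_sum q f Suc.IH)
  then show ?case by (subst (1 2) maximal_sum.simps) linarith
qed auto

text \<open>Write F for the maximal sum and P for the operator. Where F > 0, the recursion and
  monotonicity in \<open>N\<close> give F - P F \<le> f; elsewhere F = 0 and F - P F \<le> 0.
  Integration finishes the argument because P preserves integrals.\<close>

lemma maximal_ergodic:
  assumes f: "bounded_borel f"
  shows "0 \<le> (\<integral>t. indicator {t. 0 < maximal_sum q f N t} t *\<^sub>R f t \<partial>circ)"
proof -
  let ?F = "maximal_sum q f N"
  have F: "bounded_borel ?F" by (rule bounded_borel_maximal_sum[OF f])
  then have [measurable]: "?F \<in> borel_measurable borel" by (rule bounded_borel_measurable)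
  have ind: "bounded_borel (\<lambda>t. indicator {t. 0 < ?F t} t :: real)"
    by (rule bounded_borelI[of _ 1]) (auto simp: indicator_def)
  have "0 = (\<integral>t. ?F t - poisson_op q ?F t \<partial>circ)"
    using F by (subst Bochner_Integration.integral_diff)
      (auto intro!: bounded_borel_integrable bounded_borel_poisson_op simp: integral_poisson_op)
  also have "\<dots> \<le> (\<integral>t. indicator {t. 0 < ?F t} t *\<^sub>R f t \<partial>circ)"
  proof (rule integral_mono)
    fix t
    show "?F t - poisson_op q ?F t \<le> indicator {t. 0 < ?F t} t *\<^sub>R f t"
    proof (cases "0 < ?F t")
      case True
      then obtain M where N: "N = Suc M" by (cases N) auto
      with True have "?F t = f t + poisson_op q (maximal_sum q f M) t" by (auto split: if_splits simp: max_def)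
      moreover have "poisson_op q (maximal_sum q f M) t \<le> poisson_op q ?F t"
        unfolding N by (intro poisson_op_mono bounded_borel_maximal_sum q f maximal_sum_mono)
      ultimately show ?thesis using True by simp
    next
      case False
      then show ?thesis using poisson_op_nonneg[OF F maximal_sum_nonneg, of t] by simp
    qed
  qed (intro bounded_borel_integrable bounded_borel_intros F bounded_borel_poisson_op ind f)+
  finally show ?thesis .
qed

end

text \<open>Applying the operator to one of these sums and adding \<open>poisson_op q u - l\<close>
  yields the next sum, so the estimate follows the recursion step by step.\<close>

lemma maximal_sum_ge:
  assumes q: "0 \<le> q" "q < 1" and u: "bounded_borel u" and n: "n \<le> N"
  shows "(\<Sum>k=1..n. poisson_op (q ^ k) u t) - real n * l \<le> maximal_sum q (\<lambda>t. poisson_op q u t - l) N t"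
  using n
proof (induction N arbitrary: n t)
  case (Suc N)
  let ?f = "\<lambda>t. poisson_op q u t - l"
  have f: "bounded_borel ?f" by (intro bounded_borel_intros bounded_borel_poisson_op q u)
  show ?case
  proof (cases n)
    case 0
    then show ?thesis using maximal_sum_nonneg[of q ?f "Suc N" t] by simp
  next
    case (Suc m)
    have qk: "0 \<le> q ^ k" "q ^ k < 1" if "k \<in> {1..m}" for k
      using q that by (auto simp: power_less_one_iff)
    let ?s = "\<lambda>t. (\<Sum>k=1..m. poisson_op (q ^ k) u t)"
    have pk: "bounded_borel (poisson_op (q ^ k) u)" if "k \<in> {1..m}" for k
      using bounded_borel_poisson_op[OF qk u] that by auto
    have s: "bounded_borel ?s" by (intro bounded_borel_intros pk)
    have "poisson_op q ?s t = (\<Sum>k=1..m. poisson_op (q * q ^ k) u t)"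
      using pk qk by (subst poisson_op_sum[OF q]) (auto intro!: sum.cong poisson_op_poisson_op q u)
    also have "poisson_op q u t + \<dots> = (\<Sum>k=1..n. poisson_op (q ^ k) u t)"
      unfolding Suc by (subst (2) sum.atLeast_Suc_atMost) (simp, simp only: sum.shift_bounds_cl_Suc_ivl power_Suc power_one_right)
    finally have "(\<Sum>k=1..n. poisson_op (q ^ k) u t) - real n * l = ?f t + poisson_op q (\<lambda>t. ?s t - real m * l) t"
      using s by (simp add: poisson_op_diff[OF q] poisson_op_const[OF q] Suc algebra_simps)
    also have "\<dots> \<le> ?f t + poisson_op q (maximal_sum q ?f N) t"
      using Suc Suc.prems
      by (intro add_left_mono poisson_op_mono q bounded_borel_intros s bounded_borel_maximal_sum q f Suc.IH) auto
    finally show ?thesis by simp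
  qed
qed simp

text \<open>The ergodic inequality controls averages over the exponents, not a single radius. If the
  value at \<open>q ^ j\<close> exceeds 8 l, then Harnack keeps the values at least 2 l for all k
  from j to 2 j, and the sum over 1..2j exceeds 2 j l. Hence the factor 8 = 4 * 2 and the length
  \<open>2 * N\<close> of the maximal sum.\<close>

lemma poisson_weak_type:
  assumes q: "0 < q" "q < 1" and u: "bounded_borel u" "\<And>t. 0 \<le> u t" and l: "0 < l"
    and [measurable]: "A \<in> sets borel"
    and A: "\<And>t. t \<in> A \<Longrightarrow> \<exists>j\<in>{1..N}. 8 * l < poisson_op (q ^ j) u t"
  shows "measure circ A \<le> (\<integral>t. u t \<partial>circ) / l"
proof -
  have q': "0 \<le> q" using q by simp
  let ?f = "\<lambda>t. poisson_op q u t - l"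
  let ?F = "maximal_sum q ?f (2 * N)"
  have U: "bounded_borel (poisson_op q u)" by (intro bounded_borel_poisson_op q' q u)
  have f: "bounded_borel ?f" by (intro bounded_borel_intros U)
  have F: "bounded_borel ?F" by (rule bounded_borel_maximal_sum[OF q' q(2) f])
  then have [measurable]: "?F \<in> borel_measurable borel" by (rule bounded_borel_measurable)
  have ind: "bounded_borel (\<lambda>t. indicator {t. 0 < ?F t} t :: real)"
    by (rule bounded_borelI[of _ 1]) (auto simp: indicator_def)
  have sub: "A \<subseteq> {t. 0 < ?F t}"
  proof
    fix t assume t: "t \<in> A"
    obtain j where j: "1 \<le> j" "j \<le> N" and big: "8 * l < poisson_op (q ^ j) u t" using A[OF t] by auto
    have qk: "0 \<le> q ^ k" "q ^ k < 1" if "k \<ge> 1" for k using q that by (auto simp: power_less_one_iff)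
    have *: "2 * l \<le> poisson_op (q ^ k) u t" if k: "k \<in> {j..2 * j}" for k
    proof -
      have "(q ^ j)\<^sup>2 \<le> q ^ k" "q ^ k \<le> q ^ j"
        unfolding power_mult[symmetric] using q k by (auto intro!: power_decreasing)
      then have "poisson (q ^ j) t s * u s \<le> 4 * poisson (q ^ k) t s * u s" for s
        using qk[OF j(1)] u by (intro mult_right_mono poisson_Harnack) auto
      then have "poisson_op (q ^ j) u t \<le> (\<integral>s. 4 *\<^sub>R (poisson (q ^ k) t s *\<^sub>R u s) \<partial>circ)"
        unfolding poisson_op_def using qk[of j] qk[of k] j k u
        by (intro integral_mono integrable_poisson_bounded integrable_scaleR_right) (auto simp: mult.assoc)
      also have "\<dots> = 4 * poisson_op (q ^ k) u t"
        unfolding poisson_op_def by (subst integral_scaleR_right) simp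
      finally show ?thesis using big by linarith
    qed
    have "real (2 * j) * l < real (j + 1) * (2 * l)" using l by (simp add: algebra_simps)
    also have "\<dots> = (\<Sum>k\<in>{j..2 * j}. 2 * l)" by simp
    also have "\<dots> \<le> (\<Sum>k\<in>{j..2 * j}. poisson_op (q ^ k) u t)"
      by (intro sum_mono *)
    also have "\<dots> \<le> (\<Sum>k=1..2*j. poisson_op (q ^ k) u t)"
      using j qk by (intro sum_mono2) (auto intro!: poisson_op_nonneg u)
    finally show "t \<in> {t. 0 < ?F t}"
      using maximal_sum_ge[OF q' q(2) u(1), of "2 * j" "2 * N" t l] j by auto
  qed
  have "0 \<le> (\<integral>t. indicator {t. 0 < ?F t} t *\<^sub>R ?f t \<partial>circ)"
    by (rule maximal_ergodic[OF q' q(2) f])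
  also have "\<dots> \<le> (\<integral>t. poisson_op q u t - l * indicator {t. 0 < ?F t} t \<partial>circ)"
    using poisson_op_nonneg[OF q' q(2) u]
    by (intro integral_mono bounded_borel_integrable bounded_borel_intros U ind f) (auto simp: indicator_def)
  also have "\<dots> = (\<integral>t. u t \<partial>circ) - l * measure circ {t. 0 < ?F t}"
    using U ind bounded_borel_integrable[OF bounded_borel_mult[OF bounded_borel_const[of l] ind]]
    by (subst Bochner_Integration.integral_diff) (auto intro: bounded_borel_integrable simp: integral_poisson_op[OF q' q(2)] u)
  finally have "l * measure circ {t. 0 < ?F t} \<le> (\<integral>t. u t \<partial>circ)" by simp
  moreover have "measure circ A \<le> measure circ {t. 0 < ?F t}"
    by (intro circ.finite_measure_mono sub) auto
  from mult_left_mono[OF this, of l] have "l * measure circ A \<le> l * measure circ {t. 0 < ?F t}" using l by simp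
  ultimately have "l * measure circ A \<le> (\<integral>t. u t \<partial>circ)" by (rule order_trans[rotated])
  then show ?thesis using l by (simp add: field_simps)
qed

subsection \<open>Radial limits\<close>

abbreviation circle_restr :: "(complex \<Rightarrow> 'a) \<Rightarrow> real \<Rightarrow> real \<Rightarrow> 'a" where
  "circle_restr h r \<equiv> (\<lambda>t. h (of_real r * cis t))"

lemma bounded_borel_holomorphic:
  assumes "h holomorphic_on ball 0 1" "0 \<le> r" "r < 1"
  shows "bounded_borel (circle_restr h r)"
  using assms by (intro bounded_borel_circle holomorphic_on_imp_continuous_on) auto

lemma continuous_on_circle:
  assumes h: "h holomorphic_on ball 0 1" and r: "0 \<le> r" "r < 1"
  shows "continuous_on UNIV (circle_restr h r)"
  using r by (intro continuous_on_compose2[OF holomorphic_on_imp_continuous_on[OF h]] continuous_intros)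
    (auto simp: norm_mult)

lemma poisson_dilation:
  assumes h: "h holomorphic_on ball 0 1" and R: "0 < R" "R < 1" and q: "0 \<le> q" "q < 1"
  shows "(\<integral>s. poisson q t s *\<^sub>R h (of_real R * cis s) \<partial>circ) = h (of_real (R * q) * cis t)"
proof -
  have "(\<lambda>w. h (of_real R * w)) holomorphic_on ball 0 (1 / R)"
    using R by (intro holomorphic_on_compose_gen[OF _ h, unfolded o_def] holomorphic_intros)
      (auto simp: norm_mult field_simps)
  from poisson_integral_formula[OF this _ q, of t] show ?thesis
    using R by (auto simp: scaleR_conv_of_real mult_ac cball_subset_ball_iff)
qed

lemma norm_dilation_le:
  assumes h: "h holomorphic_on ball 0 1" and R: "0 < R" "R < 1" and q: "0 \<le> q" "q < 1"
  shows "cmod (h (of_real (R * q) * cis t)) \<le> poisson_op q (\<lambda>s. cmod (h (of_real R * cis s))) t"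
proof -
  have "cmod (h (of_real (R * q) * cis t)) \<le> (\<integral>s. cmod (poisson q t s *\<^sub>R h (of_real R * cis s)) \<partial>circ)"
    unfolding poisson_dilation[OF assms, symmetric] by (rule integral_norm_bound)
  also have "\<dots> = poisson_op q (\<lambda>s. cmod (h (of_real R * cis s))) t"
    unfolding poisson_op_def using poisson_pos[OF q, of t]
    by (intro Bochner_Integration.integral_cong) (auto simp: less_imp_le)
  finally show ?thesis .
qed

lemma radial_maximal_discrete:
  fixes N :: nat
  assumes h: "h holomorphic_on ball 0 1" and R: "0 < R" "R < 1" and q: "0 < q" "q < 1" and l: "0 < l"
  defines "E \<equiv> {t. \<exists>j\<in>{1..N}. 8 * l < cmod (h (of_real (R * q ^ j) * cis t))}"
  shows "E \<in> sets borel" and "measure circ E \<le> (\<integral>t. cmod (h (of_real R * cis t)) \<partial>circ) / l"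
proof -
  have qj: "0 \<le> q ^ j" "q ^ j < 1" "0 \<le> R * q ^ j" "R * q ^ j < 1" if "j \<ge> 1" for j
    using q that R mult_strict_mono[of R 1 "q ^ j" 1] by (auto simp: power_less_one_iff)
  have "open {t. 8 * l < cmod (h (of_real (R * q ^ j) * cis t))}" if "j \<in> {1..N}" for j
    using that by (intro open_Collect_less continuous_intros continuous_on_circle h qj) auto
  then have "open (\<Union>j\<in>{1..N}. {t. 8 * l < cmod (h (of_real (R * q ^ j) * cis t))})" by blast
  moreover have "E = (\<Union>j\<in>{1..N}. {t. 8 * l < cmod (h (of_real (R * q ^ j) * cis t))})"
    by (auto simp: E_def)
  ultimately show E: "E \<in> sets borel" by simp
  show "measure circ E \<le> (\<integral>t. cmod (h (of_real R * cis t)) \<partial>circ) / l"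
  proof (rule poisson_weak_type[OF q _ _ l E, where N=N])
    show "bounded_borel (\<lambda>t. cmod (h (of_real R * cis t)))"
      using R by (intro bounded_borel_norm bounded_borel_holomorphic h) auto
    fix t assume "t \<in> E"
    then obtain j where j: "j \<in> {1..N}" "8 * l < cmod (h (of_real (R * q ^ j) * cis t))"
      unfolding E_def by blast
    with norm_dilation_le[OF h R qj(1,2), of j t]
    have "8 * l < poisson_op (q ^ j) (\<lambda>s. cmod (h (of_real R * cis s))) t" by simp
    with j(1) show "\<exists>j\<in>{1..N}. 8 * l < poisson_op (q ^ j) (\<lambda>s. cmod (h (of_real R * cis s))) t" by blast
  qed simp
qed

text \<open>For each m the discrete inequality covers a finite grid of radii, with a bound that does
  not depend on m. The grids become dense, and by continuity largeness at one radius shows up on all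
  sufficiently fine grids. So the exceptional set may consist of the \<open>t\<close> that lie in
  all but finitely many \<open>E m\<close>, and its measure is a limit along an increasing
  sequence.\<close>

lemma radial_maximal:
  assumes h: "h holomorphic_on ball 0 1" and l: "0 < l" and r0: "r0 < 1"
    and A: "\<And>r. r0 < r \<Longrightarrow> 0 < r \<Longrightarrow> r < 1 \<Longrightarrow> (\<integral>t. cmod (h (of_real r * cis t)) \<partial>circ) \<le> A"
  obtains E where "E \<in> sets borel" "measure circ E \<le> A / l"
    "\<And>t r. t \<notin> E \<Longrightarrow> 0 < r \<Longrightarrow> r < 1 \<Longrightarrow> cmod (h (of_real r * cis t)) \<le> 8 * l"
proof -
  \<comment> \<open>The grid radii are exp (- (j + 1) / m): they have mesh 1 / m on the logarithmic
    scale, and \<open>m\<^sup>2\<close> of them reach past every fixed radius when m is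
    large.\<close>
  define q where "q m = exp (- 1 / real m)" for m
  define E where "E m = {t. \<exists>j\<in>{1..m\<^sup>2}. 8 * l < cmod (h (of_real (q m * q m ^ j) * cis t))}" for m
  define C where "C n = (\<Inter>m\<in>{n..}. E m)" for n
  have q: "0 < q m" "q m < 1" if "m \<ge> 1" for m using that by (auto simp: q_def)
  have "q \<longlonglongrightarrow> 1" unfolding q_def by real_asymp
  then have "eventually (\<lambda>m. r0 < q m) sequentially" by (rule order_tendstoD) (rule r0)
  then have "eventually (\<lambda>m. r0 < q m \<and> 1 \<le> m) sequentially"
    using eventually_ge_at_top[of 1] by eventually_elim auto
  then obtain m0 where m0: "\<And>m. m \<ge> m0 \<Longrightarrow> r0 < q m \<and> 1 \<le> m" by (auto simp: eventually_sequentially)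
  have E: "E m \<in> sets borel" "measure circ (E m) \<le> A / l" if "m \<ge> m0" for m
  proof -
    have m: "0 < q m" "q m < 1" "r0 < q m" using m0[OF that] q by auto
    show "E m \<in> sets borel" unfolding E_def by (rule radial_maximal_discrete[OF h m(1,2) m(1,2) l])
    have "measure circ (E m) \<le> (\<integral>t. cmod (h (of_real (q m) * cis t)) \<partial>circ) / l"
      unfolding E_def by (rule radial_maximal_discrete[OF h m(1,2) m(1,2) l])
    also have "\<dots> \<le> A / l" using l m by (intro divide_right_mono A) auto
    finally show "measure circ (E m) \<le> A / l" .
  qed
  define D where "D n = C (n + m0)" for n
  have D [measurable]: "D n \<in> sets borel" for n
    unfolding D_def C_def using E by (intro sets.countable_INT'') auto
  have "D n \<subseteq> E (n + m0)" for n by (auto simp: D_def C_def)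
  then have Dle: "measure circ (D n) \<le> A / l" for n
    using circ.finite_measure_mono[of "D n" "E (n + m0)"] E[of "n + m0"] by auto
  have "incseq D" by (rule incseq_SucI) (auto simp: D_def C_def)
  then have "(\<lambda>n. measure circ (D n)) \<longlonglongrightarrow> measure circ (\<Union>n. D n)"
    by (intro circ.finite_Lim_measure_incseq) auto
  then have "measure circ (\<Union>n. D n) \<le> A / l"
    by (rule LIMSEQ_le_const2) (use Dle in auto)
  moreover have "cmod (h (of_real r * cis t)) \<le> 8 * l" if t: "t \<notin> (\<Union>n. D n)" and r: "0 < r" "r < 1" for t r
  proof (rule ccontr)
    assume "\<not> ?thesis"
    then have big: "8 * l < cmod (h (of_real r * cis t))" by simp
    define s where "s = - ln r"
    have s: "0 < s" "r = exp (- s)" using r by (auto simp: s_def)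
    define j where "j m = nat \<lceil>s * real m\<rceil>" for m
    have j: "s * real m \<le> real (j m)" "real (j m) \<le> s * real m + 1" for m
      unfolding j_def using s by (auto simp: of_nat_nat)
    have "(\<lambda>m. real (j m + 1) / real m) \<longlonglongrightarrow> s"
    proof (rule tendsto_sandwich)
      show "(\<lambda>m. s * real m / real m) \<longlonglongrightarrow> s" by real_asymp
      show "(\<lambda>m. (s * real m + 2) / real m) \<longlonglongrightarrow> s" by real_asymp
      have "s * real m / real m \<le> real (j m + 1) / real m \<and> real (j m + 1) / real m \<le> (s * real m + 2) / real m" for m
        using j[of m] by (intro conjI divide_right_mono) auto
      then show "\<forall>\<^sub>F m in sequentially. s * real m / real m \<le> real (j m + 1) / real m"
        "\<forall>\<^sub>F m in sequentially. real (j m + 1) / real m \<le> (s * real m + 2) / real m"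
        by (blast intro: always_eventually)+
    qed
    then have "(\<lambda>m. exp (- (real (j m + 1) / real m))) \<longlonglongrightarrow> r"
      unfolding s(2) by (intro tendsto_intros)
    moreover have "exp (- (real (j m + 1) / real m)) = q m * q m ^ j m" for m
    proof -
      have "q m ^ j m = exp (real (j m) * (- 1 / real m))"
        unfolding q_def by (simp only: exp_of_nat_mult)
      then show ?thesis unfolding q_def by (simp add: exp_add[symmetric] add_divide_distrib)
    qed
    ultimately have lim: "(\<lambda>m. q m * q m ^ j m) \<longlonglongrightarrow> r" by simp
    have "isCont h (of_real r * cis t)"
      using r by (intro continuous_on_interior[OF holomorphic_on_imp_continuous_on[OF h]])
        (simp add: norm_mult)
    moreover have "(\<lambda>m. of_real (q m * q m ^ j m) * cis t) \<longlonglongrightarrow> of_real r * cis t"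
      by (intro tendsto_intros lim)
    ultimately have "(\<lambda>m. cmod (h (of_real (q m * q m ^ j m) * cis t))) \<longlonglongrightarrow> cmod (h (of_real r * cis t))"
      by (rule tendsto_norm[OF isCont_tendsto_compose])
    then have 1: "\<forall>\<^sub>F m in sequentially. 8 * l < cmod (h (of_real (q m * q m ^ j m) * cis t))"
      by (rule order_tendstoD) (rule big)
    have 2: "\<forall>\<^sub>F m in sequentially. s * real m + 1 \<le> (real m)\<^sup>2"
      using s by real_asymp
    have 3: "\<forall>\<^sub>F m in sequentially. 1 \<le> s * real m"
      using s by real_asymp
    from 1 2 3 have "\<forall>\<^sub>F m in sequentially. t \<in> E m"
    proof eventually_elim
      case (elim m)
      have "real (j m) \<le> real (m\<^sup>2)" "1 \<le> real (j m)" using j[of m] elim(2,3) unfolding of_nat_power by linarith+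
      then have "j m \<in> {1..m\<^sup>2}" by (simp only: of_nat_le_iff atLeastAtMost_iff) simp
      with elim(1) show ?case unfolding E_def by blast
    qed
    then obtain n where "\<And>m. m \<ge> n \<Longrightarrow> t \<in> E m" by (auto simp: eventually_sequentially)
    then have "t \<in> D n" by (auto simp: D_def C_def)
    with t show False by blast
  qed
  ultimately show thesis by (intro that[of "\<Union>n. D n"]) auto
qed

section \<open>Mean squares on circles\<close>

definition circle_energy :: "(complex \<Rightarrow> complex) \<Rightarrow> real \<Rightarrow> real" where
  "circle_energy h r = (\<integral>t. (cmod (h (of_real r * cis t)))\<^sup>2 \<partial>circ)"

lemma bounded_borel_power2: "bounded_borel f \<Longrightarrow> bounded_borel (\<lambda>t. (f t :: real)\<^sup>2)"
  unfolding power2_eq_square by (intro bounded_borel_mult)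

text \<open>Jensen's inequality for the square: the variance of \<open>f\<close> with respect to the
  kernel is nonnegative.\<close>

lemma poisson_op_square_le:
  assumes q: "0 \<le> q" "q < 1" and f: "bounded_borel f"
  shows "(poisson_op q f t)\<^sup>2 \<le> poisson_op q (\<lambda>s. (f s)\<^sup>2) t"
proof -
  let ?m = "poisson_op q f t"
  note f2 = bounded_borel_power2[OF f]
  have lin: "poisson_op q (\<lambda>s. 2 * ?m * f s) t = 2 * ?m * ?m"
    unfolding poisson_op_def by (simp add: mult.left_commute[of "poisson q t s" for s] flip: integral_mult_right_zero)
  have cm: "bounded_borel (\<lambda>s. 2 * ?m * f s)" by (intro bounded_borel_intros f)
  have "0 \<le> poisson_op q (\<lambda>s. (f s - ?m)\<^sup>2) t"
    by (intro poisson_op_nonneg q bounded_borel_power2 bounded_borel_intros f) auto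
  also have "(\<lambda>s. (f s - ?m)\<^sup>2) = (\<lambda>s. (f s)\<^sup>2 - (2 * ?m * f s - ?m\<^sup>2))"
    by (auto simp: power2_eq_square algebra_simps)
  also have "poisson_op q \<dots> t = poisson_op q (\<lambda>s. (f s)\<^sup>2) t - (2 * ?m * ?m - ?m\<^sup>2)"
    using f2 cm by (simp add: poisson_op_diff[OF q] bounded_borel_diff poisson_op_const[OF q] lin)
  finally show ?thesis by (simp add: power2_eq_square)
qed

lemma integral_square_le:
  assumes f: "bounded_borel (f :: real \<Rightarrow> real)"
  shows "(\<integral>t. f t \<partial>circ)\<^sup>2 \<le> (\<integral>t. (f t)\<^sup>2 \<partial>circ)"
  \<comment> \<open>For q = 0 the kernel is constantly 1, so the operator is the mean over the
    circle.\<close>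
  using poisson_op_square_le[of 0 f 0] f by (simp add: poisson_op_def poisson_def)

lemma circle_energy_mono:
  assumes h: "h holomorphic_on ball 0 1" and r: "0 < s" "s \<le> r" "r < 1"
  shows "circle_energy h s \<le> circle_energy h r"
proof (cases "s = r")
  case False
  define q where "q = s / r"
  have q: "0 \<le> q" "q < 1" and s: "s = r * q" using r False by (auto simp: q_def)
  have hr: "bounded_borel (circle_restr h r)" "bounded_borel (circle_restr h s)"
    using r by (auto intro!: bounded_borel_holomorphic h)
  have n: "bounded_borel (\<lambda>t. cmod (h (of_real r * cis t)))" by (intro bounded_borel_norm hr)
  have "circle_energy h s \<le> (\<integral>t. poisson_op q (\<lambda>s. (cmod (h (of_real r * cis s)))\<^sup>2) t \<partial>circ)"
    unfolding circle_energy_def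
  proof (intro integral_mono bounded_borel_integrable bounded_borel_poisson_op q bounded_borel_power2 bounded_borel_norm hr)
    fix t
    have "(cmod (h (of_real s * cis t)))\<^sup>2 \<le> (poisson_op q (\<lambda>s. cmod (h (of_real r * cis s))) t)\<^sup>2"
      unfolding s using r by (intro power_mono norm_dilation_le h q) auto
    also have "\<dots> \<le> poisson_op q (\<lambda>s. (cmod (h (of_real r * cis s)))\<^sup>2) t"
      by (rule poisson_op_square_le[OF q n])
    finally show "(cmod (h (of_real s * cis t)))\<^sup>2 \<le> poisson_op q (\<lambda>s. (cmod (h (of_real r * cis s)))\<^sup>2) t" .
  qed
  also have "\<dots> = circle_energy h r"
    unfolding circle_energy_def by (intro integral_poisson_op q bounded_borel_power2 n)
  finally show ?thesis .
qed simp

text \<open>The Poisson operators form a symmetric semigroup, so the cross term of \<open>h\<^sub>r\<close> and \<open>h\<^sub>s\<close> is the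
  energy at the geometric mean of the radii.\<close>

lemma circle_energy_diff:
  assumes h: "h holomorphic_on ball 0 1" and r: "0 < s" "s < r" "r < 1"
  shows "(\<integral>t. (cmod (h (of_real r * cis t) - h (of_real s * cis t)))\<^sup>2 \<partial>circ) \<le> circle_energy h r - circle_energy h s"
proof -
  define q where "q = sqrt (s / r)"
  have q: "0 \<le> q" "q < 1" using r by (auto simp: q_def)
  have rq: "r * q * q = s" using r by (simp add: q_def mult.assoc)
  have q0: "0 < q" using r by (simp add: q_def)
  have rq': "0 < r * q" "r * q < 1" "s \<le> r * q" 
    using r q q0 mult_strict_mono[of r 1 q 1] rq mult_left_mono[of q 1 "r * q"] by auto
  define f where "f = circle_restr h r"
  define g where "g = circle_restr h s"
  define m where "m = circle_restr h (r * q)"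
  have b: "bounded_borel f" "bounded_borel g" "bounded_borel m"
    unfolding f_def g_def m_def using r rq' by (rule_tac bounded_borel_holomorphic[OF h]; simp)+
  have fm: "(\<integral>s. poisson q t s *\<^sub>R f s \<partial>circ) = m t" for t
    unfolding f_def m_def using r q by (intro poisson_dilation h) auto
  have mg: "(\<integral>s. poisson q t s *\<^sub>R m s \<partial>circ) = g t" for t
    unfolding m_def g_def rq[symmetric] using rq' q by (intro poisson_dilation h) auto
  have mg': "(\<integral>s. poisson q t s *\<^sub>R cnj (m s) \<partial>circ) = cnj (g t)" for t
    using Bochner_Integration.integral_cnj[of circ "\<lambda>s. poisson q t s *\<^sub>R m s"] mg[of t] by simp
  have "(\<integral>t. f t * cnj (g t) \<partial>circ) = (\<integral>t. m t * cnj (m t) \<partial>circ)"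
    using circ_Fubini[OF q b(1) bounded_borel_cnj[OF b(3)]] by (simp add: mg' fm)
  also have "\<dots> = (\<integral>t. of_real ((cmod (m t))\<^sup>2) \<partial>circ)"
    by (simp only: complex_norm_square)
  also have "\<dots> = of_real (\<integral>t. (cmod (m t))\<^sup>2 \<partial>circ)"
    by (intro integral_of_real bounded_borel_integrable bounded_borel_power2 bounded_borel_norm b)
  also have "\<dots> = of_real (circle_energy h (r * q))"
    by (simp add: circle_energy_def m_def)
  finally have cross: "(\<integral>t. f t * cnj (g t) \<partial>circ) = of_real (circle_energy h (r * q))" .
  have fg: "integrable circ (\<lambda>t. f t * cnj (g t))" by (intro bounded_borel_integrable bounded_borel_intros b)
  have re: "(\<integral>t. Re (f t * cnj (g t)) \<partial>circ) = circle_energy h (r * q)"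
    using integral_Re[OF fg] cross by simp
  have "(cmod (f t - g t))\<^sup>2 = (cmod (f t))\<^sup>2 + (cmod (g t))\<^sup>2 - 2 * Re (f t * cnj (g t))" for t
    unfolding cmod_power2 by (simp add: power2_eq_square algebra_simps)
  moreover have n: "integrable circ (\<lambda>t. (cmod (f t))\<^sup>2)" "integrable circ (\<lambda>t. (cmod (g t))\<^sup>2)"
    by (intro bounded_borel_integrable bounded_borel_power2 bounded_borel_norm b)+
  ultimately have "(\<integral>t. (cmod (f t - g t))\<^sup>2 \<partial>circ) = (\<integral>t. (cmod (f t))\<^sup>2 + (cmod (g t))\<^sup>2 - 2 * Re (f t * cnj (g t)) \<partial>circ)"
    by simp
  also have "\<dots> = (\<integral>t. (cmod (f t))\<^sup>2 \<partial>circ) + (\<integral>t. (cmod (g t))\<^sup>2 \<partial>circ) - 2 * (\<integral>t. Re (f t * cnj (g t)) \<partial>circ)"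
    using integrable_Re[OF fg] n
    by (simp add: Bochner_Integration.integral_diff Bochner_Integration.integral_add
        Bochner_Integration.integrable_add integrable_mult_right del: times_complex.sel)
  finally have "(\<integral>t. (cmod (f t - g t))\<^sup>2 \<partial>circ) = circle_energy h r + circle_energy h s - 2 * (\<integral>t. Re (f t * cnj (g t)) \<partial>circ)"
    by (simp add: circle_energy_def f_def g_def)
  \<comment> \<open>With E for the energy, the integral equals E(r) + E(s) - 2 E(r q); monotonicity
    reduces this to the bound E(r) - E(s).\<close>
  moreover have "circle_energy h s \<le> circle_energy h (r * q)" by (rule circle_energy_mono) (use h r rq' in auto)
  ultimately show ?thesis using re by (simp add: f_def g_def)
qed

text \<open>The energy is bounded and increases with the radius, so beyond some \<open>x\<close> it
  varies by at most \<eta>^2. This bounds the squared L^2 distance between two circles, and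
  Cauchy-Schwarz passes to L^1.\<close>

lemma circle_L1_diff:
  assumes h: "h holomorphic_on ball 0 1" and B: "\<And>r. 0 < r \<Longrightarrow> r < 1 \<Longrightarrow> circle_energy h r \<le> B" and \<eta>: "0 < \<eta>"
  obtains x where "0 < x" "x < 1"
    "\<And>r s. x \<le> s \<Longrightarrow> s < r \<Longrightarrow> r < 1 \<Longrightarrow> (\<integral>t. cmod (h (of_real r * cis t) - h (of_real s * cis t)) \<partial>circ) \<le> \<eta>"
proof -
  define L where "L = Sup (circle_energy h ` {0<..<1})"
  have bdd: "bdd_above (circle_energy h ` {0<..<1})" using B by (auto intro!: bdd_aboveI[of _ B])
  have "L - \<eta>\<^sup>2 < L" using \<eta> by simp
  then obtain x where x: "0 < x" "x < 1" "L - \<eta>\<^sup>2 < circle_energy h x"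
    unfolding L_def by (subst (asm) less_cSUP_iff) (use bdd in auto)
  show thesis
  proof (rule that[OF x(1,2)])
    fix r s assume rs: "x \<le> s" "s < r" "r < 1"
    let ?d = "\<lambda>t. cmod (h (of_real r * cis t) - h (of_real s * cis t))"
    have "bounded_borel ?d"
      using rs x by (intro bounded_borel_intros bounded_borel_holomorphic h) auto
    then have "(\<integral>t. ?d t \<partial>circ)\<^sup>2 \<le> (\<integral>t. (?d t)\<^sup>2 \<partial>circ)" by (rule integral_square_le)
    also have "\<dots> \<le> circle_energy h r - circle_energy h s"
      using rs x by (intro circle_energy_diff h) auto
    also have "\<dots> \<le> \<eta>\<^sup>2"
    proof -
      have "circle_energy h r \<le> L" unfolding L_def using rs x by (intro cSUP_upper bdd) auto
      moreover have "circle_energy h x \<le> circle_energy h s" using rs x by (intro circle_energy_mono h) auto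
      ultimately show ?thesis using x(3) by linarith
    qed
    finally show "(\<integral>t. ?d t \<partial>circ) \<le> \<eta>" using \<eta> by (simp add: power2_le_iff_abs_le)
  qed
qed

section \<open>Radial limits of functions with bounded mean squares\<close>

definition hardy2 :: "(complex \<Rightarrow> complex) set" where
  "hardy2 = {h. h holomorphic_on ball 0 1 \<and> (\<exists>B. \<forall>r. 0 < r \<longrightarrow> r < 1 \<longrightarrow> circle_energy h r \<le> B)}"

lemma hardy2_L1_diff:
  assumes h: "h \<in> hardy2" and \<eta>: "0 < \<eta>"
  obtains x where "0 < x" "x < 1"
    "\<And>r s. x \<le> s \<Longrightarrow> s < r \<Longrightarrow> r < 1 \<Longrightarrow> (\<integral>t. cmod (h (of_real r * cis t) - h (of_real s * cis t)) \<partial>circ) \<le> \<eta>"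
  using h circle_L1_diff[of h _ \<eta>] \<eta> unfolding hardy2_def by blast

text \<open>The maximal inequality is applied to the difference of \<open>h\<close> and its dilate
  by \<open>R\<close>, whose L^1 means on circles near the boundary are small by the Cauchy
  property.\<close>

lemma hardy2_dilation_close:
  assumes h: "h \<in> hardy2" and l: "0 < l" and e: "0 < e"
  obtains E R where "0 < R" "R < 1" "E \<in> sets borel" "measure circ E \<le> e"
    "\<And>t r. t \<notin> E \<Longrightarrow> 0 < r \<Longrightarrow> r < 1 \<Longrightarrow> cmod (h (of_real r * cis t) - h (of_real (R * r) * cis t)) \<le> l"
proof -
  have hol: "h holomorphic_on ball 0 1" using h by (simp add: hardy2_def)
  \<comment> \<open>At level l / 8 the maximal inequality bounds the function by l and the
    exceptional set by A / (l / 8); the choice A = e (l / 8) makes the latter e.\<close>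
  have \<eta>: "0 < e * (l / 8)" using e l by simp
  obtain x where x: "0 < x" "x < 1"
    and L1: "\<And>r s. x \<le> s \<Longrightarrow> s < r \<Longrightarrow> r < 1 \<Longrightarrow> (\<integral>t. cmod (h (of_real r * cis t) - h (of_real s * cis t)) \<partial>circ) \<le> e * (l / 8)"
    using hardy2_L1_diff[OF h \<eta>] by blast
  \<comment> \<open>For r > R both \<open>r\<close> and \<open>R * r\<close> then exceed
    \<open>x\<close>.\<close>
  define R where "R = sqrt x"
  have R: "0 < R" "R < 1" "R * R = x" using x by (auto simp: R_def)
  have "(\<lambda>z. h z - h (of_real R * z)) holomorphic_on ball 0 1"
  proof (intro holomorphic_intros hol holomorphic_on_compose_gen[OF _ hol, unfolded o_def])
    show "(*) (complex_of_real R) ` ball 0 1 \<subseteq> ball 0 1"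
    proof clarsimp
      fix z :: complex assume "cmod z < 1"
      then show "cmod (of_real R * z) < 1" using R mult_strict_mono'[of R 1 "cmod z" 1] by (simp add: norm_mult)
    qed
  qed
  moreover have "0 < l / 8" using l by simp
  ultimately obtain E where "E \<in> sets borel" "measure circ E \<le> e * (l / 8) / (l / 8)"
    "\<And>t r. t \<notin> E \<Longrightarrow> 0 < r \<Longrightarrow> r < 1 \<Longrightarrow> cmod (h (of_real r * cis t) - h (of_real R * (of_real r * cis t))) \<le> 8 * (l / 8)"
  proof (rule radial_maximal[where ?r0.0=R and A="e * (l / 8)"])
    fix r assume r: "R < r" "0 < r" "r < 1"
    have "(\<integral>t. cmod (h (of_real r * cis t) - h (of_real (R * r) * cis t)) \<partial>circ) \<le> e * (l / 8)"
    proof (rule L1)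
      show "x \<le> R * r" using R r by (auto simp flip: R(3))
      show "R * r < r" using R r by simp
    qed (use r in auto)
    then show "(\<integral>t. cmod (h (of_real r * cis t) - h (of_real R * (of_real r * cis t))) \<partial>circ) \<le> e * (l / 8)"
      by (simp add: mult.assoc)
  qed (use R that in auto)
  then show thesis using R l by (intro that[of R E]) (auto simp: mult.assoc)
qed

text \<open>By Borel-Cantelli almost every \<open>t\<close> avoids all but finitely many sets
  \<open>E j\<close>. For such \<open>t\<close> the dilates, each of which has a limit at 1,
  converge to \<open>h\<close> uniformly along the radius, so the two limits can be
  interchanged.\<close>

theorem hardy2_radial_limit:
  assumes h: "h \<in> hardy2"
  shows "AE t in circ. \<exists>l. ((\<lambda>r. h (of_real r * cis t)) \<longlongrightarrow> l) (at_left 1)"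
proof -
  have hol: "h holomorphic_on ball 0 1" using h by (simp add: hardy2_def)
  have "\<exists>R E. 0 < R \<and> R < 1 \<and> E \<in> sets borel \<and> measure circ E \<le> (1/2) ^ j \<and>
      (\<forall>t r. t \<notin> E \<longrightarrow> 0 < r \<longrightarrow> r < 1 \<longrightarrow> cmod (h (of_real r * cis t) - h (of_real (R * r) * cis t)) \<le> 1 / real (Suc j))" for j
    by (rule hardy2_dilation_close[OF h, of "1 / real (Suc j)" "(1/2) ^ j"]) auto
  then obtain R E where R: "\<And>j. 0 < R j" "\<And>j. R j < 1" and E: "\<And>j. E j \<in> sets borel" "\<And>j. measure circ (E j) \<le> (1/2) ^ j"
    and close: "\<And>j t r. t \<notin> E j \<Longrightarrow> 0 < r \<Longrightarrow> r < 1 \<Longrightarrow>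
        cmod (h (of_real r * cis t) - h (of_real (R j * r) * cis t)) \<le> 1 / real (Suc j)"
    by metis
  have "AE t in circ. eventually (\<lambda>j. t \<in> space circ - E j) sequentially"
  proof (rule borel_cantelli_AE1)
    show "summable (\<lambda>j. measure circ (E j))"
      by (rule summable_comparison_test[of _ "\<lambda>j. (1/2) ^ j"]) (use E(2) in auto)
  qed (use E in \<open>auto simp: circ.emeasure_eq_measure\<close>)
  then show ?thesis
  proof eventually_elim
    case (elim t)
    then have ev: "eventually (\<lambda>j. t \<notin> E j) sequentially" by simp
    define g where "g j r = h (of_real (R j * r) * cis t)" for j r
    define l where "l j = h (of_real (R j) * cis t)" for j
    have near: "eventually (\<lambda>r. 0 < r \<and> r < 1) (at_left (1::real))"
      using eventually_at_left_field[of _ "1::real"] by (auto intro!: exI[of _ 0])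
    have g: "(g j \<longlongrightarrow> l j) (at_left 1)" for j
    proof -
      have "isCont h (of_real (R j) * cis t)"
        using R[of j] by (intro continuous_on_interior[OF holomorphic_on_imp_continuous_on[OF hol]]) (auto simp: norm_mult)
      moreover have "((\<lambda>r. of_real (R j * r) * cis t) \<longlongrightarrow> of_real (R j * 1) * cis t) (at_left 1)"
        by (intro tendsto_intros)
      ultimately show ?thesis
        unfolding g_def l_def using isCont_tendsto_compose[where g=h] by (simp only: mult_1_right)
    qed
    have ll: "cmod (l i - l j) \<le> 1 / real (Suc i) + 1 / real (Suc j)" if "t \<notin> E i" "t \<notin> E j" for i j
    proof (rule tendsto_upperbound)
      show "((\<lambda>r. cmod (g i r - g j r)) \<longlongrightarrow> cmod (l i - l j)) (at_left 1)"
        by (intro tendsto_intros g)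
      show "\<forall>\<^sub>F r in at_left 1. cmod (g i r - g j r) \<le> 1 / real (Suc i) + 1 / real (Suc j)"
        using near
      proof eventually_elim
        case (elim r)
        have "cmod (g i r - g j r) \<le> cmod (h (of_real r * cis t) - g i r) + cmod (h (of_real r * cis t) - g j r)"
          by norm
        also have "\<dots> \<le> 1 / real (Suc i) + 1 / real (Suc j)"
          unfolding g_def using that elim by (intro add_mono close) auto
        finally show ?case .
      qed
    qed auto
    have inv0: "(\<lambda>j. 1 / real (Suc j)) \<longlonglongrightarrow> 0" by real_asymp
    have "Cauchy l"
    proof (rule metric_CauchyI)
      fix e :: real assume e: "0 < e"
      have "eventually (\<lambda>j. 1 / real (Suc j) < e / 2) sequentially"
        by (rule order_tendstoD(2)[OF inv0]) (use e in auto)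
      with ev have "eventually (\<lambda>j. t \<notin> E j \<and> 1 / real (Suc j) < e / 2) sequentially" by eventually_elim auto
      then obtain M where M: "\<And>j. j \<ge> M \<Longrightarrow> t \<notin> E j \<and> 1 / real (Suc j) < e / 2" by (auto simp: eventually_sequentially)
      then have "dist (l m) (l n) < e" if "m \<ge> M" "n \<ge> M" for m n
        using ll[of m n] M[OF that(1)] M[OF that(2)] by (auto simp: dist_norm)
      then show "\<exists>M. \<forall>m\<ge>M. \<forall>n\<ge>M. dist (l m) (l n) < e" by blast
    qed
    then obtain L where L: "l \<longlonglongrightarrow> L" by (auto simp: Cauchy_convergent_iff convergent_def)
    have "((\<lambda>r. h (of_real r * cis t)) \<longlongrightarrow> L) (at 1 within {0<..<1})"
    proof (rule swap_uniform_limit)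
      have at: "at_left (1::real) = at 1 within {0<..<1}"
        by (rule at_within_nhd[of _ "{0<..<2}"]) auto
      show "\<forall>\<^sub>F n in sequentially. (g n \<longlongrightarrow> l n) (at 1 within {0<..<1})"
        using g by (auto simp flip: at)
      show "uniform_limit {0<..<1} g (\<lambda>r. h (of_real r * cis t)) sequentially"
      proof (rule uniform_limitI)
        fix e :: real assume e: "0 < e"
        have "eventually (\<lambda>j. 1 / real (Suc j) < e) sequentially"
          by (rule order_tendstoD(2)[OF inv0]) (use e in auto)
        with ev show "\<forall>\<^sub>F n in sequentially. \<forall>r\<in>{0<..<1}. dist (g n r) (h (of_real r * cis t)) < e"
        proof eventually_elim
          case (elim j)
          show ?case
          proof
            fix r :: real assume "r \<in> {0<..<1}"
            then have "cmod (h (of_real r * cis t) - g j r) \<le> 1 / real (Suc j)"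
              unfolding g_def using elim by (intro close) auto
            then show "dist (g j r) (h (of_real r * cis t)) < e"
              using elim by (simp add: dist_norm norm_minus_commute)
          qed
        qed
      qed
    qed (use L in auto)
    moreover have "at_left (1::real) = at 1 within {0<..<1}"
      by (rule at_within_nhd[of _ "{0<..<2}"]) auto
    ultimately show ?case by metis
  qed
qed

section \<open>The boundary function\<close>

definition radial_seq :: "nat \<Rightarrow> real" where
  "radial_seq k = 1 - 1 / real (k + 2)"

lemma radial_seq: "0 < radial_seq k" "radial_seq k < 1"
  by (auto simp: radial_seq_def field_simps)

lemma radial_seq_at_left: "filterlim radial_seq (at_left 1) sequentially"
proof (subst filterlim_at, intro conjI)
  show "radial_seq \<longlonglongrightarrow> 1" unfolding radial_seq_def by real_asymp
qed (use radial_seq in \<open>auto simp: less_imp_neq\<close>)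

text \<open>A limit along one fixed sequence is measurable everywhere, whereas
  \<open>boundary_fn\<close> is a limit over all radii with arbitrary values where it does not
  exist. On \<open>hardy2\<close> the two agree almost everywhere.\<close>

definition radial_lim :: "(complex \<Rightarrow> complex) \<Rightarrow> real \<Rightarrow> complex" where
  "radial_lim h t = lim (\<lambda>k. h (of_real (radial_seq k) * cis t))"

lemma radial_lim_measurable:
  assumes "h holomorphic_on ball 0 1"
  shows "radial_lim h \<in> borel_measurable borel"
proof -
  have [measurable]: "circle_restr h (radial_seq k) \<in> borel_measurable borel" for k
    using radial_seq[of k] by (intro bounded_borel_measurable bounded_borel_holomorphic assms) auto
  show ?thesis
    unfolding radial_lim_def[abs_def] by (rule borel_measurable_lim_metric) simp
qed

lemma radial_lim:
  assumes h: "h \<in> hardy2"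
  shows "AE t in circ. boundary_fn h t = radial_lim h t \<and>
    (\<lambda>k. h (of_real (radial_seq k) * cis t)) \<longlonglongrightarrow> radial_lim h t"
  using hardy2_radial_limit[OF h]
proof eventually_elim
  case (elim t)
  then obtain l where l: "((\<lambda>r. h (of_real r * cis t)) \<longlongrightarrow> l) (at_left 1)" by blast
  then have "boundary_fn h t = l"
    unfolding boundary_fn_def by (intro tendsto_Lim) auto
  moreover have s: "(\<lambda>k. h (of_real (radial_seq k) * cis t)) \<longlonglongrightarrow> l"
    using filterlim_compose[OF l radial_seq_at_left] .
  then have "radial_lim h t = l" unfolding radial_lim_def by (rule limI)
  ultimately show ?case using s by simp
qed

lemma radial_lim_Fatou:
  assumes h: "h \<in> hardy2" and G: "continuous_on UNIV G"
    and le: "\<And>k. (\<integral>\<^sup>+ t. ennreal (G (h (of_real (radial_seq k) * cis t))) \<partial>circ) \<le> c k"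
  shows "(\<integral>\<^sup>+ t. ennreal (G (radial_lim h t)) \<partial>circ) \<le> liminf c"
proof -
  have hol: "h holomorphic_on ball 0 1" using h by (simp add: hardy2_def)
  have [measurable]: "G \<in> borel_measurable borel" using G by (rule borel_measurable_continuous_onI)
  have [measurable]: "circle_restr h (radial_seq k) \<in> borel_measurable borel" for k
    using radial_seq[of k] by (intro bounded_borel_measurable bounded_borel_holomorphic hol) auto
  have "(\<integral>\<^sup>+ t. ennreal (G (radial_lim h t)) \<partial>circ)
      = (\<integral>\<^sup>+ t. liminf (\<lambda>k. ennreal (G (h (of_real (radial_seq k) * cis t)))) \<partial>circ)"
  proof (rule nn_integral_cong_AE, use radial_lim[OF h] in eventually_elim)
    case (elim t)
    then have "(\<lambda>k. ennreal (G (h (of_real (radial_seq k) * cis t)))) \<longlonglongrightarrow> ennreal (G (radial_lim h t))"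
      using G by (intro tendsto_ennrealI continuous_on_tendsto_compose[OF G]) auto
    then show ?case by (intro lim_imp_Liminf[symmetric]) auto
  qed
  also have "\<dots> \<le> liminf (\<lambda>k. \<integral>\<^sup>+ t. ennreal (G (h (of_real (radial_seq k) * cis t))) \<partial>circ)"
    by (rule nn_integral_liminf) measurable
  also have "\<dots> \<le> liminf c"
    by (intro Liminf_mono always_eventually allI le)
  finally show ?thesis .
qed

text \<open>Fatou's lemma lets the outer circle in the L^1 Cauchy estimate tend to the
  boundary.\<close>

lemma radial_lim_L1:
  assumes h: "h \<in> hardy2" and \<eta>: "0 < \<eta>"
  obtains x where "0 < x" "x < 1"
    "\<And>s. x \<le> s \<Longrightarrow> s < 1 \<Longrightarrow> (\<integral>\<^sup>+ t. ennreal (cmod (radial_lim h t - h (of_real s * cis t))) \<partial>circ) \<le> ennreal \<eta>"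
proof -
  have hol: "h holomorphic_on ball 0 1" using h by (simp add: hardy2_def)
  obtain x where x: "0 < x" "x < 1"
    and L1: "\<And>r s. x \<le> s \<Longrightarrow> s < r \<Longrightarrow> r < 1 \<Longrightarrow> (\<integral>t. cmod (h (of_real r * cis t) - h (of_real s * cis t)) \<partial>circ) \<le> \<eta>"
    using hardy2_L1_diff[OF h \<eta>] by blast
  show thesis
  proof (rule that[OF x])
    fix s assume s: "x \<le> s" "s < 1"
    define c where "c k = (\<integral>\<^sup>+ t. ennreal (cmod (h (of_real (radial_seq k) * cis t) - h (of_real s * cis t))) \<partial>circ)" for k
    have [measurable]: "circle_restr h (radial_seq k) \<in> borel_measurable borel" for k
      using radial_seq[of k] by (intro bounded_borel_measurable bounded_borel_holomorphic hol) auto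
    have [measurable]: "circle_restr h s \<in> borel_measurable borel"
      using s x by (intro bounded_borel_measurable bounded_borel_holomorphic hol) auto
    have "(\<integral>\<^sup>+ t. ennreal (cmod (radial_lim h t - h (of_real s * cis t))) \<partial>circ)
      = (\<integral>\<^sup>+ t. liminf (\<lambda>k. ennreal (cmod (h (of_real (radial_seq k) * cis t) - h (of_real s * cis t)))) \<partial>circ)"
    proof (rule nn_integral_cong_AE, use radial_lim[OF h] in eventually_elim)
      case (elim t)
      then have "(\<lambda>k. ennreal (cmod (h (of_real (radial_seq k) * cis t) - h (of_real s * cis t))))
          \<longlonglongrightarrow> ennreal (cmod (radial_lim h t - h (of_real s * cis t)))"
        by (intro tendsto_intros) auto
      then show ?case by (intro lim_imp_Liminf[symmetric]) auto
    qed
    also have "\<dots> \<le> liminf c"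
      unfolding c_def by (rule nn_integral_liminf) measurable
    also have "\<dots> \<le> ennreal \<eta>"
    proof -
      have "eventually (\<lambda>k. s < radial_seq k) sequentially"
        using radial_seq_at_left s order_tendstoD(1)[of radial_seq 1 sequentially s]
        by (auto simp: filterlim_at)
      then have "eventually (\<lambda>k. c k \<le> ennreal \<eta>) sequentially"
      proof eventually_elim
        case (elim k)
        have "bounded_borel (\<lambda>t. cmod (h (of_real (radial_seq k) * cis t) - h (of_real s * cis t)))"
          using s x radial_seq[of k] by (intro bounded_borel_intros bounded_borel_holomorphic hol) auto
        then have "c k = ennreal (\<integral>t. cmod (h (of_real (radial_seq k) * cis t) - h (of_real s * cis t)) \<partial>circ)"
          unfolding c_def by (intro nn_integral_eq_integral bounded_borel_integrable) auto
        also have "\<dots> \<le> ennreal \<eta>"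
          using elim s radial_seq by (intro ennreal_leI L1) auto
        finally show ?case .
      qed
      then have "liminf c \<le> liminf (\<lambda>_. ennreal \<eta>)" by (rule Liminf_mono)
      then show ?thesis by (simp add: Liminf_const)
    qed
    finally show "(\<integral>\<^sup>+ t. ennreal (cmod (radial_lim h t - h (of_real s * cis t))) \<partial>circ) \<le> ennreal \<eta>" .
  qed
qed

text \<open>The domination is known from circles inside the disc. Replacing the values on the circle
  of radius \<open>r\<close> by radial limits costs their L^1 distance times the maximum of the
  kernel, which becomes negligible as \<open>r\<close> tends to 1.\<close>

theorem radial_lim_poisson:
  assumes h: "h \<in> hardy2" and q: "0 \<le> q" "q < 1"
  shows "ennreal (cmod (h (of_real q * cis t))) \<le> (\<integral>\<^sup>+ s. ennreal (poisson q t s * cmod (radial_lim h s)) \<partial>circ)"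
    (is "_ \<le> ?I")
proof (cases "?I = \<infinity>")
  case False
  have hol: "h holomorphic_on ball 0 1" using h by (simp add: hardy2_def)
  have [measurable]: "radial_lim h \<in> borel_measurable borel" by (rule radial_lim_measurable[OF hol])
  obtain i where i: "?I = ennreal i" "0 \<le> i" using False by (cases ?I) auto
  have "cmod (h (of_real q * cis t)) \<le> i + e" if e: "0 < e" for e
  proof -
    \<comment> \<open>The factor cancels against the bound 1 / (1 - q)^2 of the kernel and leaves
      the error \<open>e\<close>.\<close>
    have e': "0 < e * (1 - q)\<^sup>2" using e q by simp
    obtain x where x: "0 < x" "x < 1" and L1: "\<And>s. x \<le> s \<Longrightarrow> s < 1 \<Longrightarrow>
        (\<integral>\<^sup>+ t. ennreal (cmod (radial_lim h t - h (of_real s * cis t))) \<partial>circ) \<le> ennreal (e * (1 - q)\<^sup>2)"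
      using radial_lim_L1[OF h e'] by blast
    have le: "cmod (h (of_real (r * q) * cis t)) \<le> i + e" if r: "x < r" "r < 1" for r
    proof -
      have r0: "0 < r" using r x by simp
      have b: "bounded_borel (circle_restr h r)" using r r0 by (intro bounded_borel_holomorphic hol) auto
      have [measurable]: "circle_restr h r \<in> borel_measurable borel" by (rule bounded_borel_measurable[OF b])
      have pp: "poisson q t s \<ge> 0" "poisson q t s \<le> 1 / (1 - q)\<^sup>2" for s
        using poisson_pos[OF q, of t s] poisson_le[OF q] by auto
      have "ennreal (cmod (h (of_real (r * q) * cis t))) \<le> ennreal (poisson_op q (\<lambda>s. cmod (h (of_real r * cis s))) t)"
        by (intro ennreal_leI norm_dilation_le hol r r0 q)
      also have "\<dots> = (\<integral>\<^sup>+ s. ennreal (poisson q t s *\<^sub>R cmod (h (of_real r * cis s))) \<partial>circ)"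
        unfolding poisson_op_def using pp
        by (intro nn_integral_eq_integral[symmetric] integrable_poisson_bounded q bounded_borel_norm b) auto
      also have "\<dots> \<le> (\<integral>\<^sup>+ s. ennreal (poisson q t s * cmod (radial_lim h s))
          + ennreal (1 / (1 - q)\<^sup>2) * ennreal (cmod (radial_lim h s - h (of_real r * cis s))) \<partial>circ)"
      proof (rule nn_integral_mono)
        fix s
        have "cmod (h (of_real r * cis s)) \<le> cmod (radial_lim h s) + cmod (radial_lim h s - h (of_real r * cis s))"
          by norm
        then have "poisson q t s * cmod (h (of_real r * cis s))
            \<le> poisson q t s * cmod (radial_lim h s) + poisson q t s * cmod (radial_lim h s - h (of_real r * cis s))"
          using mult_left_mono[OF _ pp(1)] by (metis distrib_left)
        also have "\<dots> \<le> poisson q t s * cmod (radial_lim h s) + 1 / (1 - q)\<^sup>2 * cmod (radial_lim h s - h (of_real r * cis s))"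
          by (intro add_left_mono mult_right_mono pp) auto
        finally show "ennreal (poisson q t s *\<^sub>R cmod (h (of_real r * cis s))) \<le> ennreal (poisson q t s * cmod (radial_lim h s))
          + ennreal (1 / (1 - q)\<^sup>2) * ennreal (cmod (radial_lim h s - h (of_real r * cis s)))"
          using pp by (simp flip: ennreal_plus ennreal_mult)
      qed
      also have "\<dots> = ?I + ennreal (1 / (1 - q)\<^sup>2) * (\<integral>\<^sup>+ s. ennreal (cmod (radial_lim h s - h (of_real r * cis s))) \<partial>circ)"
        by (subst nn_integral_add) (auto simp: nn_integral_cmult)
      also have "\<dots> \<le> ennreal i + ennreal (1 / (1 - q)\<^sup>2) * ennreal (e * (1 - q)\<^sup>2)"
        unfolding i(1) using r x by (intro add_left_mono mult_left_mono L1) auto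
      also have "\<dots> = ennreal (i + e)"
        using q e i by (simp flip: ennreal_plus ennreal_mult)
      finally show ?thesis by (subst (asm) ennreal_le_iff) (use i e in auto)
    qed
    show ?thesis
    proof (rule tendsto_upperbound)
      have "isCont h (of_real q * cis t)"
        using q by (intro continuous_on_interior[OF holomorphic_on_imp_continuous_on[OF hol]]) (auto simp: norm_mult)
      moreover have "((\<lambda>r. of_real (r * q) * cis t) \<longlongrightarrow> of_real (1 * q) * cis t) (at_left 1)"
        by (intro tendsto_intros)
      ultimately show "((\<lambda>r. cmod (h (of_real (r * q) * cis t))) \<longlongrightarrow> cmod (h (of_real q * cis t))) (at_left 1)"
        using tendsto_norm[OF isCont_tendsto_compose[where g=h]] by (simp only: mult_1)
      show "\<forall>\<^sub>F r in at_left 1. cmod (h (of_real (r * q) * cis t)) \<le> i + e"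
        unfolding eventually_at_left_field using le x by blast
    qed auto
  qed
  then have "cmod (h (of_real q * cis t)) \<le> i" by (rule field_le_epsilon)
  then show ?thesis unfolding i(1) by (rule ennreal_leI)
qed auto

subsection \<open>Orlicz functions\<close>

locale orlicz =
  fixes \<Psi> :: "real \<Rightarrow> real"
  assumes orlicz: "orlicz_fn \<Psi>"
begin

lemma zero [simp]: "\<Psi> 0 = 0"
  and nonneg: "0 \<le> x \<Longrightarrow> 0 \<le> \<Psi> x"
  and continuous: "continuous_on {0..} \<Psi>"
  and superlinear: "filterlim (\<lambda>x. \<Psi> x / x) at_top at_top"
  using orlicz by (auto simp: orlicz_fn_def)

lemma strict_mono: "0 \<le> x \<Longrightarrow> x < y \<Longrightarrow> \<Psi> x < \<Psi> y"
  using orlicz by (auto simp: orlicz_fn_def strict_mono_on_def)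

lemma mono: "0 \<le> x \<Longrightarrow> x \<le> y \<Longrightarrow> \<Psi> x \<le> \<Psi> y"
  using strict_mono[of x y] by (cases "x = y") auto

lemma pos: "0 < x \<Longrightarrow> 0 < \<Psi> x"
  using strict_mono[of 0 x] by simp

lemma convex: "convex_on {0..} \<Psi>"
proof (rule convex_onI)
  fix t x y :: real assume t: "0 < t" "t < 1" and xy: "x \<in> {0..}" "y \<in> {0..}"
  show "\<Psi> ((1 - t) *\<^sub>R x + t *\<^sub>R y) \<le> (1 - t) * \<Psi> x + t * \<Psi> y"
  proof (cases "x = y")
    case True
    then show ?thesis by (simp flip: distrib_right)
  next
    case False
    then show ?thesis
      using orlicz t xy unfolding orlicz_fn_def strictly_convex_on_def by (auto intro!: less_imp_le)
  qed
qed (auto intro: convex_real_interval)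

lemma scale_le:
  assumes "0 \<le> l" "l \<le> 1" "0 \<le> x"
  shows "\<Psi> (l * x) \<le> l * \<Psi> x"
  using convex_onD[OF convex assms(1,2), of 0 x] assms by simp

text \<open>The right derivative of \<Psi> at positive points, in the form that
  \<open>convex_le_Inf_differential\<close> expects. The value 0 is a subgradient at 0, as \<Psi> is
  nonnegative, and keeps the function monotone on the whole line.\<close>

definition slope :: "real \<Rightarrow> real" where
  "slope x = (if x \<le> 0 then 0 else Inf ((\<lambda>t. (\<Psi> x - \<Psi> t) / (x - t)) ` {x<..}))"

lemma slope_le:
  assumes "0 \<le> x" "0 \<le> y"
  shows "\<Psi> x + slope x * (y - x) \<le> \<Psi> y"
proof (cases "x = 0")
  case True
  then show ?thesis using nonneg[OF assms(2)] by (simp add: slope_def)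
next
  case False
  have "{x<..} \<inter> {0..} = {x<..}" using assms by auto
  moreover have "x \<in> interior {0..}" using False assms by (simp add: interior_real_atLeast)
  ultimately show ?thesis
    using convex_le_Inf_differential[OF convex, of x y] False assms by (simp add: slope_def)
qed

lemma slope_nonneg: "0 \<le> slope x"
proof (cases "x \<le> 0")
  case False
  have "0 \<le> (\<Psi> x - \<Psi> t) / (x - t)" if "t > x" for t
    using that False mono[of x t] by (intro divide_nonpos_nonpos) auto
  then show ?thesis
    using False by (auto simp: slope_def intro!: cInf_greatest)
qed (simp add: slope_def)

lemma slope_mono: "x \<le> y \<Longrightarrow> slope x \<le> slope y"
proof (cases "x \<le> 0 \<or> x = y")
  case True
  then show ?thesis using slope_nonneg[of y] by (auto simp: slope_def)
next
  case False
  assume "x \<le> y"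
  with False have xy: "0 < x" "x < y" by auto
  have "slope x * (y - x) \<le> slope y * (y - x)"
    using slope_le[of x y] slope_le[of y x] xy by (simp add: algebra_simps)
  then show ?thesis using xy by (simp add: mult_le_cancel_right)
qed

lemma slope_measurable [measurable]: "slope \<in> borel_measurable borel"
  using slope_mono by (intro borel_measurable_mono) (auto simp: monotone_def)

lemma continuous_abs: "continuous_on UNIV (\<lambda>x. \<Psi> \<bar>x\<bar>)"
  by (intro continuous_on_compose2[OF continuous] continuous_intros) auto

lemma abs_measurable [measurable]: "(\<lambda>x. \<Psi> \<bar>x\<bar>) \<in> borel_measurable borel"
  using continuous_abs by (rule borel_measurable_continuous_onI)

lemma at_top: "filterlim \<Psi> at_top at_top"
proof (rule filterlim_at_top_mono)
  show "filterlim (\<lambda>x. \<Psi> x / x) at_top at_top" by (rule superlinear)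
  show "\<forall>\<^sub>F x in at_top. \<Psi> x / x \<le> \<Psi> x"
    using eventually_ge_at_top[of 1]
  proof eventually_elim
    case (elim x)
    then show ?case using nonneg[of x] mult_left_mono[of 1 x "\<Psi> x"] by (simp add: field_simps)
  qed
qed

lemma inv:
  assumes "0 \<le> y"
  shows "0 \<le> orlicz_inv \<Psi> y" "\<Psi> (orlicz_inv \<Psi> y) = y"
proof -
  have inj: "inj_on \<Psi> {0..}"
    using strict_mono by (intro linorder_inj_onI) (auto simp: less_imp_neq)
  obtain x where x: "0 \<le> x" "y \<le> \<Psi> x"
    using at_top eventually_ge_at_top[of 0] unfolding filterlim_at_top
    by (metis (mono_tags, lifting) eventually_at_top_linorder linorder_linear order_trans)
  have "\<exists>z. 0 \<le> z \<and> z \<le> x \<and> \<Psi> z = y"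
    using x assms by (intro IVT') (auto intro: continuous_on_subset[OF continuous])
  then have "y \<in> \<Psi> ` {0..}" by auto
  then show "0 \<le> orlicz_inv \<Psi> y" "\<Psi> (orlicz_inv \<Psi> y) = y"
    unfolding orlicz_inv_def using the_inv_into_into[OF inj _ subset_refl] f_the_inv_into_f[OF inj] by auto
qed

lemma inv_pos: "0 < y \<Longrightarrow> 0 < orlicz_inv \<Psi> y"
  using inv[of y] zero by (metis less_eq_real_def less_irrefl)

text \<open>Superlinear growth gives \<Psi> c \<ge> c / \<nu> for large c, to be used with \<Psi> c
  = 1 / (1 - r). The product bounds the L^1 means of the scaled test functions.\<close>

lemma inv_sublinear:
  assumes "0 < \<nu>"
  obtains r0 where "0 \<le> r0" "r0 < 1" "\<And>r. r0 < r \<Longrightarrow> r < 1 \<Longrightarrow> orlicz_inv \<Psi> (1 / (1 - r)) * (1 - r) \<le> \<nu>"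
proof -
  have "eventually (\<lambda>x. 1 / \<nu> \<le> \<Psi> x / x) at_top"
    using superlinear by (simp add: filterlim_at_top)
  then obtain X where X: "0 < X" "\<And>x. x \<ge> X \<Longrightarrow> 1 / \<nu> \<le> \<Psi> x / x"
    unfolding eventually_at_top_linorder by (metis max.bounded_iff max.cobounded1 less_max_iff_disj zero_less_one)
  show thesis
  proof (rule that)
    have P: "0 \<le> \<Psi> X" using X nonneg by auto
    \<comment> \<open>Beyond this radius 1 / (1 - r) exceeds \<Psi> X, so the inverse value is at
      least \<open>X\<close>.\<close>
    show "0 \<le> 1 - 1 / (\<Psi> X + 1)" "1 - 1 / (\<Psi> X + 1) < 1" using P by auto
    fix r assume r: "1 - 1 / (\<Psi> X + 1) < r" "r < 1"
    define c where "c = orlicz_inv \<Psi> (1 / (1 - r))"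
    have c: "0 \<le> c" "\<Psi> c = 1 / (1 - r)" using inv[of "1 / (1 - r)"] r by (auto simp: c_def)
    have "\<Psi> X < 1 / (1 - r)" using r P by (simp add: field_simps)
    then have "X \<le> c" using c mono[of c X] by (cases "X \<le> c") auto
    then have "1 / \<nu> \<le> 1 / (1 - r) / c" "0 < c" using X(2)[of c] c X(1) by auto
    then show "orlicz_inv \<Psi> (1 / (1 - r)) * (1 - r) \<le> \<nu>"
      unfolding c_def[symmetric] using r assms by (simp add: field_simps)
  qed
qed

subsection \<open>Luxemburg norms\<close>

text \<open>The integral behind the Luxemburg norm, kept in \<open>ennreal\<close> because for a
  boundary function it may a priori be infinite.\<close>

definition modular :: "(real \<Rightarrow> complex) \<Rightarrow> ennreal" where
  "modular g = (\<integral>\<^sup>+ t. ennreal (\<Psi> (cmod (g t))) \<partial>circ)"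

lemma measurable_norm [measurable]:
  assumes [measurable]: "g \<in> borel_measurable M"
  shows "(\<lambda>t. \<Psi> (cmod (g t))) \<in> borel_measurable M"
  using measurable_compose[OF _ abs_measurable, of "\<lambda>t. cmod (g t)" M] by simp

text \<open>Besides changing the measure, this replaces the boundary function by a measurable
  representative.\<close>

lemma luxemburg_eq:
  assumes [measurable]: "g \<in> borel_measurable borel" and AE: "AE t in circ. f t = g t"
  shows "luxemburg \<Psi> f = Inf {C. 0 < C \<and> modular (\<lambda>t. g t / of_real C) \<le> 1}"
proof -
  have "(\<integral>\<^sup>+ t. ennreal (\<Psi> (cmod (f t) / C) / (2 * pi)) * indicator {0..2*pi} t \<partial>lborel) = modular (\<lambda>t. g t / of_real C)"
    if C: "0 < C" for C
  proof -
    have "(\<integral>\<^sup>+ t. ennreal (\<Psi> (cmod (f t) / C) / (2 * pi)) * indicator {0..2*pi} t \<partial>lborel)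
        = (\<integral>\<^sup>+ t. ennreal (\<Psi> (cmod (g t / of_real C)) / (2 * pi)) * indicator {0..2*pi} t \<partial>lborel)"
      using AE C unfolding AE_circ
      by (intro nn_integral_cong_AE) (auto elim!: eventually_mono simp: norm_divide indicator_def)
    also have "\<dots> = modular (\<lambda>t. g t / of_real C)"
      unfolding modular_def by (rule nn_integral_circ) (measurable, simp add: nonneg)
    finally show ?thesis .
  qed
  then show ?thesis
    unfolding luxemburg_def by (intro arg_cong[where f=Inf]) auto
qed

lemma modular_mono:
  assumes "\<And>t. cmod (f t) \<le> cmod (g t)"
  shows "modular f \<le> modular g"
  unfolding modular_def using assms by (intro nn_integral_mono ennreal_leI mono) auto

lemma modular_scale_mono:
  assumes "0 < C" "C \<le> D"
  shows "modular (\<lambda>t. g t / of_real D) \<le> modular (\<lambda>t. g t / of_real C)"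
  using assms by (intro modular_mono) (auto simp: norm_divide intro: divide_left_mono)

lemma modular_bounded_le:
  assumes "\<And>t. cmod (g t) \<le> orlicz_inv \<Psi> 1"
  shows "modular g \<le> 1"
proof -
  have "modular g \<le> (\<integral>\<^sup>+ t. ennreal 1 \<partial>circ)"
    unfolding modular_def
  proof (intro nn_integral_mono ennreal_leI)
    fix t show "\<Psi> (cmod (g t)) \<le> 1" using mono[OF _ assms, of t] inv[of 1] by simp
  qed
  then show ?thesis by simp
qed

lemma luxemburg_le:
  assumes "g \<in> borel_measurable borel" "AE t in circ. f t = g t" "0 < C" "modular (\<lambda>t. g t / of_real C) \<le> 1"
  shows "luxemburg \<Psi> f \<le> C"
  unfolding luxemburg_eq[OF assms(1,2)] using assms(3,4) by (intro cInf_lower bdd_belowI[of _ 0]) auto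

text \<open>A bound for the norms is a bound for infima, and \<open>Inf\<close> of an empty set
  would carry no information. On each circle the function is bounded, so admissible constants exist,
  one of them lies below \<open>\<bar>B\<bar> + 1\<close>, and larger constants stay
  admissible.\<close>

lemma hardy_orlicz_iff:
  "h \<in> hardy_orlicz \<Psi> \<longleftrightarrow> h holomorphic_on ball 0 1 \<and>
    (\<exists>C>0. \<forall>r. 0 \<le> r \<longrightarrow> r < 1 \<longrightarrow> modular (\<lambda>t. h (of_real r * cis t) / of_real C) \<le> 1)"
proof (cases "h holomorphic_on ball 0 1")
  case True
  have b: "bounded_borel (circle_restr h r)" if "0 \<le> r" "r < 1" for r
    using that by (intro bounded_borel_holomorphic True)
  let ?l = "\<lambda>r. luxemburg \<Psi> (circle_restr h r)"
  have "(\<exists>C>0. \<forall>r. 0 \<le> r \<longrightarrow> r < 1 \<longrightarrow> modular (\<lambda>t. h (of_real r * cis t) / of_real C) \<le> 1) \<longleftrightarrow> bdd_above (?l ` {0..<1})"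
  proof
    assume "\<exists>C>0. \<forall>r. 0 \<le> r \<longrightarrow> r < 1 \<longrightarrow> modular (\<lambda>t. h (of_real r * cis t) / of_real C) \<le> 1"
    then obtain C where "0 < C" "\<And>r. 0 \<le> r \<Longrightarrow> r < 1 \<Longrightarrow> modular (\<lambda>t. h (of_real r * cis t) / of_real C) \<le> 1" by auto
    then have "?l r \<le> C" if "r \<in> {0..<1}" for r
      using that by (intro luxemburg_le[where g="circle_restr h r"] bounded_borel_measurable[OF b]) auto
    then show "bdd_above (?l ` {0..<1})" by (intro bdd_aboveI[of _ C]) auto
  next
    assume "bdd_above (?l ` {0..<1})"
    then obtain B where B: "\<And>r. 0 \<le> r \<Longrightarrow> r < 1 \<Longrightarrow> ?l r \<le> B"
      unfolding bdd_above_def by (metis atLeastLessThan_iff imageI)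
    have "modular (\<lambda>t. h (of_real r * cis t) / of_real (\<bar>B\<bar> + 1)) \<le> 1" if r: "0 \<le> r" "r < 1" for r
    proof -
      let ?S = "{C. 0 < C \<and> modular (\<lambda>t. h (of_real r * cis t) / of_real C) \<le> 1}"
      obtain K where K: "\<And>t. cmod (h (of_real r * cis t)) \<le> K" "0 \<le> K"
        using b[OF r] by (meson bounded_borelE)
      define x where "x = orlicz_inv \<Psi> 1"
      have x: "0 < x" unfolding x_def by (rule inv_pos) simp
      \<comment> \<open>Division by this constant brings the bound \<open>K\<close> down to at most
        \<open>x\<close>, and \<Psi> x = 1. The summand 1 keeps the constant positive when K =
        0.\<close>
      have "K / x + 1 \<in> ?S"
      proof (intro CollectI conjI modular_bounded_le)
        show "0 < K / x + 1" using K x by (simp add: add_nonneg_pos)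
        fix t
        have "cmod (h (of_real r * cis t)) \<le> x * (K / x + 1)" using K(1)[of t] x by (simp add: distrib_left)
        then show "cmod (h (of_real r * cis t) / of_real (K / x + 1)) \<le> orlicz_inv \<Psi> 1"
          using \<open>0 < K / x + 1\<close> unfolding x_def[symmetric] norm_divide norm_of_real by (simp add: pos_divide_le_eq)
      qed
      then have ne: "?S \<noteq> {}" by blast
      have "Inf ?S \<le> B"
        using B[OF r] luxemburg_eq[OF bounded_borel_measurable[OF b[OF r]], of "circle_restr h r"] by simp
      then have "Inf ?S < \<bar>B\<bar> + 1" by linarith
      then obtain C where C: "C \<in> ?S" "C < \<bar>B\<bar> + 1" using cInf_lessD[OF ne] by blast
      have "modular (\<lambda>t. h (of_real r * cis t) / of_real (\<bar>B\<bar> + 1)) \<le> modular (\<lambda>t. h (of_real r * cis t) / of_real C)"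
        using C by (intro modular_scale_mono) auto
      also have "\<dots> \<le> 1" using C by simp
      finally show ?thesis .
    qed
    then show "\<exists>C>0. \<forall>r. 0 \<le> r \<longrightarrow> r < 1 \<longrightarrow> modular (\<lambda>t. h (of_real r * cis t) / of_real C) \<le> 1"
      by (intro exI[of _ "\<bar>B\<bar> + 1"]) auto
  qed
  then show ?thesis using True by (simp add: hardy_orlicz_def)
qed (simp add: hardy_orlicz_def)

lemma hardy_orlicz_lincomb:
  assumes f: "f \<in> hardy_orlicz \<Psi>" and g: "g \<in> hardy_orlicz \<Psi>"
  shows "(\<lambda>z. a * f z + b * g z) \<in> hardy_orlicz \<Psi>"
proof -
  obtain C where C: "0 < C" "\<And>r. 0 \<le> r \<Longrightarrow> r < 1 \<Longrightarrow> modular (\<lambda>t. f (of_real r * cis t) / of_real C) \<le> 1"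
    and hf: "f holomorphic_on ball 0 1" using f unfolding hardy_orlicz_iff by auto
  obtain D where D: "0 < D" "\<And>r. 0 \<le> r \<Longrightarrow> r < 1 \<Longrightarrow> modular (\<lambda>t. g (of_real r * cis t) / of_real D) \<le> 1"
    and hg: "g holomorphic_on ball 0 1" using g unfolding hardy_orlicz_iff by auto
  \<comment> \<open>The factor 2 leaves each summand the weight 1/2 in the convexity inequality; the
    1 keeps \<open>E\<close> positive when both coefficients vanish.\<close>
  define E where "E = 2 * (cmod a * C + cmod b * D + 1)"
  define k where "k = (1/2 :: real)"
  have k: "0 \<le> k" by (simp add: k_def)
  have E0: "0 < E" using C D by (simp add: E_def add_nonneg_pos)
  have "modular (\<lambda>t. (a * f (of_real r * cis t) + b * g (of_real r * cis t)) / of_real E) \<le> 1" if r: "0 \<le> r" "r < 1" for r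
  proof -
    define u where "u t = cmod (f (of_real r * cis t)) / C" for t
    define v where "v t = cmod (g (of_real r * cis t)) / D" for t
    have uv: "0 \<le> u t" "0 \<le> v t" for t using C D by (auto simp: u_def v_def)
    have [measurable]: "circle_restr f r \<in> borel_measurable borel" "circle_restr g r \<in> borel_measurable borel"
      using bounded_borel_holomorphic[OF hf r] bounded_borel_holomorphic[OF hg r]
      by (auto dest: bounded_borel_measurable)
    have "modular (\<lambda>t. (a * f (of_real r * cis t) + b * g (of_real r * cis t)) / of_real E)
        \<le> (\<integral>\<^sup>+ t. ennreal k * ennreal (\<Psi> (u t)) + ennreal k * ennreal (\<Psi> (v t)) \<partial>circ)"
      unfolding modular_def
    proof (rule nn_integral_mono)
      fix t
      have "cmod (a * f (of_real r * cis t) + b * g (of_real r * cis t)) \<le> cmod a * C * u t + cmod b * D * v t"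
        using C D norm_triangle_ineq[of "a * f (of_real r * cis t)" "b * g (of_real r * cis t)"] by (simp add: u_def v_def norm_mult)
      also have "\<dots> \<le> (E / 2) * u t + (E / 2) * v t"
        using C D uv by (intro add_mono mult_right_mono) (auto simp: E_def)
      finally have "cmod ((a * f (of_real r * cis t) + b * g (of_real r * cis t)) / of_real E) \<le> (1/2) * u t + (1/2) * v t"
        using E0 by (simp add: norm_divide field_simps)
      then have "\<Psi> (cmod ((a * f (of_real r * cis t) + b * g (of_real r * cis t)) / of_real E)) \<le> \<Psi> ((1/2) * u t + (1/2) * v t)"
        by (intro mono) auto
      also have "\<dots> \<le> k * \<Psi> (u t) + k * \<Psi> (v t)"
        using convex_onD[OF convex, of "1/2" "u t" "v t"] uv by (simp add: k_def)
      finally show "ennreal (\<Psi> (cmod ((a * f (of_real r * cis t) + b * g (of_real r * cis t)) / of_real E)))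
        \<le> ennreal k * ennreal (\<Psi> (u t)) + ennreal k * ennreal (\<Psi> (v t))"
        using uv nonneg k by (simp flip: ennreal_plus ennreal_mult)
    qed
    also have "\<dots> = ennreal k * modular (\<lambda>t. f (of_real r * cis t) / of_real C) + ennreal k * modular (\<lambda>t. g (of_real r * cis t) / of_real D)"
    proof -
      have "u t = cmod (f (of_real r * cis t) / of_real C)" "v t = cmod (g (of_real r * cis t) / of_real D)" for t
        using C D by (auto simp: u_def v_def norm_divide)
      then show ?thesis
        unfolding modular_def by (simp only: ) (subst nn_integral_add; measurable?; simp add: nn_integral_cmult)
    qed
    also have "\<dots> \<le> ennreal k * 1 + ennreal k * 1"
      using C D r by (intro add_mono mult_left_mono) auto
    also have "\<dots> = 1" unfolding mult_1_right ennreal_plus[OF k k, symmetric] by (simp add: k_def)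
    finally show ?thesis .
  qed
  then show ?thesis
    unfolding hardy_orlicz_iff using E0 hf hg by (auto intro!: holomorphic_intros)
qed

section \<open>Consequences of the growth condition\<close>

lemma Delta0_growth:
  assumes "Delta0 \<Psi>"
  obtains \<beta> where "1 < \<beta>" "\<And>K. \<exists>x0>0. \<forall>x\<ge>x0. K * \<Psi> x \<le> \<Psi> (\<beta> * x)"
proof -
  from assms obtain \<beta> where \<beta>: "1 < \<beta>" "filterlim (\<lambda>x. \<Psi> (\<beta> * x) / \<Psi> x) at_top at_top"
    unfolding Delta0_def by blast
  show thesis
  proof (rule that[OF \<beta>(1)])
    fix K
    have "eventually (\<lambda>x. K \<le> \<Psi> (\<beta> * x) / \<Psi> x) at_top"
      using \<beta>(2) by (simp add: filterlim_at_top)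
    then obtain N where N: "\<And>x. x \<ge> N \<Longrightarrow> K \<le> \<Psi> (\<beta> * x) / \<Psi> x"
      by (auto simp: eventually_at_top_linorder)
    have "K * \<Psi> x \<le> \<Psi> (\<beta> * x)" if "x \<ge> max N 1" for x
      using N[of x] pos[of x] that by (simp add: pos_le_divide_eq)
    then show "\<exists>x0>0. \<forall>x\<ge>x0. K * \<Psi> x \<le> \<Psi> (\<beta> * x)" by (intro exI[of _ "max N 1"]) auto
  qed
qed

text \<open>Replacing x by \<beta> x multiplies x^2 by \<beta>^2 and, for x \<ge> x0, multiplies
  \<Psi> x by at least as much. So a bound for the quotient of x^2 and \<Psi> x between x0 and
  \<beta> x0 propagates to all larger x.\<close>

lemma Delta0_square_le:
  assumes "Delta0 \<Psi>"
  obtains A B where "0 \<le> A" "0 \<le> B" "\<And>x. 0 \<le> x \<Longrightarrow> x\<^sup>2 \<le> A + B * \<Psi> x"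
proof -
  obtain \<beta> where \<beta>: "1 < \<beta>" "\<And>K. \<exists>x0>0. \<forall>x\<ge>x0. K * \<Psi> x \<le> \<Psi> (\<beta> * x)"
    using Delta0_growth[OF assms] by blast
  from \<beta>(2)[of "\<beta>\<^sup>2"] obtain x0 where x0: "0 < x0" "\<And>x. x \<ge> x0 \<Longrightarrow> \<beta>\<^sup>2 * \<Psi> x \<le> \<Psi> (\<beta> * x)" by blast
  define D where "D = (\<beta> * x0)\<^sup>2 / \<Psi> x0"
  have D: "0 \<le> D" using pos[OF x0(1)] by (simp add: D_def)
  have *: "x\<^sup>2 \<le> D * \<Psi> x" if "x0 \<le> x" "x \<le> \<beta> ^ k * (\<beta> * x0)" for x k
    using that
  proof (induction k arbitrary: x)
    case 0
    have "x\<^sup>2 \<le> (\<beta> * x0)\<^sup>2" using 0 x0 by (intro power_mono) auto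
    also have "\<dots> = D * \<Psi> x0" using pos[OF x0(1)] by (simp add: D_def)
    also have "\<dots> \<le> D * \<Psi> x" using 0 x0 D by (intro mult_left_mono mono) auto
    finally show ?case .
  next
    case (Suc k)
    show ?case
    proof (cases "x \<le> \<beta> ^ k * (\<beta> * x0)")
      case True
      then show ?thesis using Suc by auto
    next
      case False
      have "1 \<le> \<beta> ^ k" using \<beta>(1) by simp
      then have "1 * (\<beta> * x0) \<le> \<beta> ^ k * (\<beta> * x0)" using \<beta>(1) x0 by (intro mult_right_mono) auto
      with False have "\<beta> * x0 \<le> x" by linarith
      then have "x0 \<le> x / \<beta>" using \<beta>(1) by (simp add: field_simps)
      moreover have "x / \<beta> \<le> \<beta> ^ k * (\<beta> * x0)" using Suc.prems \<beta>(1) by (simp add: field_simps)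
      ultimately have "(x / \<beta>)\<^sup>2 \<le> D * \<Psi> (x / \<beta>)" by (rule Suc.IH)
      then have "x\<^sup>2 \<le> D * (\<beta>\<^sup>2 * \<Psi> (x / \<beta>))" using \<beta>(1) by (simp add: field_simps)
      also have "\<dots> \<le> D * \<Psi> (\<beta> * (x / \<beta>))" by (intro mult_left_mono x0(2) D) fact
      finally show ?thesis using \<beta>(1) by simp
    qed
  qed
  show thesis
  proof (rule that[of "x0\<^sup>2" D])
    fix x :: real assume x: "0 \<le> x"
    show "x\<^sup>2 \<le> x0\<^sup>2 + D * \<Psi> x"
    proof (cases "x0 \<le> x")
      case True
      obtain k where "x / (\<beta> * x0) < \<beta> ^ k" using real_arch_pow[OF \<beta>(1)] by blast
      then have "x \<le> \<beta> ^ k * (\<beta> * x0)" using \<beta>(1) x0(1) by (simp add: field_simps)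
      with *[OF True this] show ?thesis using zero_le_power2[of x0] by linarith
    next
      case False
      then have "x\<^sup>2 \<le> x0\<^sup>2" using x by (intro power_mono) auto
      moreover have "0 \<le> D * \<Psi> x" using D nonneg[OF x] by simp
      ultimately show ?thesis by linarith
    qed
  qed (use D in auto)
qed

text \<open>While x is moderate, adding it to a number a \<le> b costs a linear term. When x is
  large it dominates a, so (a + x) / M \<le> x / \<beta>, and \<Psi> (x / \<beta>) is a small
  multiple of \<Psi> x. It is essential that \<open>M\<close> is chosen before \<open>b\<close> and
  \<epsilon>: the same \<open>M\<close> serves for all partial sums.\<close>

lemma Delta0_perturb:
  assumes "Delta0 \<Psi>"
  obtains M where "0 < M"
    "\<And>b \<epsilon>. 0 < \<epsilon> \<Longrightarrow> \<exists>K\<ge>0. \<forall>a x. 0 \<le> a \<longrightarrow> a \<le> b \<longrightarrow> 0 \<le> x \<longrightarrow>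
       \<Psi> ((a + x) / M) \<le> \<Psi> (a / M) + K * x + \<epsilon> * \<Psi> x"
proof -
  obtain \<beta> where \<beta>: "1 < \<beta>" "\<And>K. \<exists>x0>0. \<forall>x\<ge>x0. K * \<Psi> x \<le> \<Psi> (\<beta> * x)"
    using Delta0_growth[OF assms] by blast
  define M where "M = 2 * \<beta>"
  have M: "0 < M" using \<beta> by (simp add: M_def)
  show thesis
  proof (rule that[OF M])
    fix b \<epsilon> :: real assume \<epsilon>: "0 < \<epsilon>"
    obtain x0 where x0: "0 < x0" "\<And>x. x \<ge> x0 \<Longrightarrow> (1 / \<epsilon>) * \<Psi> x \<le> \<Psi> (\<beta> * x)" using \<beta>(2)[of "1 / \<epsilon>"] by blast
    \<comment> \<open>Beyond this threshold x exceeds a, and x / \<beta> is at least x0.\<close>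
    define \<tau> where "\<tau> = max b (\<beta> * x0)"
    \<comment> \<open>The slope at the largest argument that occurs when both a and x are at most
      \<tau>.\<close>
    define K where "K = slope (2 * \<tau> / M) / M"
    have K: "0 \<le> K" using slope_nonneg M by (simp add: K_def)
    have "\<Psi> ((a + x) / M) \<le> \<Psi> (a / M) + K * x + \<epsilon> * \<Psi> x" if a: "0 \<le> a" "a \<le> b" and x: "0 \<le> x" for a x
    proof (cases "x \<le> \<tau>")
      case True
      have "a \<le> \<tau>" using a by (simp add: \<tau>_def)
      have "\<Psi> ((a + x) / M) \<le> \<Psi> (a / M) + slope ((a + x) / M) * (x / M)"
        using slope_le[of "(a + x) / M" "a / M"] a x M by (simp add: field_simps)
      also have "slope ((a + x) / M) * (x / M) \<le> slope (2 * \<tau> / M) * (x / M)"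
        using True \<open>a \<le> \<tau>\<close> M x by (intro mult_right_mono slope_mono divide_right_mono) auto
      also have "\<dots> = K * x" by (simp add: K_def)
      finally show ?thesis using nonneg[OF x] \<epsilon> mult_nonneg_nonneg[of \<epsilon> "\<Psi> x"] by linarith
    next
      case False
      then have "a \<le> x" "\<beta> * x0 \<le> x" using a by (auto simp: \<tau>_def)
      have "(a + x) / M \<le> x / \<beta>" using \<open>a \<le> x\<close> \<beta>(1) by (simp add: M_def field_simps)
      then have "\<Psi> ((a + x) / M) \<le> \<Psi> (x / \<beta>)" using a x M by (intro mono) auto
      also have "\<dots> \<le> \<epsilon> * \<Psi> x"
        using x0(2)[of "x / \<beta>"] \<open>\<beta> * x0 \<le> x\<close> \<beta>(1) \<epsilon> by (simp add: field_simps)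
      finally show ?thesis using nonneg[of "a / M"] mult_nonneg_nonneg[OF K x] a M by simp
    qed
    with K show "\<exists>K\<ge>0. \<forall>a x. 0 \<le> a \<longrightarrow> a \<le> b \<longrightarrow> 0 \<le> x \<longrightarrow>
       \<Psi> ((a + x) / M) \<le> \<Psi> (a / M) + K * x + \<epsilon> * \<Psi> x" by blast
  qed
qed

subsection \<open>Boundary values of functions in the Hardy--Orlicz space\<close>

lemma hardy_orlicz_subset_hardy2:
  assumes "Delta0 \<Psi>" and h: "h \<in> hardy_orlicz \<Psi>"
  shows "h \<in> hardy2"
proof -
  obtain A B where AB: "0 \<le> A" "0 \<le> B" "\<And>x. 0 \<le> x \<Longrightarrow> x\<^sup>2 \<le> A + B * \<Psi> x"
    using Delta0_square_le[OF assms(1)] by blast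
  obtain C where C: "0 < C" "\<And>r. 0 \<le> r \<Longrightarrow> r < 1 \<Longrightarrow> modular (\<lambda>t. h (of_real r * cis t) / of_real C) \<le> 1"
    and hol: "h holomorphic_on ball 0 1" using h unfolding hardy_orlicz_iff by auto
  have "circle_energy h r \<le> C\<^sup>2 * (A + B)" if r: "0 < r" "r < 1" for r
  proof -
    let ?v = "\<lambda>t. cmod (h (of_real r * cis t) / of_real C)"
    have b: "bounded_borel (circle_restr h r)" using r by (intro bounded_borel_holomorphic hol) auto
    have [measurable]: "circle_restr h r \<in> borel_measurable borel" by (rule bounded_borel_measurable[OF b])
    have "ennreal (circle_energy h r) = (\<integral>\<^sup>+ t. ennreal ((cmod (h (of_real r * cis t)))\<^sup>2) \<partial>circ)"
      unfolding circle_energy_def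
      by (intro nn_integral_eq_integral[symmetric] bounded_borel_integrable bounded_borel_power2 bounded_borel_norm b) auto
    also have "\<dots> \<le> (\<integral>\<^sup>+ t. ennreal (C\<^sup>2 * A) + ennreal (C\<^sup>2 * B) * ennreal (\<Psi> (?v t)) \<partial>circ)"
    proof (rule nn_integral_mono)
      fix t
      have "(cmod (h (of_real r * cis t)))\<^sup>2 = C\<^sup>2 * (?v t)\<^sup>2"
        using C(1) by (simp add: norm_divide power_divide)
      also have "\<dots> \<le> C\<^sup>2 * (A + B * \<Psi> (?v t))"
        by (intro mult_left_mono AB) auto
      finally have "(cmod (h (of_real r * cis t)))\<^sup>2 \<le> C\<^sup>2 * A + (C\<^sup>2 * B) * \<Psi> (?v t)"
        by (simp add: algebra_simps)
      then show "ennreal ((cmod (h (of_real r * cis t)))\<^sup>2) \<le> ennreal (C\<^sup>2 * A) + ennreal (C\<^sup>2 * B) * ennreal (\<Psi> (?v t))"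
        using AB nonneg[of "?v t"] by (simp flip: ennreal_plus ennreal_mult)
    qed
    also have "\<dots> = ennreal (C\<^sup>2 * A) + ennreal (C\<^sup>2 * B) * modular (\<lambda>t. h (of_real r * cis t) / of_real C)"
      unfolding modular_def by (subst nn_integral_add) (auto simp: nn_integral_cmult)
    also have "\<dots> \<le> ennreal (C\<^sup>2 * A) + ennreal (C\<^sup>2 * B) * 1"
      using C r by (intro add_left_mono mult_left_mono) auto
    also have "\<dots> = ennreal (C\<^sup>2 * (A + B))"
      using AB by (simp add: distrib_left flip: ennreal_plus)
    finally show ?thesis using AB by (subst (asm) ennreal_le_iff) auto
  qed
  then show ?thesis using hol by (auto simp: hardy2_def)
qed

lemma modular_radial_lim_le:
  assumes h: "h \<in> hardy2" and C: "0 < C" and le: "\<And>r. 0 < r \<Longrightarrow> r < 1 \<Longrightarrow> modular (\<lambda>t. h (of_real r * cis t) / of_real C) \<le> 1"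
  shows "modular (\<lambda>t. radial_lim h t / of_real C) \<le> 1"
proof -
  have "continuous_on UNIV (\<lambda>z::complex. \<Psi> \<bar>cmod (z / of_real C)\<bar>)"
    using C by (intro continuous_on_compose2[OF continuous_abs] continuous_intros) auto
  then have G: "continuous_on UNIV (\<lambda>z::complex. \<Psi> (cmod (z / of_real C)))" by simp
  have "modular (\<lambda>t. radial_lim h t / of_real C) \<le> liminf (\<lambda>_. 1)"
    unfolding modular_def
    by (rule radial_lim_Fatou[OF h G]) (use le radial_seq in \<open>simp add: modular_def\<close>)
  then show ?thesis by (simp add: Liminf_const)
qed

lemma ho_norm_le:
  assumes h: "h \<in> hardy2" and C: "0 < C" and le: "\<And>r. 0 < r \<Longrightarrow> r < 1 \<Longrightarrow> modular (\<lambda>t. h (of_real r * cis t) / of_real C) \<le> 1"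
  shows "ho_norm \<Psi> h \<le> C"
  unfolding ho_norm_def
proof (rule luxemburg_le)
  show "radial_lim h \<in> borel_measurable borel" using h by (intro radial_lim_measurable) (simp add: hardy2_def)
  show "AE t in circ. boundary_fn h t = radial_lim h t" using radial_lim[OF h] by eventually_elim simp
qed (use modular_radial_lim_le[OF assms] C in auto)

text \<open>A lower bound for an \<open>Inf\<close> requires an admissible constant; the one for
  interior circles passes to the boundary by Fatou's lemma.\<close>

lemma le_ho_normI:
  assumes D: "Delta0 \<Psi>" and h: "h \<in> hardy_orlicz \<Psi>"
    and le: "\<And>C. 0 < C \<Longrightarrow> modular (\<lambda>t. radial_lim h t / of_real C) \<le> 1 \<Longrightarrow> x \<le> C"
  shows "x \<le> ho_norm \<Psi> h"
proof -
  have h2: "h \<in> hardy2" by (rule hardy_orlicz_subset_hardy2[OF D h])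
  have m: "radial_lim h \<in> borel_measurable borel" using h2 by (intro radial_lim_measurable) (simp add: hardy2_def)
  have ae: "AE t in circ. boundary_fn h t = radial_lim h t" using radial_lim[OF h2] by eventually_elim simp
  obtain C where C: "0 < C" "\<And>r. 0 \<le> r \<Longrightarrow> r < 1 \<Longrightarrow> modular (\<lambda>t. h (of_real r * cis t) / of_real C) \<le> 1"
    using h unfolding hardy_orlicz_iff by auto
  then have "modular (\<lambda>t. radial_lim h t / of_real C) \<le> 1"
    by (intro modular_radial_lim_le h2) auto
  with C(1) have ne: "{C. 0 < C \<and> modular (\<lambda>t. radial_lim h t / of_real C) \<le> 1} \<noteq> {}" by blast
  show ?thesis
    unfolding ho_norm_def luxemburg_eq[OF m ae] by (rule cInf_greatest[OF ne]) (use le in auto)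
qed

text \<open>\<open>p\<close> is a weight and \<open>j\<close> majorises the conjugate function of
  \<Psi> along it, known only through Young's inequality. Domination by radial limits turns the left
  side into a double integral, Young's inequality is applied under it, and the kernel has mass 1 in
  either variable. Thus a mean over an interior circle is controlled by the boundary norm.\<close>

lemma weighted_mean_le:
  assumes h: "h \<in> hardy2" and q: "0 \<le> q" "q < 1"
    and p: "bounded_borel p" "\<And>t. 0 \<le> p t" and j: "bounded_borel j" "\<And>t. 0 \<le> j t"
    and young: "\<And>t y. 0 \<le> y \<Longrightarrow> p t * y \<le> \<Psi> y + j t"
    and C: "0 < C" "modular (\<lambda>t. radial_lim h t / of_real C) \<le> 1"
  shows "(\<integral>t. p t * cmod (h (of_real q * cis t)) \<partial>circ) \<le> C * (1 + (\<integral>t. j t \<partial>circ))"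
proof -
  have hol: "h holomorphic_on ball 0 1" using h by (simp add: hardy2_def)
  have [measurable]: "radial_lim h \<in> borel_measurable borel" by (rule radial_lim_measurable[OF hol])
  have [measurable]: "p \<in> borel_measurable borel" "j \<in> borel_measurable borel"
    using p j by (auto dest: bounded_borel_measurable)
  let ?y = "\<lambda>s. cmod (radial_lim h s / of_real C)"
  have P: "0 \<le> poisson q t s" for t s using poisson_pos[OF q, of t s] by simp
  have b: "bounded_borel (circle_restr h q)" by (intro bounded_borel_holomorphic hol q)
  have "ennreal (\<integral>t. p t * cmod (h (of_real q * cis t)) \<partial>circ) = (\<integral>\<^sup>+ t. ennreal (p t * cmod (h (of_real q * cis t))) \<partial>circ)"
    using p by (intro nn_integral_eq_integral[symmetric] bounded_borel_integrable bounded_borel_mult bounded_borel_norm b) auto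
  also have "\<dots> \<le> (\<integral>\<^sup>+ t. (\<integral>\<^sup>+ s. ennreal (p t) * ennreal (poisson q t s * cmod (radial_lim h s)) \<partial>circ) \<partial>circ)"
  proof (rule nn_integral_mono)
    fix t
    have "ennreal (p t * cmod (h (of_real q * cis t))) = ennreal (p t) * ennreal (cmod (h (of_real q * cis t)))"
      using p by (simp add: ennreal_mult)
    also have "\<dots> \<le> ennreal (p t) * (\<integral>\<^sup>+ s. ennreal (poisson q t s * cmod (radial_lim h s)) \<partial>circ)"
      by (intro mult_left_mono radial_lim_poisson h q) auto
    also have "\<dots> = (\<integral>\<^sup>+ s. ennreal (p t) * ennreal (poisson q t s * cmod (radial_lim h s)) \<partial>circ)"
      by (rule nn_integral_cmult[symmetric]) measurable
    finally show "ennreal (p t * cmod (h (of_real q * cis t))) \<le> \<dots>" .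
  qed
  also have "\<dots> \<le> (\<integral>\<^sup>+ t. (\<integral>\<^sup>+ s. ennreal C * (ennreal (poisson q t s) * ennreal (\<Psi> (?y s)) + ennreal (poisson q t s) * ennreal (j t)) \<partial>circ) \<partial>circ)"
  proof (intro nn_integral_mono)
    fix t s
    have "p t * (poisson q t s * cmod (radial_lim h s)) = C * (poisson q t s * (p t * ?y s))"
      using C by (simp add: norm_divide)
    also have "\<dots> \<le> C * (poisson q t s * (\<Psi> (?y s) + j t))"
      using C P by (intro mult_left_mono young) auto
    finally have "p t * (poisson q t s * cmod (radial_lim h s)) \<le> C * (poisson q t s * \<Psi> (?y s) + poisson q t s * j t)"
      by (simp add: distrib_left)
    then show "ennreal (p t) * ennreal (poisson q t s * cmod (radial_lim h s))
      \<le> ennreal C * (ennreal (poisson q t s) * ennreal (\<Psi> (?y s)) + ennreal (poisson q t s) * ennreal (j t))"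
      using p j P nonneg[of "?y s"] C by (simp flip: ennreal_plus ennreal_mult)
  qed
  also have "\<dots> = ennreal C * ((\<integral>\<^sup>+ t. (\<integral>\<^sup>+ s. ennreal (poisson q t s) * ennreal (\<Psi> (?y s)) \<partial>circ) \<partial>circ)
      + (\<integral>\<^sup>+ t. (\<integral>\<^sup>+ s. ennreal (poisson q t s) * ennreal (j t) \<partial>circ) \<partial>circ))"
    by (simp add: nn_integral_cmult nn_integral_add)
  also have "(\<integral>\<^sup>+ t. (\<integral>\<^sup>+ s. ennreal (poisson q t s) * ennreal (\<Psi> (?y s)) \<partial>circ) \<partial>circ)
      = (\<integral>\<^sup>+ s. (\<integral>\<^sup>+ t. ennreal (poisson q t s) * ennreal (\<Psi> (?y s)) \<partial>circ) \<partial>circ)"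
    by (rule circ2.Fubini') measurable
  also have "\<dots> = modular (\<lambda>t. radial_lim h t / of_real C)"
    unfolding modular_def by (simp add: nn_integral_multc nn_integral_poisson_one[OF q])
  also have "(\<integral>\<^sup>+ t. (\<integral>\<^sup>+ s. ennreal (poisson q t s) * ennreal (j t) \<partial>circ) \<partial>circ) = ennreal (\<integral>t. j t \<partial>circ)"
    using j by (simp add: nn_integral_multc nn_integral_poisson_one[OF q] nn_integral_eq_integral bounded_borel_integrable)
  also have "ennreal C * (modular (\<lambda>t. radial_lim h t / of_real C) + ennreal (\<integral>t. j t \<partial>circ)) \<le> ennreal C * (1 + ennreal (\<integral>t. j t \<partial>circ))"
    by (intro mult_left_mono add_right_mono C) auto
  also have "\<dots> = ennreal (C * (1 + (\<integral>t. j t \<partial>circ)))"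
    using C j by (simp add: ennreal_mult integral_nonneg flip: ennreal_1 ennreal_plus)
  finally show ?thesis
    using C j by (subst (asm) ennreal_le_iff) (auto intro!: mult_nonneg_nonneg add_nonneg_nonneg integral_nonneg)
qed

lemma bounded_borel_Psi:
  assumes g: "bounded_borel g" "\<And>t. 0 \<le> g t"
  shows "bounded_borel (\<lambda>t. \<Psi> (g t))"
proof -
  obtain B where B': "\<And>t. norm (g t) \<le> B" "g \<in> borel_measurable borel" using g(1) by (meson bounded_borelE)
  have B: "g t \<le> B" for t using B'(1)[of t] by simp
  have "(\<lambda>t. \<Psi> \<bar>g t\<bar>) \<in> borel_measurable borel" by (rule measurable_compose[OF B'(2) abs_measurable])
  then show ?thesis
    using g(2) mono[OF g(2) B] nonneg[OF g(2)] by (intro bounded_borelI[of _ "\<Psi> B"]) auto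
qed

text \<open>Duality made explicit: the weight is the normalised subgradient of \<open>\<Psi>\<close> along \<open>v\<close>, restricted
  to the set where \<open>v\<close> is large, so that its mean is small.\<close>

lemma norming_weight:
  assumes v: "bounded_borel v" "\<And>t. 0 \<le> v t" "\<And>t. v t \<le> V" and \<delta>: "0 < \<delta>"
    and big: "1 < (\<integral>t. \<Psi> (v t / \<delta>) \<partial>circ)"
    and small: "\<Psi> (1 / \<delta>) * (\<integral>t. v t \<partial>circ) \<le> 1 / 2"
    and y: "0 < y" "\<Psi> y * (\<integral>t. v t \<partial>circ) \<le> 1"
  obtains w where "bounded_borel w" "\<And>t. 0 \<le> w t" "\<And>t. w t \<le> slope (2 * V / \<delta>)"
    "\<delta> / 2 \<le> (\<integral>t. v t * w t \<partial>circ)" "y * (\<integral>t. w t \<partial>circ) \<le> 1"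
    "\<And>h q C. h \<in> hardy2 \<Longrightarrow> 0 \<le> q \<Longrightarrow> q < 1 \<Longrightarrow> 0 < C \<Longrightarrow> modular (\<lambda>t. radial_lim h t / of_real C) \<le> 1 \<Longrightarrow>
       (\<integral>t. w t * cmod (h (of_real q * cis t)) \<partial>circ) \<le> C"
proof -
  have [measurable]: "v \<in> borel_measurable borel" using v by (auto dest: bounded_borel_measurable)
  have V: "0 \<le> V" using v(2)[of 0] v(3)[of 0] by linarith
  define E where "E = {t. 1 < v t}"
  have [measurable]: "E \<in> sets borel" by (simp add: E_def)
  \<comment> \<open>The factor 2 pays for the restriction to \<open>E\<close>: there convexity gives
    \<Psi> (v / \<delta>) \<le> \<Psi> x / 2, and the part off \<open>E\<close> has integral at most
    1/2 by \<open>small\<close>.\<close>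
  define x where "x t = 2 * v t / \<delta> * indicator E t" for t
  define p where "p t = slope (x t) * indicator E t" for t
  \<comment> \<open>The conjugate function of \<Psi> at \<open>p\<close>, through equality in
    Young's inequality at \<open>x\<close>.\<close>
  define j where "j t = p t * x t - \<Psi> (x t)" for t
  define J where "J = (\<integral>t. j t \<partial>circ)"
  have x0: "0 \<le> x t" for t using v \<delta> by (simp add: x_def)
  have xle: "x t \<le> 2 * V / \<delta>" for t using v \<delta> V by (auto simp: x_def indicator_def divide_right_mono)
  have p0: "0 \<le> p t" "p t \<le> slope (2 * V / \<delta>)" for t
    using slope_nonneg slope_mono[OF xle[of t]] by (auto simp: p_def indicator_def)
  have [measurable]: "x \<in> borel_measurable borel" unfolding x_def by measurable
  have bx: "bounded_borel x" by (rule bounded_borelI[of _ "2 * V / \<delta>"]) (use x0 xle in auto)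
  have [measurable]: "p \<in> borel_measurable borel" unfolding p_def by measurable
  have bp: "bounded_borel p" by (rule bounded_borelI[of _ "slope (2 * V / \<delta>)"]) (use p0 in auto)
  have bj: "bounded_borel j" unfolding j_def by (intro bounded_borel_intros bp bx bounded_borel_Psi x0)
  have young: "p t * z \<le> \<Psi> z + j t" if "0 \<le> z" for t z
  proof (cases "t \<in> E")
    case True
    then show ?thesis using slope_le[OF x0 that, of t] by (simp add: p_def j_def algebra_simps)
  next
    case False
    then show ?thesis using nonneg[OF that] by (simp add: p_def j_def x_def)
  qed
  have j0: "0 \<le> j t" for t using young[OF order_refl, of t] by simp
  have J: "0 \<le> J" unfolding J_def using j0 by (simp add: integral_nonneg)
  have bvd: "bounded_borel (\<lambda>t. v t / \<delta>)" using bounded_borel_mult[OF bounded_borel_const[of "1 / \<delta>"] v(1)] by simp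
  have x1: "1 \<le> (\<integral>t. \<Psi> (x t) \<partial>circ)"
  proof -
    have "\<Psi> (v t / \<delta>) \<le> \<Psi> (1 / \<delta>) * v t + 1 / 2 * \<Psi> (x t)" for t
    proof (cases "t \<in> E")
      case True
      then have "v t / \<delta> = 1 / 2 * x t" by (simp add: x_def)
      then have "\<Psi> (v t / \<delta>) \<le> 1 / 2 * \<Psi> (x t)" using scale_le[of "1/2" "x t"] x0 by (simp only:)
      then show ?thesis using mult_nonneg_nonneg[OF nonneg[of "1 / \<delta>"] v(2)[of t]] \<delta> by simp
    next
      case False
      then have "v t \<le> 1" by (simp add: E_def)
      then have "\<Psi> (v t * (1 / \<delta>)) \<le> v t * \<Psi> (1 / \<delta>)" using v \<delta> by (intro scale_le) auto
      then show ?thesis using nonneg[OF x0, of t] by (simp add: mult.commute)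
    qed
    then have "(\<integral>t. \<Psi> (v t / \<delta>) \<partial>circ) \<le> (\<integral>t. \<Psi> (1 / \<delta>) * v t + 1 / 2 * \<Psi> (x t) \<partial>circ)"
      using v \<delta> by (intro integral_mono bounded_borel_integrable bounded_borel_intros bounded_borel_Psi bvd bx x0) auto
    also have "\<dots> = \<Psi> (1 / \<delta>) * (\<integral>t. v t \<partial>circ) + 1 / 2 * (\<integral>t. \<Psi> (x t) \<partial>circ)"
      using bounded_borel_integrable[OF v(1)] bounded_borel_integrable[OF bounded_borel_Psi[OF bx x0]]
      by (subst Bochner_Integration.integral_add) auto
    finally show ?thesis using small big by linarith
  qed
  \<comment> \<open>\<open>weighted_mean_le\<close> bounds means with weight \<open>p\<close> by C
    (1 + J), so after this normalisation the functional has norm at most 1.\<close>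
  define w where "w t = p t / (1 + J)" for t
  have w: "w t = 1 / (1 + J) * p t" for t by (simp add: w_def)
  have bw: "bounded_borel w" unfolding w by (intro bounded_borel_intros bp)
  have ip: "(\<integral>t. w t * g t \<partial>circ) = (\<integral>t. p t * g t \<partial>circ) / (1 + J)" if "bounded_borel g" for g
    unfolding w mult.assoc by (subst integral_mult_right_zero) simp
  show thesis
  proof (rule that[OF bw])
    show "0 \<le> w t" for t using p0[of t] J by (simp add: w_def)
    show "w t \<le> slope (2 * V / \<delta>)" for t
    proof -
      have "w t \<le> p t" using p0[of t] J mult_left_mono[of 1 "1 + J" "p t"] by (simp add: w_def pos_divide_le_eq add_pos_nonneg)
      also note p0(2)
      finally show ?thesis .
    qed
    \<comment> \<open>The integrand is p x, and x = 2 v / \<delta> on \<open>E\<close>: a mean of at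
      least 1 + J for p x becomes \<delta> / 2 for v w.\<close>
    have "1 + J \<le> (\<integral>t. j t + \<Psi> (x t) \<partial>circ)"
      using x1 bounded_borel_integrable[OF bj] bounded_borel_integrable[OF bounded_borel_Psi[OF bx x0]]
      by (subst Bochner_Integration.integral_add) (auto simp: J_def)
    also have "(\<lambda>t. j t + \<Psi> (x t)) = (\<lambda>t. 2 / \<delta> * (p t * v t))"
      by (auto simp: j_def x_def p_def indicator_def)
    also have "(\<integral>t. 2 / \<delta> * (p t * v t) \<partial>circ) = 2 / \<delta> * (\<integral>t. p t * v t \<partial>circ)" by (rule integral_mult_right_zero)
    also have "(\<integral>t. p t * v t \<partial>circ) = (1 + J) * (\<integral>t. v t * w t \<partial>circ)"
      using ip[OF v(1)] J by (simp add: mult.commute)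
    finally have "(1 + J) * 1 \<le> (1 + J) * (2 / \<delta> * (\<integral>t. v t * w t \<partial>circ))" by (simp add: mult_ac)
    then have "1 \<le> 2 / \<delta> * (\<integral>t. v t * w t \<partial>circ)" using J by (subst (asm) mult_le_cancel_left_pos) auto
    then show "\<delta> / 2 \<le> (\<integral>t. v t * w t \<partial>circ)" using \<delta> by (simp add: field_simps)
    \<comment> \<open>Young's inequality at the constant y. Since v > 1 on \<open>E\<close>, the
      term \<Psi> y is absorbed into \<Psi> y * v, whose mean is at most 1.\<close>
    have "y * (\<integral>t. p t \<partial>circ) = (\<integral>t. y * p t \<partial>circ)" by simp
    also have "\<dots> \<le> (\<integral>t. \<Psi> y * v t + j t \<partial>circ)"
    proof (intro integral_mono bounded_borel_integrable bounded_borel_intros bp bj v)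
      fix t
      show "y * p t \<le> \<Psi> y * v t + j t"
      proof (cases "t \<in> E")
        case True
        then have "\<Psi> y * 1 \<le> \<Psi> y * v t" using pos[OF y(1)] by (intro mult_left_mono) (auto simp: E_def)
        then show ?thesis using young[of y t] y by (simp add: mult.commute)
      next
        case False
        then show ?thesis using j0[of t] v(2)[of t] pos[OF y(1)] by (simp add: p_def)
      qed
    qed
    also have "\<dots> = \<Psi> y * (\<integral>t. v t \<partial>circ) + J"
      using bounded_borel_integrable[OF bj] bounded_borel_integrable[OF v(1)]
      by (subst Bochner_Integration.integral_add) (auto simp: J_def)
    also have "\<dots> \<le> 1 + J" using y by simp
    finally have "y * (\<integral>t. p t \<partial>circ) \<le> 1 + J" .
    moreover have "(\<integral>t. w t \<partial>circ) = (\<integral>t. p t \<partial>circ) / (1 + J)" using ip[of "\<lambda>_. 1"] by simp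
    ultimately show "y * (\<integral>t. w t \<partial>circ) \<le> 1" using J by (simp add: pos_divide_le_eq add_pos_nonneg)
    fix h and q C :: real assume h: "h \<in> hardy2" and q: "0 \<le> q" "q < 1" and C: "0 < C" "modular (\<lambda>t. radial_lim h t / of_real C) \<le> 1"
    have "bounded_borel (\<lambda>t. cmod (h (of_real q * cis t)))"
      using h q by (intro bounded_borel_norm bounded_borel_holomorphic) (auto simp: hardy2_def)
    then show "(\<integral>t. w t * cmod (h (of_real q * cis t)) \<partial>circ) \<le> C"
      using weighted_mean_le[OF h q bp p0(1) bj j0 young C] J
      by (simp add: ip J_def[symmetric] pos_divide_le_eq add_pos_nonneg)
  qed
qed

end

subsection \<open>The test functions\<close>

context
  fixes a :: complex and r :: real
  assumes a: "cmod a = 1" and r: "0 \<le> r" "r < 1"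
begin

lemma u_fn_arg: "cmod (cnj a * of_real r * z) = r * cmod z"
  using a r by (simp add: norm_mult)

lemma u_fn_denom:
  assumes "cmod z < 1"
  shows "1 - r \<le> cmod (1 - cnj a * of_real r * z)"
proof -
  have "r * cmod z \<le> r * 1" using assms r by (intro mult_left_mono) auto
  then show ?thesis
    using norm_triangle_ineq2[of 1 "cnj a * of_real r * z"] u_fn_arg[of z] by simp
qed

lemma u_fn_denom_nonzero: "cmod z < 1 \<Longrightarrow> 1 - cnj a * of_real r * z \<noteq> 0"
  using u_fn_denom[of z] r by auto

lemma u_fn_holomorphic: "u_fn a r holomorphic_on ball 0 1"
  unfolding u_fn_def[abs_def] using u_fn_denom_nonzero by (intro holomorphic_intros) auto

lemma norm_u_fn: "cmod (u_fn a r z) = (1 - r)\<^sup>2 / (cmod (1 - cnj a * of_real r * z))\<^sup>2"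
proof -
  have "cmod (1 - complex_of_real r) = 1 - r" using r norm_of_real[of "1 - r", where 'a=complex] by simp
  then show ?thesis by (simp add: u_fn_def norm_power norm_divide power_divide)
qed

lemma norm_u_fn_le_1:
  assumes "cmod z < 1" shows "cmod (u_fn a r z) \<le> 1"
proof -
  have "(1 - r)\<^sup>2 \<le> (cmod (1 - cnj a * of_real r * z))\<^sup>2" using u_fn_denom[OF assms] r by (intro power_mono) auto
  then show ?thesis using r u_fn_denom_nonzero[OF assms] by (simp add: norm_u_fn divide_le_eq_1)
qed

text \<open>On the circle \<open>|u_{a,r}|\<close> is a multiple of a Poisson kernel, hence dominated on the whole disc by
  the real part of a holomorphic function; subordination then only needs the mean value property.\<close>

lemma integral_u_fn_le:
  assumes \<phi>: "\<phi> holomorphic_on ball 0 1" "\<phi> ` ball 0 1 \<subseteq> ball 0 1" and q: "0 \<le> q" "q < 1"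
  shows "(\<integral>t. cmod (u_fn a r (\<phi> (of_real q * cis t))) \<partial>circ) \<le> (1 - r) * ((1 + cmod (\<phi> 0)) / (1 - cmod (\<phi> 0)))"
proof -
  define \<zeta> where "\<zeta> z = cnj a * of_real r * \<phi> z" for z
  define H where "H z = (1 + \<zeta> z) / (1 - \<zeta> z)" for z
  have \<phi>1: "cmod (\<phi> z) < 1" if "z \<in> ball 0 1" for z using \<phi>(2) that by (force simp: image_subset_iff)
  have ne: "1 - \<zeta> z \<noteq> 0" if "z \<in> ball 0 1" for z unfolding \<zeta>_def by (rule u_fn_denom_nonzero[OF \<phi>1[OF that]])
  have H: "H holomorphic_on ball 0 1"
    unfolding H_def using ne unfolding \<zeta>_def by (intro holomorphic_intros \<phi>) auto
  have zq: "of_real q * cis t \<in> ball 0 1" for t using q by (simp add: norm_mult)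
  have le: "cmod (u_fn a r (\<phi> z)) \<le> (1 - r) * Re (H z)" if z: "z \<in> ball 0 1" for z
  proof -
    let ?d = "(cmod (1 - \<zeta> z))\<^sup>2"
    have d: "0 < ?d" using ne[OF z] by simp
    have "r * cmod (\<phi> z) \<le> r * 1" using \<phi>1[OF z] r by (intro mult_left_mono) auto
    then have "cmod (\<zeta> z) \<le> r" unfolding \<zeta>_def u_fn_arg by simp
    then have "(cmod (\<zeta> z))\<^sup>2 \<le> r\<^sup>2" by (intro power_mono) auto
    moreover have "r\<^sup>2 \<le> r" using r by (simp add: power2_eq_square mult_left_le)
    ultimately have "1 - r \<le> 1 - (cmod (\<zeta> z))\<^sup>2" by linarith
    then have "(1 - r) * ((1 - r) / ?d) \<le> (1 - r) * ((1 - (cmod (\<zeta> z))\<^sup>2) / ?d)"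
      using r by (intro mult_left_mono divide_right_mono) auto
    also have "(1 - (cmod (\<zeta> z))\<^sup>2) / ?d = Re (H z)"
      unfolding H_def Re_divide cmod_power2 by (simp add: power2_eq_square algebra_simps)
    finally show ?thesis by (simp add: norm_u_fn \<zeta>_def power2_eq_square)
  qed
  have b: "bounded_borel (\<lambda>t. H (of_real q * cis t))" by (intro bounded_borel_holomorphic H q)
  have iH: "integrable circ (\<lambda>t. H (of_real q * cis t))" by (rule bounded_borel_integrable[OF b])
  have mean: "(\<integral>t. H (of_real q * cis t) \<partial>circ) = H 0"
  proof (cases "q = 0")
    case True then show ?thesis by simp
  next
    case False
    \<comment> \<open>With kernel parameter 0 the Poisson formula on the circle of radius
      \<open>q\<close> is the mean value property.\<close>
    then show ?thesis using poisson_dilation[OF H, of q 0 0] q by (simp add: poisson_def)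
  qed
  have u: "u_fn a r \<circ> \<phi> holomorphic_on ball 0 1"
    by (rule holomorphic_on_compose_gen[OF \<phi>(1) u_fn_holomorphic \<phi>(2)])
  have "(\<integral>t. cmod (u_fn a r (\<phi> (of_real q * cis t))) \<partial>circ) \<le> (\<integral>t. (1 - r) * Re (H (of_real q * cis t)) \<partial>circ)"
  proof (rule integral_mono)
    show "integrable circ (\<lambda>t. cmod (u_fn a r (\<phi> (of_real q * cis t))))"
      using bounded_borel_holomorphic[OF u q] by (intro bounded_borel_integrable bounded_borel_norm) simp
    show "integrable circ (\<lambda>t. (1 - r) * Re (H (of_real q * cis t)))"
      by (intro integrable_mult_right integrable_Re iH)
  qed (use le zq in auto)
  also have "\<dots> = (1 - r) * Re (H 0)"
    using integral_Re[OF iH] mean by simp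
  also have "Re (H 0) \<le> (1 + cmod (\<phi> 0)) / (1 - cmod (\<phi> 0))"
  proof -
    have "cmod (\<zeta> 0) \<le> cmod (\<phi> 0)" unfolding \<zeta>_def u_fn_arg using r by (simp add: mult_left_le_one_le)
    have "Re (H 0) \<le> cmod (1 + \<zeta> 0) / cmod (1 - \<zeta> 0)"
      unfolding H_def norm_divide[symmetric] by (rule complex_Re_le_cmod)
    also have "\<dots> \<le> (1 + cmod (\<phi> 0)) / (1 - cmod (\<phi> 0))"
      using \<open>cmod (\<zeta> 0) \<le> cmod (\<phi> 0)\<close> \<phi>1[of 0] norm_triangle_ineq[of 1 "\<zeta> 0"] norm_triangle_ineq2[of 1 "\<zeta> 0"]
      by (intro frac_le) auto
    finally show ?thesis .
  qed
  finally show ?thesis using r by (simp add: mult_left_mono)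
qed

end

context orlicz
begin

text \<open>As |u| \<le> 1, convexity gives \<Psi> (c |u|) \<le> |u| \<Psi> c, and \<Psi> c = 1 / (1
  - r) is the reciprocal of the bound for the mean of |u|. This is where the scaling factor comes
  from.\<close>

lemma modular_test_function:
  assumes a: "cmod a = 1" and r: "0 \<le> r" "r < 1" and q: "0 \<le> q" "q < 1"
  defines "c \<equiv> orlicz_inv \<Psi> (1 / (1 - r))"
  shows "modular (\<lambda>t. of_real c * u_fn a r (of_real q * cis t)) \<le> 1"
proof -
  have c: "0 \<le> c" "\<Psi> c = 1 / (1 - r)" using inv[of "1 / (1 - r)"] r by (auto simp: c_def)
  have b: "bounded_borel (\<lambda>t. cmod (u_fn a r (of_real q * cis t)))"
    by (intro bounded_borel_norm bounded_borel_holomorphic u_fn_holomorphic a r q)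
  have "modular (\<lambda>t. of_real c * u_fn a r (of_real q * cis t)) \<le> (\<integral>\<^sup>+ t. ennreal (cmod (u_fn a r (of_real q * cis t)) * (1 / (1 - r))) \<partial>circ)"
    unfolding modular_def
  proof (intro nn_integral_mono ennreal_leI)
    fix t
    have "cmod (of_real q * cis t) < 1" using q by (simp add: norm_mult)
    then have "\<Psi> (cmod (u_fn a r (of_real q * cis t)) * c) \<le> cmod (u_fn a r (of_real q * cis t)) * \<Psi> c"
      using c by (intro scale_le norm_u_fn_le_1 a r) auto
    then show "\<Psi> (cmod (of_real c * u_fn a r (of_real q * cis t))) \<le> cmod (u_fn a r (of_real q * cis t)) * (1 / (1 - r))"
      using c by (simp add: norm_mult mult.commute)
  qed
  also have "\<dots> = ennreal (\<integral>t. cmod (u_fn a r (of_real q * cis t)) * (1 / (1 - r)) \<partial>circ)"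
    using r by (intro nn_integral_eq_integral bounded_borel_integrable bounded_borel_mult b bounded_borel_const) auto
  also have "\<dots> \<le> ennreal 1"
  proof (rule ennreal_leI)
    have "(\<integral>t. cmod (u_fn a r (of_real q * cis t)) \<partial>circ) \<le> 1 - r"
      using integral_u_fn_le[OF a r, of "\<lambda>z. z" q] q by simp
    then show "(\<integral>t. cmod (u_fn a r (of_real q * cis t)) * (1 / (1 - r)) \<partial>circ) \<le> 1"
      using r by (simp add: pos_divide_le_eq)
  qed
  finally show ?thesis by simp
qed

text \<open>\<open>s\<close> stands for a partial sum and \<open>f\<close> for the new block. The
  linear term is paid by the small mean of \<open>f\<close> and the other one by its modular,
  \<epsilon> each.\<close>

lemma modular_perturb:
  assumes M: "0 < M" and b: "0 \<le> b" and K: "0 \<le> K" "0 \<le> \<epsilon>"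
    and perturb: "\<And>a x. 0 \<le> a \<Longrightarrow> a \<le> b \<Longrightarrow> 0 \<le> x \<Longrightarrow> \<Psi> ((a + x) / M) \<le> \<Psi> (a / M) + K * x + \<epsilon> * \<Psi> x"
    and s: "s \<in> borel_measurable borel" "\<And>t. cmod (s t) \<le> b"
    and f: "bounded_borel f" "K * (\<integral>t. cmod (f t) \<partial>circ) \<le> \<epsilon>" "modular f \<le> 1"
  shows "modular (\<lambda>t. (s t + f t) / of_real M) \<le> modular (\<lambda>t. s t / of_real M) + ennreal (2 * \<epsilon>)"
proof -
  have [measurable]: "s \<in> borel_measurable borel" "f \<in> borel_measurable borel"
    using s f by (auto dest: bounded_borel_measurable)
  have "modular (\<lambda>t. (s t + f t) / of_real M) \<le>
    (\<integral>\<^sup>+ t. (ennreal (\<Psi> (cmod (s t / of_real M))) + ennreal K * ennreal (cmod (f t))) + ennreal \<epsilon> * ennreal (\<Psi> (cmod (f t))) \<partial>circ)"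
    unfolding modular_def
  proof (rule nn_integral_mono)
    fix t
    have "\<Psi> (cmod ((s t + f t) / of_real M)) \<le> \<Psi> ((cmod (s t) + cmod (f t)) / M)"
      using M by (intro mono) (auto simp: norm_divide intro!: divide_right_mono norm_triangle_ineq)
    also have "\<dots> \<le> \<Psi> (cmod (s t) / M) + K * cmod (f t) + \<epsilon> * \<Psi> (cmod (f t))"
      by (intro perturb s) auto
    also have "cmod (s t) / M = cmod (s t / of_real M)" using M by (simp add: norm_divide)
    finally show "ennreal (\<Psi> (cmod ((s t + f t) / of_real M))) \<le>
        (ennreal (\<Psi> (cmod (s t / of_real M))) + ennreal K * ennreal (cmod (f t))) + ennreal \<epsilon> * ennreal (\<Psi> (cmod (f t)))"
      using K nonneg by (simp flip: ennreal_plus ennreal_mult)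
  qed
  also have "\<dots> = (modular (\<lambda>t. s t / of_real M) + ennreal K * (\<integral>\<^sup>+ t. ennreal (cmod (f t)) \<partial>circ)) + ennreal \<epsilon> * modular f"
    unfolding modular_def by (simp add: nn_integral_add nn_integral_cmult)
  also have "(\<integral>\<^sup>+ t. ennreal (cmod (f t)) \<partial>circ) = ennreal (\<integral>t. cmod (f t) \<partial>circ)"
    by (intro nn_integral_eq_integral bounded_borel_integrable bounded_borel_norm f) auto
  also have "(modular (\<lambda>t. s t / of_real M) + ennreal K * ennreal (\<integral>t. cmod (f t) \<partial>circ)) + ennreal \<epsilon> * modular f
     \<le> (modular (\<lambda>t. s t / of_real M) + ennreal \<epsilon>) + ennreal \<epsilon> * 1"
    using f K by (intro add_mono mult_left_mono) (auto simp flip: ennreal_mult intro: ennreal_leI)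
  also have "\<dots> = modular (\<lambda>t. s t / of_real M) + ennreal (2 * \<epsilon>)"
    using K by (simp add: add.assoc flip: ennreal_plus)
  finally show ?thesis .
qed

subsection \<open>Almost disjoint blocks\<close>

text \<open>One step of a gliding hump. \<open>b\<close> and \<open>B\<close> come from the earlier
  functions and weights, \<open>b'\<close> and \<open>B'\<close> from the new ones. The functional
  is small on functions bounded by \<open>b\<close> because its weight has a small mean, and on
  later images because its weight is bounded while their L^1 means are small.\<close>

lemma building_block:
  assumes D: "Delta0 \<Psi>" and \<phi>: "\<phi> holomorphic_on ball 0 1" "\<phi> ` ball 0 1 \<subseteq> ball 0 1" and \<delta>: "0 < \<delta>"
    and large: "\<And>r0. 0 \<le> r0 \<Longrightarrow> r0 < 1 \<Longrightarrow> \<exists>a r \<rho>. cmod a = 1 \<and> r0 < r \<and> r < 1 \<and> 0 \<le> \<rho> \<and> \<rho> < 1 \<and>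
      1 < modular (\<lambda>t. of_real (orlicz_inv \<Psi> (1 / (1 - r))) * u_fn a r (\<phi> (of_real \<rho> * cis t)) / of_real \<delta>)"
    and M: "0 < M" and perturb: "\<And>b \<epsilon>. 0 < \<epsilon> \<Longrightarrow> \<exists>K\<ge>0. \<forall>a x. 0 \<le> a \<longrightarrow> a \<le> b \<longrightarrow> 0 \<le> x \<longrightarrow>
       \<Psi> ((a + x) / M) \<le> \<Psi> (a / M) + K * x + \<epsilon> * \<Psi> x"
    and b: "0 \<le> b" and B: "0 \<le> B" and \<eta>: "0 < \<eta>"
  obtains f :: "complex \<Rightarrow> complex" and G :: "(complex \<Rightarrow> complex) \<Rightarrow> complex" and b' B' :: real where
    "f holomorphic_on ball 0 1" "0 \<le> b'" "0 \<le> B'" "\<And>z. z \<in> ball 0 1 \<Longrightarrow> cmod (f z) \<le> b'"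
    "\<And>s q. s holomorphic_on ball 0 1 \<Longrightarrow> (\<And>z. z \<in> ball 0 1 \<Longrightarrow> cmod (s z) \<le> b) \<Longrightarrow> 0 \<le> q \<Longrightarrow> q < 1 \<Longrightarrow>
       modular (\<lambda>t. (s (of_real q * cis t) + f (of_real q * cis t)) / of_real M)
         \<le> modular (\<lambda>t. s (of_real q * cis t) / of_real M) + ennreal \<eta>"
    "\<And>h k \<alpha> \<beta>. h holomorphic_on ball 0 1 \<Longrightarrow> k holomorphic_on ball 0 1 \<Longrightarrow>
       G (\<lambda>z. \<alpha> * h z + \<beta> * k z) = \<alpha> * G h + \<beta> * G k"
    "\<And>h. h \<in> hardy_orlicz \<Psi> \<Longrightarrow> cmod (G h) \<le> ho_norm \<Psi> h"
    "\<delta> / 2 \<le> cmod (G (f \<circ> \<phi>))"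
    "\<And>h. h holomorphic_on ball 0 1 \<Longrightarrow> (\<And>z. z \<in> ball 0 1 \<Longrightarrow> cmod (h z) \<le> b) \<Longrightarrow> cmod (G h) \<le> \<eta>"
    "\<And>h m. h holomorphic_on ball 0 1 \<Longrightarrow> (\<And>q. 0 \<le> q \<Longrightarrow> q < 1 \<Longrightarrow> (\<integral>t. cmod (h (of_real q * cis t)) \<partial>circ) \<le> m) \<Longrightarrow>
       cmod (G h) \<le> B' * m"
    "\<And>q. 0 \<le> q \<Longrightarrow> q < 1 \<Longrightarrow> B * (\<integral>t. cmod ((f \<circ> \<phi>) (of_real q * cis t)) \<partial>circ) \<le> \<eta>"
proof -
  \<comment> \<open>Composition with \<phi> enlarges the bound for the means of test functions by
    this factor.\<close>
  define \<kappa> where "\<kappa> = (1 + cmod (\<phi> 0)) / (1 - cmod (\<phi> 0))"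
  have \<phi>1: "cmod (\<phi> z) < 1" if "z \<in> ball 0 1" for z using \<phi>(2) that by (force simp: image_subset_iff)
  have \<kappa>: "0 \<le> \<kappa>" unfolding \<kappa>_def using \<phi>1[of 0] by (intro divide_nonneg_nonneg) auto
  obtain K where K: "0 \<le> K" "\<And>a x. 0 \<le> a \<Longrightarrow> a \<le> b \<Longrightarrow> 0 \<le> x \<Longrightarrow>
       \<Psi> ((a + x) / M) \<le> \<Psi> (a / M) + K * x + (\<eta> / 2) * \<Psi> x"
    using perturb[of "\<eta> / 2" b] \<eta> by auto
  \<comment> \<open>The weight will have mean at most 1 / y, so functions bounded by b \<le> \<eta>
    y are sent to values of size at most \<eta>.\<close>
  define y where "y = b / \<eta> + 1"
  have y: "0 < y" "b \<le> \<eta> * y" using b \<eta> by (auto simp: y_def add_nonneg_pos distrib_left)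
  have P: "0 \<le> \<Psi> (1 / \<delta>)" "0 \<le> \<Psi> y" using \<delta> y by (auto intro!: nonneg)
  \<comment> \<open>Each summand after the 1 is a coefficient whose product with c (1 - r) has to be
    at most 1: for the perturbation estimate, for the image against \<open>B\<close>, and for the
    two smallness hypotheses of \<open>norming_weight\<close>. The 1 makes \<open>S\<close>
    positive.\<close>
  define S where "S = 1 + 2 * K / \<eta> + B * \<kappa> / \<eta> + 2 * \<Psi> (1 / \<delta>) * \<kappa> + \<Psi> y * \<kappa>"
  have terms: "0 \<le> 2 * K / \<eta>" "0 \<le> B * \<kappa> / \<eta>" "0 \<le> 2 * \<Psi> (1 / \<delta>) * \<kappa>" "0 \<le> \<Psi> y * \<kappa>"
    using K \<eta> B \<kappa> P by auto
  then have S: "0 < S" "2 * K / \<eta> \<le> S" "B * \<kappa> / \<eta> \<le> S" "2 * \<Psi> (1 / \<delta>) * \<kappa> \<le> S" "\<Psi> y * \<kappa> \<le> S"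
    unfolding S_def by linarith+
  have small: "x * \<nu> \<le> 1" if "0 \<le> x" "x \<le> S" "\<nu> \<le> 1 / S" for x \<nu>
  proof -
    have "x * \<nu> \<le> x * (1 / S)" using that by (intro mult_left_mono) auto
    also have "\<dots> \<le> 1" using that S(1) by simp
    finally show ?thesis .
  qed
  have "0 < 1 / S" using S by simp
  then obtain r0 where r0: "0 \<le> r0" "r0 < 1" "\<And>r. r0 < r \<Longrightarrow> r < 1 \<Longrightarrow> orlicz_inv \<Psi> (1 / (1 - r)) * (1 - r) \<le> 1 / S"
    using inv_sublinear by blast
  obtain a r \<rho> where a: "cmod a = 1" and r: "r0 < r" "r < 1" and \<rho>: "0 \<le> \<rho>" "\<rho> < 1"
    and big: "1 < modular (\<lambda>t. of_real (orlicz_inv \<Psi> (1 / (1 - r))) * u_fn a r (\<phi> (of_real \<rho> * cis t)) / of_real \<delta>)"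
    using large[OF r0(1,2)] by blast
  have r': "0 \<le> r" using r r0 by simp
  define c where "c = orlicz_inv \<Psi> (1 / (1 - r))"
  have c: "0 < c" "c * (1 - r) \<le> 1 / S" using inv_pos[of "1 / (1 - r)"] r0(3) r by (auto simp: c_def)
  have cr: "0 \<le> c * (1 - r)" using c r by simp
  define f where "f z = of_real c * u_fn a r z" for z
  have f: "f holomorphic_on ball 0 1"
    unfolding f_def by (intro holomorphic_intros u_fn_holomorphic a r' r)
  have f\<phi>: "f \<circ> \<phi> holomorphic_on ball 0 1"
    by (rule holomorphic_on_compose_gen[OF \<phi>(1) f \<phi>(2)])
  have fle: "cmod (f z) \<le> c" if "z \<in> ball 0 1" for z
    using norm_u_fn_le_1[OF a r' r(2), of z] that c by (simp add: f_def norm_mult mult_left_le)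
  have fint: "(\<integral>t. cmod (f (of_real q * cis t)) \<partial>circ) \<le> c * (1 - r)" if "0 \<le> q" "q < 1" for q
    using integral_u_fn_le[OF a r' r(2), of "\<lambda>z. z" q] that c by (simp add: f_def norm_mult)
  have \<phi>int: "(\<integral>t. cmod ((f \<circ> \<phi>) (of_real q * cis t)) \<partial>circ) \<le> \<kappa> * (c * (1 - r))" if "0 \<le> q" "q < 1" for q
    using mult_left_mono[OF integral_u_fn_le[OF a r' r(2) \<phi> that], of c] c
    by (simp add: f_def norm_mult \<kappa>_def mult_ac)
  define v where "v t = cmod (f (\<phi> (of_real \<rho> * cis t)))" for t
  have b\<phi>: "bounded_borel (\<lambda>t. f (\<phi> (of_real \<rho> * cis t)))"
    using bounded_borel_holomorphic[OF f\<phi> \<rho>] by simp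
  have bv: "bounded_borel v" unfolding v_def by (intro bounded_borel_norm b\<phi>)
  have v0: "0 \<le> v t" for t by (simp add: v_def)
  have \<rho>ball: "\<phi> (of_real \<rho> * cis t) \<in> ball 0 1" for t using \<phi>1[of "of_real \<rho> * cis t"] \<rho> by (simp add: norm_mult)
  have vc: "v t \<le> c" for t unfolding v_def by (intro fle \<rho>ball)
  have vint: "(\<integral>t. v t \<partial>circ) \<le> \<kappa> * (c * (1 - r))" using \<phi>int[OF \<rho>] by (simp add: v_def)
  have bvd: "bounded_borel (\<lambda>t. v t / \<delta>)" using bounded_borel_mult[OF bounded_borel_const[of "1 / \<delta>"] bv] by simp
  have "modular (\<lambda>t. of_real c * u_fn a r (\<phi> (of_real \<rho> * cis t)) / of_real \<delta>) = (\<integral>\<^sup>+ t. ennreal (\<Psi> (v t / \<delta>)) \<partial>circ)"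
    unfolding modular_def v_def f_def using \<delta> by (simp add: norm_divide)
  also have "\<dots> = ennreal (\<integral>t. \<Psi> (v t / \<delta>) \<partial>circ)"
    using \<delta> v0 by (intro nn_integral_eq_integral bounded_borel_integrable bounded_borel_Psi bvd AE_I2 nonneg) auto
  finally have big': "1 < (\<integral>t. \<Psi> (v t / \<delta>) \<partial>circ)"
    using big unfolding c_def[symmetric] by (simp add: ennreal_less_iff flip: ennreal_1)
  have "\<Psi> (1 / \<delta>) * (\<integral>t. v t \<partial>circ) \<le> \<Psi> (1 / \<delta>) * (\<kappa> * (c * (1 - r)))"
    using P vint by (intro mult_left_mono) auto
  also have "\<dots> \<le> 1 / 2" using small[OF terms(3) S(4) c(2)] by (simp add: mult_ac)
  finally have small1: "\<Psi> (1 / \<delta>) * (\<integral>t. v t \<partial>circ) \<le> 1 / 2" .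
  have "\<Psi> y * (\<integral>t. v t \<partial>circ) \<le> \<Psi> y * (\<kappa> * (c * (1 - r)))"
    using P vint by (intro mult_left_mono) auto
  also have "\<dots> \<le> 1" using small[OF terms(4) S(5) c(2)] by (simp add: mult_ac)
  finally have small2: "\<Psi> y * (\<integral>t. v t \<partial>circ) \<le> 1" .
  show thesis
  proof (rule norming_weight[OF bv v0 vc \<delta> big' small1 y(1) small2])
    fix w assume bw: "bounded_borel w" and w: "\<And>t. 0 \<le> w t" "\<And>t. w t \<le> slope (2 * c / \<delta>)"
      and vw: "\<delta> / 2 \<le> (\<integral>t. v t * w t \<partial>circ)" and yw: "y * (\<integral>t. w t \<partial>circ) \<le> 1"
      and wh: "\<And>h q C. h \<in> hardy2 \<Longrightarrow> 0 \<le> q \<Longrightarrow> q < 1 \<Longrightarrow> 0 < C \<Longrightarrow> modular (\<lambda>t. radial_lim h t / of_real C) \<le> 1 \<Longrightarrow>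
         (\<integral>t. w t * cmod (h (of_real q * cis t)) \<partial>circ) \<le> C"
    \<comment> \<open>The conjugate phase makes the integrand for the block's own image equal to v
      w.\<close>
    define g where "g t = of_real (w t) * cnj (sgn (f (\<phi> (of_real \<rho> * cis t))))" for t
    have bg: "bounded_borel g"
    proof -
      obtain W where [measurable]: "w \<in> borel_measurable borel" and W: "\<And>t. norm (w t) \<le> W" using bw by (meson bounded_borelE)
      have [measurable]: "(\<lambda>t. f (\<phi> (of_real \<rho> * cis t))) \<in> borel_measurable borel" by (rule bounded_borel_measurable[OF b\<phi>])
      have "bounded_borel (\<lambda>t. sgn (f (\<phi> (of_real \<rho> * cis t))))"
      proof (rule bounded_borelI[of _ 1])
        show "(\<lambda>t. sgn (f (\<phi> (of_real \<rho> * cis t)))) \<in> borel_measurable borel"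
          unfolding sgn_div_norm by measurable
      qed (simp add: norm_sgn)
      moreover have "bounded_borel (\<lambda>t. complex_of_real (w t))" using W by (intro bounded_borelI[of _ W]) auto
      ultimately show ?thesis unfolding g_def by (intro bounded_borel_mult bounded_borel_cnj)
    qed
    have gw: "cmod (g t) \<le> w t" for t
      using w(1)[of t] by (simp add: g_def norm_mult norm_sgn)
    define G where "G h = (\<integral>t. h (of_real \<rho> * cis t) * g t \<partial>circ)" for h
    have bh: "bounded_borel (circle_restr h \<rho>)" if "h holomorphic_on ball 0 1" for h :: "complex \<Rightarrow> complex"
      using that by (intro bounded_borel_holomorphic \<rho>)
    have Gle: "cmod (G h) \<le> (\<integral>t. w t * cmod (h (of_real \<rho> * cis t)) \<partial>circ)" if h: "h holomorphic_on ball 0 1" for h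
    proof -
      have "cmod (G h) \<le> (\<integral>t. cmod (h (of_real \<rho> * cis t) * g t) \<partial>circ)" unfolding G_def by (rule integral_norm_bound)
      also have "\<dots> \<le> (\<integral>t. w t * cmod (h (of_real \<rho> * cis t)) \<partial>circ)"
      proof (rule integral_mono)
        fix t
        have "cmod (h (of_real \<rho> * cis t) * g t) = cmod (g t) * cmod (h (of_real \<rho> * cis t))" by (simp add: norm_mult)
        also have "\<dots> \<le> w t * cmod (h (of_real \<rho> * cis t))" by (intro mult_right_mono gw) auto
        finally show "cmod (h (of_real \<rho> * cis t) * g t) \<le> w t * cmod (h (of_real \<rho> * cis t))" .
      qed (intro bounded_borel_integrable bounded_borel_norm bounded_borel_mult bh[OF h] bg bw)+
      finally show ?thesis .
    qed
    have wint: "0 \<le> (\<integral>t. w t \<partial>circ)" using w by (simp add: integral_nonneg)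
    show thesis
    proof (rule that[of f c "slope (2 * c / \<delta>)" G])
      show "f holomorphic_on ball 0 1" by fact
      show "0 \<le> c" "0 \<le> slope (2 * c / \<delta>)" using c slope_nonneg by auto
      show "cmod (f z) \<le> c" if "z \<in> ball 0 1" for z using fle[OF that] .
      show "modular (\<lambda>t. (s (of_real q * cis t) + f (of_real q * cis t)) / of_real M)
           \<le> modular (\<lambda>t. s (of_real q * cis t) / of_real M) + ennreal \<eta>"
        if s: "s holomorphic_on ball 0 1" "\<And>z. z \<in> ball 0 1 \<Longrightarrow> cmod (s z) \<le> b" and q: "0 \<le> q" "q < 1" for s q
      proof -
        have "modular (\<lambda>t. (s (of_real q * cis t) + f (of_real q * cis t)) / of_real M)
           \<le> modular (\<lambda>t. s (of_real q * cis t) / of_real M) + ennreal (2 * (\<eta> / 2))"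
        proof (rule modular_perturb[OF M b K(1) _ K(2)])
          show "(\<lambda>t. s (of_real q * cis t)) \<in> borel_measurable borel"
            by (rule bounded_borel_measurable[OF bounded_borel_holomorphic[OF s(1) q]])
          show "bounded_borel (\<lambda>t. f (of_real q * cis t))" by (rule bounded_borel_holomorphic[OF f q])
          have "K * (\<integral>t. cmod (f (of_real q * cis t)) \<partial>circ) \<le> K * (c * (1 - r))"
            by (intro mult_left_mono fint q K)
          also have "\<dots> \<le> \<eta> / 2" using small[OF terms(1) S(2) c(2)] \<eta> by (simp add: field_simps)
          finally show "K * (\<integral>t. cmod (f (of_real q * cis t)) \<partial>circ) \<le> \<eta> / 2" .
          show "modular (\<lambda>t. f (of_real q * cis t)) \<le> 1"
            unfolding f_def c_def by (rule modular_test_function[OF a r' r(2) q])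
        qed (use \<eta> s q in \<open>auto simp: norm_mult\<close>)
        then show ?thesis by simp
      qed
      show "G (\<lambda>z. \<alpha> * h z + \<beta> * k z) = \<alpha> * G h + \<beta> * G k"
        if "h holomorphic_on ball 0 1" "k holomorphic_on ball 0 1" for h k \<alpha> \<beta>
      proof -
        note i = bounded_borel_integrable[OF bounded_borel_mult[OF bh[OF that(1)] bg]]
          bounded_borel_integrable[OF bounded_borel_mult[OF bh[OF that(2)] bg]]
        have "G (\<lambda>z. \<alpha> * h z + \<beta> * k z) = (\<integral>t. \<alpha> * (h (of_real \<rho> * cis t) * g t) + \<beta> * (k (of_real \<rho> * cis t) * g t) \<partial>circ)"
          unfolding G_def by (intro Bochner_Integration.integral_cong) (auto simp: algebra_simps)
        also have "\<dots> = \<alpha> * G h + \<beta> * G k"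
          unfolding G_def using i by (subst Bochner_Integration.integral_add) auto
        finally show ?thesis .
      qed
      show "cmod (G h) \<le> ho_norm \<Psi> h" if h: "h \<in> hardy_orlicz \<Psi>" for h
      proof (rule le_ho_normI[OF D h])
        fix C :: real assume C: "0 < C" "modular (\<lambda>t. radial_lim h t / of_real C) \<le> 1"
        have "h \<in> hardy2" by (rule hardy_orlicz_subset_hardy2[OF D h])
        from Gle[of h] wh[OF this \<rho> C] h show "cmod (G h) \<le> C" by (auto simp: hardy_orlicz_def)
      qed
      have "G (f \<circ> \<phi>) = (\<integral>t. of_real (v t * w t) \<partial>circ)"
        unfolding G_def
      proof (rule Bochner_Integration.integral_cong[OF refl])
        fix t
        let ?z = "f (\<phi> (of_real \<rho> * cis t))"
        have "?z * cnj (sgn ?z) = of_real (cmod ?z)"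
        proof (cases "?z = 0")
          case False
          have "?z * cnj (sgn ?z) = of_real (inverse (cmod ?z)) * (?z * cnj ?z)"
            by (simp add: sgn_div_norm scaleR_conv_of_real mult_ac)
          also have "\<dots> = of_real (inverse (cmod ?z) * (cmod ?z)\<^sup>2)"
            by (simp only: complex_norm_square of_real_mult)
          finally show ?thesis using False by (simp add: power2_eq_square)
        qed simp
        then show "(f \<circ> \<phi>) (of_real \<rho> * cis t) * g t = of_real (v t * w t)"
          by (simp add: g_def v_def mult.left_commute)
      qed
      also have "\<dots> = of_real (\<integral>t. v t * w t \<partial>circ)"
        by (intro integral_of_real bounded_borel_integrable bounded_borel_mult bv bw)
      finally show "\<delta> / 2 \<le> cmod (G (f \<circ> \<phi>))" using vw by simp
      show "cmod (G h) \<le> \<eta>" if h: "h holomorphic_on ball 0 1" and hb: "\<And>z. z \<in> ball 0 1 \<Longrightarrow> cmod (h z) \<le> b" for h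
      proof -
        have "cmod (G h) \<le> (\<integral>t. w t * b \<partial>circ)"
        proof (rule order_trans[OF Gle[OF h]], rule integral_mono)
          show "w t * cmod (h (of_real \<rho> * cis t)) \<le> w t * b" for t
            using \<rho> by (intro mult_left_mono hb w) (auto simp: norm_mult)
        qed (intro bounded_borel_integrable bounded_borel_norm bounded_borel_mult bh[OF h] bw bounded_borel_const)+
        also have "\<dots> = b * (\<integral>t. w t \<partial>circ)" by simp
        also have "\<dots> \<le> (\<eta> * y) * (\<integral>t. w t \<partial>circ)" by (intro mult_right_mono y wint)
        also have "\<dots> \<le> \<eta>" using mult_left_mono[OF yw, of \<eta>] \<eta> by (simp add: mult.assoc)
        finally show ?thesis .
      qed
      show "cmod (G h) \<le> slope (2 * c / \<delta>) * m"
        if h: "h holomorphic_on ball 0 1" and hm: "\<And>q. 0 \<le> q \<Longrightarrow> q < 1 \<Longrightarrow> (\<integral>t. cmod (h (of_real q * cis t)) \<partial>circ) \<le> m" for h m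
      proof -
        have "cmod (G h) \<le> (\<integral>t. slope (2 * c / \<delta>) * cmod (h (of_real \<rho> * cis t)) \<partial>circ)"
        proof (rule order_trans[OF Gle[OF h]], rule integral_mono)
          show "w t * cmod (h (of_real \<rho> * cis t)) \<le> slope (2 * c / \<delta>) * cmod (h (of_real \<rho> * cis t))" for t
            by (intro mult_right_mono w) auto
        qed (intro bounded_borel_integrable bounded_borel_norm bounded_borel_mult bh[OF h] bw bounded_borel_const)+
        also have "\<dots> = slope (2 * c / \<delta>) * (\<integral>t. cmod (h (of_real \<rho> * cis t)) \<partial>circ)" by simp
        also have "\<dots> \<le> slope (2 * c / \<delta>) * m" by (intro mult_left_mono hm \<rho> slope_nonneg)
        finally show ?thesis .
      qed
      show "B * (\<integral>t. cmod ((f \<circ> \<phi>) (of_real q * cis t)) \<partial>circ) \<le> \<eta>" if q: "0 \<le> q" "q < 1" for q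
      proof -
        have "B * (\<integral>t. cmod ((f \<circ> \<phi>) (of_real q * cis t)) \<partial>circ) \<le> B * (\<kappa> * (c * (1 - r)))"
          by (intro mult_left_mono \<phi>int q B)
        also have "\<dots> \<le> \<eta>" using small[OF terms(2) S(3) c(2)] \<eta> by (simp add: field_simps)
        finally show ?thesis .
      qed
    qed
  qed
qed

end

subsection \<open>Cluster points\<close>

text \<open>Otherwise every point has a neighbourhood that the sequence eventually avoids, and
  finitely many of these cover \<open>K\<close>.\<close>

lemma compactin_cluster_point:
  assumes K: "compactin X K" and y: "\<And>n::nat. y n \<in> K"
  obtains g where "g \<in> K" "\<And>U. openin X U \<Longrightarrow> g \<in> U \<Longrightarrow> \<exists>\<^sub>F n in sequentially. y n \<in> U"
proof (rule ccontr)
  assume "\<not> thesis"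
  then have "\<forall>g\<in>K. \<exists>U. openin X U \<and> g \<in> U \<and> \<not> (\<exists>\<^sub>F n in sequentially. y n \<in> U)"
    using that by blast
  then obtain U where U: "\<And>g. g \<in> K \<Longrightarrow> openin X (U g)" "\<And>g. g \<in> K \<Longrightarrow> g \<in> U g"
    "\<And>g. g \<in> K \<Longrightarrow> \<not> (\<exists>\<^sub>F n in sequentially. y n \<in> U g)"
    by metis
  obtain F where F: "finite F" "F \<subseteq> U ` K" "K \<subseteq> \<Union>F"
    using compactinD[OF K, of "U ` K"] U(1,2) by blast
  have "\<forall>\<^sub>F n in sequentially. \<forall>V\<in>F. y n \<notin> V"
    using F(1,2) U(3) by (intro eventually_ball_finite) (auto simp: not_frequently subset_iff image_iff)
  then obtain n where "\<forall>V\<in>F. y n \<notin> V" by (auto simp: eventually_sequentially)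
  with y[of n] F(3) show False by blast
qed

context orlicz
begin

lemma openin_ho_weak_topology:
  assumes "L \<in> ho_dual \<Psi>" "open U"
  shows "openin (ho_weak_topology \<Psi>) ({f. L f \<in> U} \<inter> hardy_orlicz \<Psi>)"
  unfolding ho_weak_topology_def
  by (rule openin_subtopology_Int, rule topology_generated_by_Basis) (use assms in blast)

lemma topspace_ho_weak_topology: "topspace (ho_weak_topology \<Psi>) = hardy_orlicz \<Psi>"
proof -
  \<comment> \<open>A generated topology lives on the union of its generators; the zero functional
    shows that this union is everything.\<close>
  have "(\<lambda>_. 0) \<in> ho_dual \<Psi>" unfolding ho_dual_def by (auto intro!: exI[of _ 0])
  then have "{f. (\<lambda>_. 0::complex) f \<in> UNIV} \<in> {{f. L f \<in> U} | L U. L \<in> ho_dual \<Psi> \<and> open U}"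
    by blast
  then have "\<Union>{{f. L f \<in> U} | L U. L \<in> ho_dual \<Psi> \<and> open U} = UNIV" by blast
  then show ?thesis unfolding ho_weak_topology_def by (simp add: topspace_subtopology)
qed

text \<open>By Tychonoff's theorem the unit ball of the dual is weak-star compact; this replaces an ultrafilter limit.\<close>

lemma dual_cluster_point:
  assumes G: "\<And>n. G n \<in> ho_dual \<Psi>" "\<And>n h. h \<in> hardy_orlicz \<Psi> \<Longrightarrow> cmod (G n h) \<le> ho_norm \<Psi> h"
  obtains L where "L \<in> ho_dual \<Psi>"
    "\<And>h \<epsilon>. h \<in> hardy_orlicz \<Psi> \<Longrightarrow> 0 < \<epsilon> \<Longrightarrow> \<exists>\<^sub>F n in sequentially. cmod (G n h - L h) < \<epsilon>"
proof -
  let ?H = "hardy_orlicz \<Psi>"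
  define X where "X = product_topology (\<lambda>_. euclidean :: complex topology) ?H"
  define K where "K = PiE ?H (\<lambda>h. cball (0::complex) (ho_norm \<Psi> h))"
  have "compactin X K" unfolding X_def K_def by (simp add: compactin_PiE)
  moreover have "restrict (G n) ?H \<in> K" for n unfolding K_def using G(2) by auto
  ultimately obtain L where L: "L \<in> K" "\<And>U. openin X U \<Longrightarrow> L \<in> U \<Longrightarrow> \<exists>\<^sub>F n in sequentially. restrict (G n) ?H \<in> U"
    using compactin_cluster_point[of X K "\<lambda>n. restrict (G n) ?H"] by metis
  \<comment> \<open>Several functions at one index: linearity of \<open>L\<close> compares three
    values of the same \<open>G n\<close>.\<close>
  have freq: "\<exists>\<^sub>F n in sequentially. \<forall>h\<in>F. cmod (G n h - L h) < \<epsilon>" if F: "finite F" "F \<subseteq> ?H" and \<epsilon>: "0 < \<epsilon>" for F \<epsilon>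
  proof -
    let ?U = "PiE ?H (\<lambda>h. if h \<in> F then ball (L h) \<epsilon> else UNIV)"
    have "openin X ?U"
      unfolding X_def openin_PiE_gen
      by (rule disjI2) (auto intro: finite_subset[OF _ F(1)])
    moreover have "L \<in> ?U" using L(1) \<epsilon> by (auto simp: K_def PiE_iff)
    ultimately have "\<exists>\<^sub>F n in sequentially. restrict (G n) ?H \<in> ?U" by (rule L(2))
    then show ?thesis
    proof (rule frequently_elim1)
      fix n assume n: "restrict (G n) ?H \<in> ?U"
      show "\<forall>h\<in>F. cmod (G n h - L h) < \<epsilon>"
      proof
        fix h assume h: "h \<in> F"
        then have "h \<in> ?H" using F by blast
        then have "restrict (G n) ?H h \<in> (if h \<in> F then ball (L h) \<epsilon> else UNIV)" using n by (rule PiE_mem[rotated])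
        then show "cmod (G n h - L h) < \<epsilon>" using h \<open>h \<in> ?H\<close> by (simp add: dist_norm norm_minus_commute)
      qed
    qed
  qed
  show thesis
  proof (rule that)
    show "L \<in> ho_dual \<Psi>"
      unfolding ho_dual_def
    proof (intro CollectI conjI ballI allI)
      have "cmod (L h) \<le> ho_norm \<Psi> h" if "h \<in> ?H" for h using L(1) that by (auto simp: K_def PiE_iff)
      then show "\<exists>K. \<forall>f\<in>?H. cmod (L f) \<le> K * ho_norm \<Psi> f" by (intro exI[of _ 1]) auto
    next
      fix f g :: "complex \<Rightarrow> complex" and a b :: complex
      assume f: "f \<in> ?H" and g: "g \<in> ?H"
      let ?h = "\<lambda>z. a * f z + b * g z"
      have h: "?h \<in> ?H" by (rule hardy_orlicz_lincomb[OF f g])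
      have "cmod (L ?h - (a * L f + b * L g)) \<le> 0 + e" if e: "0 < e" for e
      proof -
        define \<epsilon> where "\<epsilon> = e / (1 + cmod a + cmod b)"
        have pos: "0 < 1 + cmod a + cmod b" by (simp add: add_pos_nonneg)
        have \<epsilon>: "0 < \<epsilon>" using e pos by (simp add: \<epsilon>_def)
        have "\<exists>\<^sub>F n in sequentially. \<forall>k\<in>{f, g, ?h}. cmod (G n k - L k) < \<epsilon>"
          by (rule freq) (use f g h \<epsilon> in auto)
        then obtain n where n: "cmod (G n f - L f) < \<epsilon>" "cmod (G n g - L g) < \<epsilon>" "cmod (G n ?h - L ?h) < \<epsilon>"
          by (auto dest: frequently_ex)
        have lin: "G n ?h = a * G n f + b * G n g" using G(1)[of n] f g unfolding ho_dual_def by blast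
        have eq: "L ?h - (a * L f + b * L g) = a * (G n f - L f) + (b * (G n g - L g) - (G n ?h - L ?h))"
          unfolding lin by (simp add: algebra_simps)
        have "cmod (L ?h - (a * L f + b * L g)) \<le> cmod (a * (G n f - L f)) + (cmod (b * (G n g - L g)) + cmod (G n ?h - L ?h))"
          unfolding eq by (intro order_trans[OF norm_triangle_ineq] add_left_mono norm_triangle_ineq4)
        also have "\<dots> \<le> cmod a * \<epsilon> + (cmod b * \<epsilon> + \<epsilon>)"
          unfolding norm_mult using n by (intro add_mono mult_left_mono) auto
        also have "\<dots> = (1 + cmod a + cmod b) * \<epsilon>" by (simp add: algebra_simps)
        also have "\<dots> = e" using pos by (simp add: \<epsilon>_def)
        finally show ?thesis by simp
      qed
      then have "cmod (L ?h - (a * L f + b * L g)) \<le> 0" by (rule field_le_epsilon)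
      then show "L ?h = a * L f + b * L g" by simp
    qed
    show "\<exists>\<^sub>F n in sequentially. cmod (G n h - L h) < \<epsilon>" if "h \<in> ?H" "0 < \<epsilon>" for h \<epsilon>
      using freq[of "{h}" \<epsilon>] that by simp
  qed
qed

text \<open>A weak cluster point of \<open>y\<close> and a weak-star cluster point of \<open>G\<close> would make the two iterated limits
  of \<open>G n (y N)\<close> agree.\<close>

lemma no_triangular_system:
  assumes K: "compactin (ho_weak_topology \<Psi>) K" and y: "\<And>N. y N \<in> K"
    and G: "\<And>n. G n \<in> ho_dual \<Psi>" "\<And>n h. h \<in> hardy_orlicz \<Psi> \<Longrightarrow> cmod (G n h) \<le> ho_norm \<Psi> h"
    and e: "0 < e" and low: "\<And>n N. n < N \<Longrightarrow> e \<le> cmod (G n (y N))"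
    and lim: "\<And>N. (\<lambda>n. G n (y N)) \<longlonglongrightarrow> 0"
  shows False
proof -
  have KH: "K \<subseteq> hardy_orlicz \<Psi>"
    using compactin_subset_topspace[OF K] by (simp add: topspace_ho_weak_topology)
  obtain g where g: "g \<in> K" "\<And>U. openin (ho_weak_topology \<Psi>) U \<Longrightarrow> g \<in> U \<Longrightarrow> \<exists>\<^sub>F N in sequentially. y N \<in> U"
    using compactin_cluster_point[OF K, of y] y by metis
  have gH: "g \<in> hardy_orlicz \<Psi>" using g(1) KH by blast
  have cl: "\<exists>\<^sub>F N in sequentially. L (y N) \<in> U" if L: "L \<in> ho_dual \<Psi>" and U: "open U" "L g \<in> U" for L U
  proof -
    have "\<exists>\<^sub>F N in sequentially. y N \<in> {f. L f \<in> U} \<inter> hardy_orlicz \<Psi>"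
      using U gH by (intro g(2) openin_ho_weak_topology L) auto
    then show ?thesis by (rule frequently_elim1) auto
  qed
  \<comment> \<open>\<open>G n\<close> is weakly continuous, so its lower bound on late terms of
    \<open>y\<close> passes to the cluster point.\<close>
  have Gg: "e \<le> cmod (G n g)" for n
  proof (rule ccontr)
    assume "\<not> e \<le> cmod (G n g)"
    then have "\<exists>\<^sub>F N in sequentially. G n (y N) \<in> ball 0 e" by (intro cl G) auto
    moreover have "\<forall>\<^sub>F N in sequentially. G n (y N) \<notin> ball 0 e"
      using eventually_gt_at_top[of n] by eventually_elim (use low in \<open>auto simp: not_less\<close>)
    ultimately show False by (simp add: frequently_def)
  qed
  obtain L where L: "L \<in> ho_dual \<Psi>"
    "\<And>h \<epsilon>. h \<in> hardy_orlicz \<Psi> \<Longrightarrow> 0 < \<epsilon> \<Longrightarrow> \<exists>\<^sub>F n in sequentially. cmod (G n h - L h) < \<epsilon>"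
    using dual_cluster_point[of G] G by metis
  have Ly: "L (y N) = 0" for N
  proof (rule ccontr)
    assume ne: "L (y N) \<noteq> 0"
    let ?\<epsilon> = "cmod (L (y N)) / 2"
    have "\<exists>\<^sub>F n in sequentially. cmod (G n (y N) - L (y N)) < ?\<epsilon>"
      using ne y[of N] KH by (intro L(2)) auto
    moreover have "\<forall>\<^sub>F n in sequentially. cmod (G n (y N)) < ?\<epsilon>"
      using tendstoD[OF lim[of N], of ?\<epsilon>] ne by simp
    ultimately have "\<exists>\<^sub>F n in sequentially. cmod (G n (y N) - L (y N)) < ?\<epsilon> \<and> cmod (G n (y N)) < ?\<epsilon>"
      by (rule frequently_eventually_frequently)
    then obtain n where n: "cmod (G n (y N) - L (y N)) < ?\<epsilon>" "cmod (G n (y N)) < ?\<epsilon>" by (auto dest: frequently_ex)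
    have "cmod (L (y N)) \<le> cmod (G n (y N)) + cmod (G n (y N) - L (y N))" by norm
    with n show False by linarith
  qed
  \<comment> \<open>\<open>L\<close> is itself in the dual, hence weakly continuous, so its
    vanishing on all \<open>y N\<close> passes to \<open>g\<close>.\<close>
  have "L g = 0"
  proof (rule ccontr)
    assume "L g \<noteq> 0"
    then have "\<exists>\<^sub>F N in sequentially. L (y N) \<in> - {0}" by (intro cl L) auto
    then show False using Ly by simp
  qed
  moreover have "\<exists>\<^sub>F n in sequentially. cmod (G n g - L g) < e" by (rule L(2)[OF gH e])
  ultimately obtain n where "cmod (G n g) < e" by (auto dest: frequently_ex)
  with Gg[of n] show False by simp
qed

subsection \<open>Weak compactness\<close>

text \<open>If this failed, blocks could be strung together for ever, each depending on the earlier
  ones only through \<open>b\<close> and \<open>B\<close>, and the images of the scaled partial sums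
  would form the triangular system just excluded. Interior circles suffice because Fatou's lemma
  turns such bounds into norm estimates.\<close>

lemma weakly_compact_modular_bound:
  assumes D: "Delta0 \<Psi>" and \<phi>: "\<phi> holomorphic_on ball 0 1" "\<phi> ` ball 0 1 \<subseteq> ball 0 1"
    and wc: "ho_weakly_compact \<Psi> (comp_op \<phi>)" and \<delta>: "0 < \<delta>"
  shows "\<exists>r0. 0 \<le> r0 \<and> r0 < 1 \<and>
    (\<forall>a r \<rho>. cmod a = 1 \<longrightarrow> r0 < r \<longrightarrow> r < 1 \<longrightarrow> 0 \<le> \<rho> \<longrightarrow> \<rho> < 1 \<longrightarrow>
      modular (\<lambda>t. of_real (orlicz_inv \<Psi> (1 / (1 - r))) * u_fn a r (\<phi> (of_real \<rho> * cis t)) / of_real \<delta>) \<le> 1)"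
proof (rule ccontr)
  assume neg: "\<not> ?thesis"
  have large: "\<exists>a r \<rho>. cmod a = 1 \<and> r0 < r \<and> r < 1 \<and> 0 \<le> \<rho> \<and> \<rho> < 1 \<and>
      1 < modular (\<lambda>t. of_real (orlicz_inv \<Psi> (1 / (1 - r))) * u_fn a r (\<phi> (of_real \<rho> * cis t)) / of_real \<delta>)"
    if "0 \<le> r0" "r0 < 1" for r0
  proof -
    define m where "m a r \<rho> = modular (\<lambda>t. of_real (orlicz_inv \<Psi> (1 / (1 - r))) * u_fn a r (\<phi> (of_real \<rho> * cis t)) / of_real \<delta>)"
      for a r \<rho>
    show ?thesis using neg that unfolding m_def[symmetric] by (meson not_le)
  qed
  obtain M where M: "0 < M" and perturb: "\<And>b \<epsilon>. 0 < \<epsilon> \<Longrightarrow> \<exists>K\<ge>0. \<forall>a x. 0 \<le> a \<longrightarrow> a \<le> b \<longrightarrow> 0 \<le> x \<longrightarrow>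
       \<Psi> ((a + x) / M) \<le> \<Psi> (a / M) + K * x + \<epsilon> * \<Psi> x"
    using Delta0_perturb[OF D] by metis
  define hol where "hol h \<longleftrightarrow> h holomorphic_on ball (0::complex) 1" for h :: "complex \<Rightarrow> complex"
  \<comment> \<open>A total of at most 1 keeps the modulars of partial sums below 1; a total of at
    most \<delta> / 4 leaves \<delta> / 4 of the diagonal values, which are at least \<delta> /
    2.\<close>
  define \<eta> where "\<eta> n = min 1 (\<delta> / 4) * (1/2) ^ Suc n" for n
  have \<eta>: "0 < \<eta> n" for n using \<delta> by (simp add: \<eta>_def)
  have \<eta>sum: "(\<Sum>k\<in>A. \<eta> k) \<le> min 1 (\<delta> / 4)" if "finite A" for A
  proof -
    have "\<eta> sums (min 1 (\<delta> / 4) * 1)" unfolding \<eta>_def by (intro sums_mult power_half_series)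
    then show ?thesis using sum_le_suminf[of \<eta> A] that \<eta> by (simp add: sums_iff less_imp_le)
  qed
  \<comment> \<open>Bounding \<open>f\<close> by b' - b makes \<open>b\<close> accumulate to a sup
    bound for partial sums; \<open>B\<close> is likewise made to grow, so that it serves for all
    earlier functionals at once.\<close>
  define block where "block n b B f G b' B' \<longleftrightarrow> hol f \<and> (\<forall>z\<in>ball 0 1. cmod (f z) \<le> b' - b) \<and> b \<le> b' \<and> B \<le> B' \<and>
      (\<forall>s q. hol s \<longrightarrow> (\<forall>z\<in>ball 0 1. cmod (s z) \<le> b) \<longrightarrow> 0 \<le> q \<longrightarrow> q < 1 \<longrightarrow>
         modular (\<lambda>t. (s (of_real q * cis t) + f (of_real q * cis t)) / of_real M)
           \<le> modular (\<lambda>t. s (of_real q * cis t) / of_real M) + ennreal (\<eta> n)) \<and>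
      (\<forall>h k \<alpha> \<beta>. hol h \<longrightarrow> hol k \<longrightarrow> G (\<lambda>z. \<alpha> * h z + \<beta> * k z) = \<alpha> * G h + \<beta> * G k) \<and>
      (\<forall>h\<in>hardy_orlicz \<Psi>. cmod (G h) \<le> ho_norm \<Psi> h) \<and>
      \<delta> / 2 \<le> cmod (G (f \<circ> \<phi>)) \<and>
      (\<forall>h. hol h \<longrightarrow> (\<forall>z\<in>ball 0 1. cmod (h z) \<le> b) \<longrightarrow> cmod (G h) \<le> \<eta> n) \<and>
      (\<forall>h m. hol h \<longrightarrow> (\<forall>q. 0 \<le> q \<longrightarrow> q < 1 \<longrightarrow> (\<integral>t. cmod (h (of_real q * cis t)) \<partial>circ) \<le> m) \<longrightarrow>
         cmod (G h) \<le> B' * m) \<and>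
      (\<forall>q. 0 \<le> q \<longrightarrow> q < 1 \<longrightarrow> B * (\<integral>t. cmod ((f \<circ> \<phi>) (of_real q * cis t)) \<partial>circ) \<le> \<eta> n)"
    for n :: nat and b B :: real and f :: "complex \<Rightarrow> complex" and G :: "(complex \<Rightarrow> complex) \<Rightarrow> complex" and b' B' :: real
  have ex: "\<exists>f G b' B'. block n b B f G b' B'" if b: "0 \<le> b" and B: "0 \<le> B" for n b B
  proof (rule building_block[OF D \<phi> \<delta> large M perturb b B \<eta>[of n]], goal_cases)
    case (4 f G b' B')
    \<comment> \<open>Nonnegativity of \<open>m\<close> allows the constant to be enlarged to B +
      B'.\<close>
    have m: "0 \<le> m" if "\<forall>q. 0 \<le> q \<longrightarrow> q < 1 \<longrightarrow> (\<integral>t. cmod (h (of_real q * cis t)) \<partial>circ) \<le> m" for h :: "complex \<Rightarrow> complex" and m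
    proof -
      have "0 \<le> (\<integral>t. cmod (h (of_real 0 * cis t)) \<partial>circ)" by simp
      also have "\<dots> \<le> m" using that by (metis less_numeral_extra(1) order_refl)
      finally show ?thesis .
    qed
    have "cmod (G h) \<le> (B + B') * m" if "hol h" "\<forall>q. 0 \<le> q \<longrightarrow> q < 1 \<longrightarrow> (\<integral>t. cmod (h (of_real q * cis t)) \<partial>circ) \<le> m" for h m
    proof -
      have "cmod (G h) \<le> B' * m" using that by (intro 4) (auto simp: hol_def)
      also have "\<dots> \<le> (B + B') * m" using B m[OF that(2)] by (intro mult_right_mono) auto
      finally show ?thesis .
    qed
    then have "block n b B f G (b + b') (B + B')"
      unfolding block_def using 4 by (auto simp: hol_def)
    then show ?case by blast
  qed auto
  define P where "P x \<longleftrightarrow> (case x of (f, G, b, B) \<Rightarrow> 0 \<le> b \<and> 1 \<le> B)"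
    for x :: "(complex \<Rightarrow> complex) \<times> ((complex \<Rightarrow> complex) \<Rightarrow> complex) \<times> real \<times> real"
  have "\<exists>X. \<forall>n. (P (X n) \<and> (n = 0 \<longrightarrow> fst (snd (snd (X n))) = 0)) \<and>
    (case X n of (f, G, b, B) \<Rightarrow> case X (Suc n) of (f', G', b', B') \<Rightarrow> block n b B f' G' b' B')"
  proof (rule dependent_nat_choice)
    \<comment> \<open>A dummy state: bound 0 for the empty sum, and B = 1 so that division by
      \<open>B\<close> is always possible.\<close>
    show "\<exists>x. P x \<and> (0 = (0::nat) \<longrightarrow> fst (snd (snd x)) = 0)"
      by (rule exI[of _ "(\<lambda>_. 0, \<lambda>_. 0, 0, 1)"]) (simp add: P_def)
    fix x and n :: nat assume x: "P x \<and> (n = 0 \<longrightarrow> fst (snd (snd x)) = 0)"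
    obtain f G b B where xx: "x = (f, G, b, B)" by (metis prod_cases4)
    with x have b: "0 \<le> b" "1 \<le> B" by (auto simp: P_def)
    then obtain f' G' b' B' where bl: "block n b B f' G' b' B'" using ex[of b B n] by auto
    have "0 \<le> b'" "1 \<le> B'"
      using b bl[unfolded block_def, THEN conjunct2, THEN conjunct2, THEN conjunct1]
        bl[unfolded block_def, THEN conjunct2, THEN conjunct2, THEN conjunct2, THEN conjunct1] by linarith+
    with bl show "\<exists>y. (P y \<and> (Suc n = 0 \<longrightarrow> fst (snd (snd y)) = 0)) \<and>
      (case x of (f, G, b, B) \<Rightarrow> case y of (f', G', b', B') \<Rightarrow> block n b B f' G' b' B')"
      by (intro exI[of _ "(f', G', b', B')"]) (simp add: P_def xx)
  qed
  then obtain X where X: "\<And>n. P (X n)" "fst (snd (snd (X 0))) = 0"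
    "\<And>n. case X n of (f, G, b, B) \<Rightarrow> case X (Suc n) of (f', G', b', B') \<Rightarrow> block n b B f' G' b' B'"
    by metis
  \<comment> \<open>State 0 holds no block, so block n is stored in state Suc n, whereas
    \<open>b n\<close> and \<open>B n\<close> are the bounds before it is added.\<close>
  define f where "f n = fst (X (Suc n))" for n
  define G where "G n = fst (snd (X (Suc n)))" for n
  define b where "b n = fst (snd (snd (X n)))" for n
  define B where "B n = snd (snd (snd (X n)))" for n
  have b0: "b 0 = 0" using X(2) by (simp add: b_def)
  have B1: "1 \<le> B n" for n using X(1)[of n] by (simp add: P_def B_def case_prod_beta)
  have bl: "block n (b n) (B n) (f n) (G n) (b (Suc n)) (B (Suc n))" for n
    using X(3)[of n] by (simp add: case_prod_beta f_def G_def b_def B_def)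
  note C = bl[unfolded block_def]
  note fhol = C[THEN conjunct1, rule_format]
  note fb = C[THEN conjunct2, THEN conjunct1, rule_format]
  note bS = C[THEN conjunct2, THEN conjunct2, THEN conjunct1, rule_format]
  note BS = C[THEN conjunct2, THEN conjunct2, THEN conjunct2, THEN conjunct1, rule_format]
  note pert = C[THEN conjunct2, THEN conjunct2, THEN conjunct2, THEN conjunct2, THEN conjunct1, rule_format]
  note lin = C[THEN conjunct2, THEN conjunct2, THEN conjunct2, THEN conjunct2, THEN conjunct2, THEN conjunct1, rule_format]
  note Gnorm = C[THEN conjunct2, THEN conjunct2, THEN conjunct2, THEN conjunct2, THEN conjunct2, THEN conjunct2, THEN conjunct1, rule_format]
  note diag = C[THEN conjunct2, THEN conjunct2, THEN conjunct2, THEN conjunct2, THEN conjunct2, THEN conjunct2, THEN conjunct2, THEN conjunct1, rule_format]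
  note old = C[THEN conjunct2, THEN conjunct2, THEN conjunct2, THEN conjunct2, THEN conjunct2, THEN conjunct2, THEN conjunct2, THEN conjunct2, THEN conjunct1, rule_format]
  note new = C[THEN conjunct2, THEN conjunct2, THEN conjunct2, THEN conjunct2, THEN conjunct2, THEN conjunct2, THEN conjunct2, THEN conjunct2, THEN conjunct2, THEN conjunct1, rule_format]
  note small = C[THEN conjunct2, THEN conjunct2, THEN conjunct2, THEN conjunct2, THEN conjunct2, THEN conjunct2, THEN conjunct2, THEN conjunct2, THEN conjunct2, THEN conjunct2, rule_format]
  have bmono: "b m \<le> b n" if "m \<le> n" for m n using bS that by (rule lift_Suc_mono_le)
  have Bmono: "B m \<le> B n" if "m \<le> n" for m n using BS that by (rule lift_Suc_mono_le)
  define S where "S N z = (\<Sum>k<N. f k z)" for N z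
  have Shol: "hol (S N)" for N
    unfolding hol_def S_def[abs_def] using fhol unfolding hol_def by (intro holomorphic_intros)
  have Sb: "cmod (S N z) \<le> b N" if "z \<in> ball 0 1" for N z
  proof (induction N)
    case (Suc N)
    have "cmod (S (Suc N) z) \<le> cmod (S N z) + cmod (f N z)" by (simp add: S_def norm_triangle_ineq)
    also have "\<dots> \<le> b N + (b (Suc N) - b N)" using Suc fb[OF that] by (rule add_mono)
    finally show ?case by simp
  qed (simp add: S_def b0)
  have Smod: "modular (\<lambda>t. S N (of_real q * cis t) / of_real M) \<le> ennreal (\<Sum>k<N. \<eta> k)" if q: "0 \<le> q" "q < 1" for q N
  proof (induction N)
    case 0
    then show ?case by (simp add: S_def modular_def)
  next
    case (Suc N)
    have "modular (\<lambda>t. S (Suc N) (of_real q * cis t) / of_real M)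
      = modular (\<lambda>t. (S N (of_real q * cis t) + f N (of_real q * cis t)) / of_real M)"
      by (simp add: S_def)
    also have "\<dots> \<le> modular (\<lambda>t. S N (of_real q * cis t) / of_real M) + ennreal (\<eta> N)"
      by (intro pert Shol Sb q)
    also have "\<dots> \<le> ennreal (\<Sum>k<N. \<eta> k) + ennreal (\<eta> N)" by (intro add_right_mono Suc)
    also have "\<dots> = ennreal (\<Sum>k<Suc N. \<eta> k)"
      using \<eta> by (simp add: sum_nonneg less_imp_le flip: ennreal_plus)
    finally show ?case .
  qed
  \<comment> \<open>Division by the fixed constant \<open>M\<close> puts every partial sum into the
    unit ball.\<close>
  define s where "s N z = S N z / of_real M" for N z
  have smod: "modular (\<lambda>t. s N (of_real q * cis t) / of_real 1) \<le> 1" if q: "0 \<le> q" "q < 1" for q N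
  proof -
    have "modular (\<lambda>t. s N (of_real q * cis t) / of_real 1) \<le> ennreal (\<Sum>k<N. \<eta> k)"
      using Smod[OF q, of N] by (simp add: s_def)
    also have "\<dots> \<le> ennreal 1" using \<eta>sum[of "{..<N}"] by (intro ennreal_leI) auto
    finally show ?thesis by simp
  qed
  have sH: "s N \<in> hardy_orlicz \<Psi>" for N
    unfolding hardy_orlicz_iff
  proof (intro conjI exI[of _ 1] allI impI smod)
    show "s N holomorphic_on ball 0 1"
      using Shol[of N] M unfolding s_def hol_def by (intro holomorphic_intros) auto
  qed auto
  have snorm: "ho_norm \<Psi> (s N) \<le> 1" for N
    by (rule ho_norm_le[OF hardy_orlicz_subset_hardy2[OF D sH]]) (use smod in auto)
  define y where "y N = comp_op \<phi> (s N)" for N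
  have TH: "comp_op \<phi> h \<in> hardy_orlicz \<Psi>" if "h \<in> hardy_orlicz \<Psi>" for h
    using wc that by (simp add: ho_weakly_compact_def)
  define K where "K = ho_weak_topology \<Psi> closure_of (comp_op \<phi> ` {h \<in> hardy_orlicz \<Psi>. ho_norm \<Psi> h \<le> 1})"
  have Kc: "compactin (ho_weak_topology \<Psi>) K" using wc by (simp add: ho_weakly_compact_def K_def)
  have "comp_op \<phi> ` {h \<in> hardy_orlicz \<Psi>. ho_norm \<Psi> h \<le> 1} \<subseteq> K"
    unfolding K_def using TH by (intro closure_of_subset) (auto simp: topspace_ho_weak_topology)
  then have yK: "y N \<in> K" for N using sH snorm unfolding y_def by blast
  \<comment> \<open>The image of a sum of blocks before division by \<open>M\<close>; general index
    sets serve the induction in \<open>GH\<close>.\<close>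
  define H where "H A z = (\<Sum>k\<in>A. f k (\<phi> z))" for A z
  have chol: "hol (h \<circ> \<phi>)" if "hol h" for h
    using that \<phi> unfolding hol_def by (blast intro: holomorphic_on_compose_gen)
  have Hhol: "hol (H A)" for A
    unfolding hol_def H_def[abs_def]
    using chol[OF fhol] unfolding hol_def by (intro holomorphic_intros) (simp add: o_def)
  have Gscale: "G n (\<lambda>z. \<alpha> * h z) = \<alpha> * G n h" if "hol h" for n \<alpha> h
    using lin[OF that that, of n \<alpha> 0] by simp
  have Gadd: "G n (\<lambda>z. h z + k z) = G n h + G n k" if "hol h" "hol k" for n h k
    using lin[OF that, of n 1 1] by simp
  have yH: "y N = (\<lambda>z. (1 / of_real M) * H {..<N} z)" for N
    by (simp add: y_def comp_op_def s_def S_def H_def fun_eq_iff)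
  have Gy: "G n (y N) = (1 / of_real M) * G n (H {..<N})" for n N
    unfolding yH by (rule Gscale[OF Hhol])
  have zero: "hol (\<lambda>_. 0)" by (simp add: hol_def)
  have G0: "G n (\<lambda>_. 0) = 0" for n using lin[OF zero zero, of n 0 0] by simp
  have GH: "G n (H A) = (\<Sum>k\<in>A. G n (f k \<circ> \<phi>))" if "finite A" for n A
    using that
  proof (induction A)
    case empty
    then show ?case by (simp add: H_def G0)
  next
    case (insert k A)
    have "H (insert k A) = (\<lambda>z. (f k \<circ> \<phi>) z + H A z)" using insert by (auto simp: H_def)
    then have "G n (H (insert k A)) = G n (f k \<circ> \<phi>) + G n (H A)"
      using Gadd[OF chol[OF fhol[of k]] Hhol[of A]] by (simp only:)
    then show ?case by (simp only: sum.insert[OF insert(1,2)] insert(3))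
  qed
  \<comment> \<open>The whole head is one function bounded by \<open>b n\<close>, so it is estimated
    at once and not term by term.\<close>
  have low: "cmod (G n (H {..<N})) \<le> \<eta> n" if "N \<le> n" for n N
  proof (rule old[OF Hhol])
    fix z :: complex assume z: "z \<in> ball 0 1"
    then have "\<phi> z \<in> ball 0 1" using \<phi>(2) by blast
    then have "cmod (S N (\<phi> z)) \<le> b N" by (rule Sb)
    also have "\<dots> \<le> b n" by (rule bmono[OF that])
    finally show "cmod (H {..<N} z) \<le> b n" by (simp add: H_def S_def)
  qed
  \<comment> \<open>Block k was chosen with image means at most \<eta> k / B k, and B k \<ge> B (Suc
    n) since n < k.\<close>
  have high: "cmod (G n (f k \<circ> \<phi>)) \<le> \<eta> k" if "n < k" for n k
  proof -
    have "(\<integral>t. cmod ((f k \<circ> \<phi>) (of_real q * cis t)) \<partial>circ) \<le> \<eta> k / B k" if "0 \<le> q" "q < 1" for q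
      using small[OF that, of k] B1[of k] by (simp add: pos_le_divide_eq mult.commute)
    then have "cmod (G n (f k \<circ> \<phi>)) \<le> B (Suc n) * (\<eta> k / B k)" by (intro new chol fhol)
    also have "\<dots> \<le> B k * (\<eta> k / B k)"
      using B1[of k] \<eta>[of k] that by (intro mult_right_mono Bmono) auto
    also have "\<dots> = \<eta> k" using B1[of k] by simp
    finally show ?thesis .
  qed
  have main: "\<delta> / 4 \<le> cmod (G n (H {..<N}))" if nN: "n < N" for n N
  proof -
    have split: "{..<N} = {..<n} \<union> insert n {n<..<N}" using nN by auto
    have "sum g {..<N} = sum g {..<n} + (g n + sum g {n<..<N})" for g :: "nat \<Rightarrow> complex"
      unfolding split by (subst sum.union_disjoint) auto
    then have "G n (H {..<N}) = G n (H {..<n}) + (G n (f n \<circ> \<phi>) + (\<Sum>k\<in>{n<..<N}. G n (f k \<circ> \<phi>)))"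
      by (simp only: GH[OF finite_lessThan])
    moreover have "cmod (\<Sum>k\<in>{n<..<N}. G n (f k \<circ> \<phi>)) \<le> (\<Sum>k\<in>{n<..<N}. \<eta> k)"
      by (intro sum_norm_le high) auto
    moreover have "(\<Sum>k\<in>insert n {n<..<N}. \<eta> k) \<le> \<delta> / 4"
      using \<eta>sum[of "insert n {n<..<N}"] by simp
    then have "\<eta> n + (\<Sum>k\<in>{n<..<N}. \<eta> k) \<le> \<delta> / 4" by simp
    moreover have "cmod (G n (f n \<circ> \<phi>)) \<le> cmod (G n (H {..<n}) + (G n (f n \<circ> \<phi>) + (\<Sum>k\<in>{n<..<N}. G n (f k \<circ> \<phi>))))
       + cmod (G n (H {..<n})) + cmod (\<Sum>k\<in>{n<..<N}. G n (f k \<circ> \<phi>))"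
      by norm
    ultimately show ?thesis using diag[of n] low[of n n] by simp
  qed
  show False
  proof (rule no_triangular_system[OF Kc yK])
    show "G n \<in> ho_dual \<Psi>" for n
      unfolding ho_dual_def
    proof (intro CollectI conjI ballI allI exI[of _ 1])
      fix g h :: "complex \<Rightarrow> complex" and \<alpha> \<beta> :: complex assume "g \<in> hardy_orlicz \<Psi>" "h \<in> hardy_orlicz \<Psi>"
      then show "G n (\<lambda>z. \<alpha> * g z + \<beta> * h z) = \<alpha> * G n g + \<beta> * G n h"
        by (intro lin) (auto simp: hol_def hardy_orlicz_def)
    qed (use Gnorm in simp)
    show "cmod (G n h) \<le> ho_norm \<Psi> h" if "h \<in> hardy_orlicz \<Psi>" for n h by (rule Gnorm[OF that])
    show "0 < \<delta> / 4 / M" using \<delta> M by simp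
    show "\<delta> / 4 / M \<le> cmod (G n (y N))" if "n < N" for n N
      using divide_right_mono[OF main[OF that], of M] M by (simp add: Gy norm_mult norm_divide)
    show "(\<lambda>n. G n (y N)) \<longlonglongrightarrow> 0" for N
    proof (rule Lim_null_comparison)
      show "\<forall>\<^sub>F n in sequentially. norm (G n (y N)) \<le> 1 / M * \<eta> n"
        using eventually_ge_at_top[of N]
      proof eventually_elim
        case (elim n)
        then show ?case using low[OF elim] M by (simp add: Gy norm_mult norm_divide divide_right_mono)
      qed
      show "(\<lambda>n. 1 / M * \<eta> n) \<longlonglongrightarrow> 0" unfolding \<eta>_def by real_asymp
    qed
  qed
qed

end

theorem mainTheorem9:
  fixes \<Psi> :: "real \<Rightarrow> real" and \<phi> :: "complex \<Rightarrow> complex"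
  assumes "orlicz_fn \<Psi>" and "Delta0 \<Psi>"
    and "\<phi> holomorphic_on ball 0 1" and "\<phi> ` ball 0 1 \<subseteq> ball 0 1"
    and "ho_weakly_compact \<Psi> (comp_op \<phi>)"
  shows "((\<lambda>r. (SUP a\<in>sphere 0 1. ho_norm \<Psi> (comp_op \<phi> (u_fn a r)))
              * orlicz_inv \<Psi> (1 / (1 - r))) \<longlongrightarrow> 0) (at_left 1)"
proof (rule tendstoI)
  interpret orlicz \<Psi> by unfold_locales (rule assms(1))
  fix e :: real assume e: "0 < e"
  \<comment> \<open>The half restores the strict inequality that is lost in passing to the
    supremum.\<close>
  then have e2: "0 < e / 2" by simp
  obtain r0 where r0: "0 \<le> r0" "r0 < 1"
    "\<And>a r \<rho>. cmod a = 1 \<Longrightarrow> r0 < r \<Longrightarrow> r < 1 \<Longrightarrow> 0 \<le> \<rho> \<Longrightarrow> \<rho> < 1 \<Longrightarrow>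
      modular (\<lambda>t. of_real (orlicz_inv \<Psi> (1 / (1 - r))) * u_fn a r (\<phi> (of_real \<rho> * cis t)) / of_real (e / 2)) \<le> 1"
    using weakly_compact_modular_bound[OF assms(2-5) e2] by blast
  have "dist ((SUP a\<in>sphere 0 1. ho_norm \<Psi> (comp_op \<phi> (u_fn a r))) * orlicz_inv \<Psi> (1 / (1 - r))) 0 < e"
    if r: "r0 < r" "r < 1" for r
  proof -
    have r': "0 \<le> r" using r r0 by simp
    define c where "c = orlicz_inv \<Psi> (1 / (1 - r))"
    have c: "0 < c" unfolding c_def using r by (intro inv_pos) simp
    have norm: "0 \<le> ho_norm \<Psi> (comp_op \<phi> (u_fn a r))" "ho_norm \<Psi> (comp_op \<phi> (u_fn a r)) \<le> e / 2 / c" if a: "cmod a = 1" for a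
    proof -
      have "u_fn a r \<in> hardy_orlicz \<Psi>"
        unfolding hardy_orlicz_iff
      proof (intro conjI exI[of _ "1 / c"] allI impI)
        show "u_fn a r holomorphic_on ball 0 1" by (rule u_fn_holomorphic[OF a r' r(2)])
        show "modular (\<lambda>t. u_fn a r (of_real q * cis t) / of_real (1 / c)) \<le> 1" if "0 \<le> q" "q < 1" for q
          using modular_test_function[OF a r' r(2) that] by (simp add: c_def mult.commute)
      qed (use c in auto)
      then have H: "comp_op \<phi> (u_fn a r) \<in> hardy_orlicz \<Psi>" using assms(5) by (simp add: ho_weakly_compact_def)
      show "0 \<le> ho_norm \<Psi> (comp_op \<phi> (u_fn a r))" by (rule le_ho_normI[OF assms(2) H]) simp
      show "ho_norm \<Psi> (comp_op \<phi> (u_fn a r)) \<le> e / 2 / c"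
      proof (rule ho_norm_le[OF hardy_orlicz_subset_hardy2[OF assms(2) H]])
        fix q :: real assume q: "0 < q" "q < 1"
        have "(\<lambda>t. comp_op \<phi> (u_fn a r) (of_real q * cis t) / of_real (e / 2 / c))
            = (\<lambda>t. of_real c * u_fn a r (\<phi> (of_real q * cis t)) / of_real (e / 2))"
          using c e by (auto simp: comp_op_def field_simps)
        then show "modular (\<lambda>t. comp_op \<phi> (u_fn a r) (of_real q * cis t) / of_real (e / 2 / c)) \<le> 1"
          using r0(3)[OF a r, of q] q by (simp add: c_def)
      qed (use e c in simp)
    qed
    let ?s = "SUP a\<in>sphere 0 1. ho_norm \<Psi> (comp_op \<phi> (u_fn a r))"
    have ne: "sphere (0::complex) 1 \<noteq> {}" by simp
    have "?s \<le> e / 2 / c" by (rule cSUP_least[OF ne]) (use norm in auto)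
    \<comment> \<open>A real \<open>SUP\<close> dominates its members only for bounded families.
      With the bound at hand, the member at a = 1 shows that it is nonnegative.\<close>
    moreover have "0 \<le> ho_norm \<Psi> (comp_op \<phi> (u_fn 1 r))" by (rule norm) simp
    then have "0 \<le> ?s" by (rule order_trans, intro cSUP_upper bdd_aboveI2[where M="e / 2 / c"]) (use norm in auto)
    ultimately have "0 \<le> ?s * c" "?s * c \<le> e / 2" using c by (auto simp: pos_le_divide_eq)
    then show ?thesis using e unfolding c_def[symmetric] by simp
  qed
  then show "\<forall>\<^sub>F r in at_left 1. dist ((SUP a\<in>sphere 0 1. ho_norm \<Psi> (comp_op \<phi> (u_fn a r))) * orlicz_inv \<Psi> (1 / (1 - r))) 0 < e"
    unfolding eventually_at_left_field using r0(2) by blast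
qed

end
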